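(* Let $T$ be a self-similar interval exchange map with associated substitution $\sigma$ and matrix $M$. Assume that $M$ has an eigenvalue $\beta$ with $|\beta|>1$ such that $\beta_0=\beta/|\beta|$ is not a root of unity, and that there exists an eigenvector $\Gamma$ of $M$ for $\beta$ such that $T$ has the unique representation property for $\beta$ and $\Gamma$. Let $\gamma=z\Gamma$ be a good eigenvector, let $\tau=z/|z|\in\mathbb S^1$, and let $\omega\in\Omega_\sigma$ be a minimal sequence for $\gamma$ with prefix-suffix decomposition $(p_m,c_m,s_m)_{m\ge0}$. Then there exists $n\ge0$ such that: (1) $(\beta_0^{n}\tau,(p_n,c_n,s_n))$ belongs to a minimal component of $H$; (2) $(\beta_0^{m}\tau,(p_m,c_m,s_m))=H^{-m+n}(\beta_0^{n}\tau,(p_n,c_n,s_n))$ for all $m\ge n$, where negative powers of $H$ are powers of the inverse of the restriction of $H$ to that minimal component.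
   Context: **Self-similar i.e.m. and substitution.** Let $I=[0,1)$ and $\mathcal A$ a finite alphabet. An interval exchange map (i.e.m.) is a bijection $T\colon I\to I$ such that, for a partition $(I_a)_{a\in\mathcal A}$ of $I$ into (left-closed, right-open) intervals and a vector $\delta\in\mathbb R^{\mathcal A}$, $T(t)=t+\delta_a$ for $t\in I_a$. $T$ is self-similar (on $[0,\alpha)$, $0<\alpha<1$) if its first return map to $[0,\alpha)$ equals $T$ up to rescaling; it exchanges the intervals $I^{(1)}_a=\alpha I_a$, and $r_a$ is the first return time of $I_a^{(1)}$ to $[0,\alpha)$. The associated substitution $\sigma\colon\mathcal A\to\mathcal A^*\setminus\{\varepsilon\}$ ($\mathcal A^*$: finite words, $\varepsilon$: empty word) is given by $\sigma(a)=w_0\dots w_{r_a-1}$ where $T^m(I^{(1)}_a)\subseteq I_{w_m}$ for $0\le m\le r_a-1$ (it is part of the setting that this makes sense). $T$ is minimal and $\sigma$ is primitive. $M$ is the $\mathcal A\times\mathcal A$ matrix with $M_{a,b}$ = number of occurrences of $b$ in $\sigma(a)$. **Subshift, minimal sequences, prefix-suffix decomposition.** $\Omega_\sigma\subseteq\mathcal A^{\mathbb Z}$ is the set of two-sided sequences all of whose finite subwords are subwords of $\sigma^n(a)$ for some $n\ge0$, $a\in\mathcal A$; $S$ is the left shift. For $\gamma\in\mathbb C^{\mathcal A}$ and a word $w=w_0\dots w_{n-1}$ put $\gamma(w)=\gamma_{w_0}+\dots+\gamma_{w_{n-1}}$; for $\omega\in\Omega_\sigma$ put $\gamma_0(\omega)=0$,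 $\gamma_n(\omega)=\gamma(\omega_0\dots\omega_{n-1})$, $\gamma_{-n}(\omega)=-\gamma(\omega_{-n}\dots\omega_{-1})$ for $n\ge1$. $\omega$ is a minimal sequence for $\gamma$ if $\mathrm{Re}(\gamma_n(\omega))\ge0$ for all $n\in\mathbb Z$. The prefix-suffix decomposition of $\omega\in\Omega_\sigma$ is the unique sequence $(p_m,c_m,s_m)_{m\ge0}$ in $\mathcal A^*\times\mathcal A\times\mathcal A^*$ such that for all $m\ge0$, $\sigma(c_{m+1})=p_mc_ms_m$ and $\sigma^m(p_m)\dots\sigma(p_1)p_0\cdot c_0s_0\sigma(s_1)\dots\sigma^m(s_m)$ is the central part of $\omega$ (the dot separates negative and nonnegative coordinates). **Fractals.** Let $\bar{\mathcal A}_a=\{(p,c,s)\in\mathcal A^*\times\mathcal A\times\mathcal A^*:\sigma(a)=pcs\}$ and $\bar{\mathcal A}=\bigcup_a\bar{\mathcal A}_a$ (labels). Let $\mathcal S_a$ be the set of sequences $x=(p^x_m,c^x_m,s^x_m)_{m\ge1}\in\bar{\mathcal A}^{\mathbb N}$ with $(p^x_1,c^x_1,s^x_1)\in\bar{\mathcal A}_a$ and $(p^x_{m+1},c^x_{m+1},s^x_{m+1})\in\bar{\mathcal A}_{c^x_m}$ for $m\ge1$; let $\mathcal S_{a,(p,c,s)}$ be those with first coordinate $(p,c,s)$. Put $z_a(x)=\sum_{m\ge1}\beta^{-m}\Gamma(p^x_m)$, $F_a=z_a(\mathcal S_a)$, $F_{a,(p,c,s)}=z_a(\mathcal S_{a,(p,c,s)})$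 (compact subsets of $\mathbb C$). For $\tau\in\mathbb S^1$ (unit circle in $\mathbb C$) let $v_a(\tau)=\min_{z\in F_a}\mathrm{Re}(\tau z)$ and $v_{a,(p,c,s)}(\tau)=\min_{z\in F_{a,(p,c,s)}}\mathrm{Re}(\tau z)$. A point $z\in F_a$ is extreme for the direction $\tau$ if $\mathrm{Re}(\tau z)=v_a(\tau)$. **Unique representation property (u.r.p.)** for $\beta$ and $\Gamma$: for every $a\in\mathcal A$ and every extreme point $z\in F_a$ (for any direction) there is a unique $x\in\mathcal S_a$ with $z_a(x)=z$. **Good eigenvectors.** $\Psi_a$ is the set of $\tau\in\mathbb S^1$ such that $v_a(\tau)=v_{a,(p,c,s)}(\tau)=v_{a,(\bar p,\bar c,\bar s)}(\tau)$ for some different labels $(p,c,s),(\bar p,\bar c,\bar s)\in\bar{\mathcal A}_a$; $\Psi=\bigcup_a\Psi_a$. $\llbracket\tau-\tau'\rrbracket$ is the natural (arc-length) distance on $\mathbb S^1$. A direction $\tau\in\mathbb S^1$ is good if for some constant $1<A<|\beta|$ and every $\xi\in\Psi$, $\liminf_{n\to\infty}A^n\llbracket\xi-\beta_0^n\tau\rrbracket=\infty$. An eigenvector $\gamma$ of $M$ for $\beta$ is good if $\gamma=z\Gamma$ with $z\in\mathbb C\setminus\{0\}$ and $z/|z|$ a good direction. **The map $H$.** Let $X=\mathbb S^1\times\bar{\mathcal A}$ and $H\colon X\to X$, $H(\tau,(q,a,r))=(\beta_0^{-1}\tau,(p,c,s))$, where $(p,c,s)\in\bar{\mathcal A}_a$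 satisfies $v_a(\tau)=v_{a,(p,c,s)}(\tau)$. Under the u.r.p. the choice of $(p,c,s)$ is ambiguous for only finitely many $\tau$, and there it is made so that $H$ is right-continuous. **Minimal components.** Split $I=[0,1)$ into $|\bar{\mathcal A}|$ consecutive left-closed right-open intervals $I_{(p,c,s)}$ of equal length, one per label, and identify $\mathbb S^1\times\{(p,c,s)\}$ with $I_{(p,c,s)}$ by the orientation-preserving linear bijection sending $1\in\mathbb S^1$ to the left endpoint. Under this identification $H$ becomes a map $H\colon I\to I$ that is a translation on each of finitely many intervals. Let $\tilde H(t)=\lim_{s\nearrow t}H(s)$ be its left-continuous version, $D$ the set of discontinuities of $H$ together with their preimages and images by (iterates of) $\tilde H$, and $\hat I=I\cup\{t^-:t\in D\}\cup\{1\}$, where $t^-$ is a new point placed immediately to the left of $t$, with the order topology (compact metrizable). Let $\hat H\colon\hat I\to\hat I$ be the continuous map with $\hat H=H$ on $I$, $\hat H(t^-)=(\tilde H(t))^-$ for $t\in D$, and $\hat H(1)$ defined by continuity. A minimal component of $\hat H$ is a nonempty closed set $\hat J\subseteq \hat I$ with $\hat H(\hat J)=\hat J$ in which every point has dense $\hat H$-orbit. A minimal component of $H$ is a set $J=\hat J\cap I$ with $\hat J$ a minimal component of $\hat H$ (or the corresponding subset of $X$). Under the present hypotheses $H$ restricts to a bijection of each minimal component. *)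

theory Defs
  imports "HOL-Analysis.Analysis" "HOL-Library.Sublist"
begin

section \<open>Self-similar interval exchange maps and their substitutions\<close>

definition interval_exchange ::
    "(real \<Rightarrow> real) \<Rightarrow> ('a::finite \<Rightarrow> real set) \<Rightarrow> ('a \<Rightarrow> real) \<Rightarrow> bool" where
  "interval_exchange T P \<delta> \<longleftrightarrow>
     bij_betw T {0..<1} {0..<1} \<and>
     (\<forall>a. \<exists>l r. l < r \<and> P a = {l..<r}) \<and>
     disjoint_family P \<and> (\<Union>a. P a) = {0..<1} \<and>
     (\<forall>a. \<forall>t\<in>P a. T t = t + \<delta> a)"

text \<open>Orbits are two-sided here: \<open>s\<close> lies on the orbit of \<open>t\<close> iff one of the two points is a
  forward iterate of the other.\<close>

definition minimal_iem :: "(real \<Rightarrow> real) \<Rightarrow> bool" where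
  "minimal_iem T \<longleftrightarrow>
     (\<forall>t\<in>{0..<1}. {0..<1} \<subseteq> closure {s\<in>{0..<1}. \<exists>n. (T ^^ n) t = s \<or> (T ^^ n) s = t})"

definition first_return_time :: "('p \<Rightarrow> 'p) \<Rightarrow> 'p set \<Rightarrow> 'p \<Rightarrow> nat" where
  "first_return_time T A t = (LEAST n. 0 < n \<and> (T ^^ n) t \<in> A)"

definition first_return :: "('p \<Rightarrow> 'p) \<Rightarrow> 'p set \<Rightarrow> 'p \<Rightarrow> 'p" where
  "first_return T A t = (T ^^ first_return_time T A t) t"

definition self_similar_on :: "(real \<Rightarrow> real) \<Rightarrow> real \<Rightarrow> bool" where
  "self_similar_on T \<alpha> \<longleftrightarrow>
     0 < \<alpha> \<and> \<alpha> < 1 \<and>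
     (\<forall>t\<in>{0..<1}. (\<exists>n>0. (T ^^ n) (\<alpha> * t) \<in> {0..<\<alpha>}) \<and>
                  first_return T {0..<\<alpha>} (\<alpha> * t) = \<alpha> * T t)"

text \<open>The return time is required to be constant on each \<open>\<alpha> P a\<close>, and the word \<open>\<sigma> a\<close> records
  the intervals visited up to that time.\<close>

definition associated_substitution ::
    "(real \<Rightarrow> real) \<Rightarrow> ('a \<Rightarrow> real set) \<Rightarrow> real \<Rightarrow> ('a \<Rightarrow> 'a list) \<Rightarrow> bool" where
  "associated_substitution T P \<alpha> \<sigma> \<longleftrightarrow>
     (\<forall>a. \<forall>t\<in>P a. first_return_time T {0..<\<alpha>} (\<alpha> * t) = length (\<sigma> a) \<and>
                  (\<forall>m<length (\<sigma> a). (T ^^ m) (\<alpha> * t) \<in> P (\<sigma> a ! m)))"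

definition subst_iter :: "('a \<Rightarrow> 'a list) \<Rightarrow> nat \<Rightarrow> 'a list \<Rightarrow> 'a list" where
  "subst_iter \<sigma> n w = ((\<lambda>u. concat (map \<sigma> u)) ^^ n) w"

definition primitive_subst :: "('a \<Rightarrow> 'a list) \<Rightarrow> bool" where
  "primitive_subst \<sigma> \<longleftrightarrow> (\<exists>n>0. \<forall>a b. b \<in> set (subst_iter \<sigma> n [a]))"

definition subst_matrix :: "('a::finite \<Rightarrow> 'a list) \<Rightarrow> complex^'a^'a" where
  "subst_matrix \<sigma> = (\<chi> a b. of_nat (count_list (\<sigma> a) b))"

definition eigenvector :: "complex^'a^'a \<Rightarrow> complex \<Rightarrow> complex^'a::finite \<Rightarrow> bool" where
  "eigenvector M \<beta> v \<longleftrightarrow> v \<noteq> 0 \<and> M *v v = \<beta> *s v"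


section \<open>Subshift, minimal sequences, prefix-suffix decomposition\<close>

definition factor :: "(int \<Rightarrow> 'a) \<Rightarrow> int \<Rightarrow> nat \<Rightarrow> 'a list" where
  "factor \<omega> i n = map (\<lambda>k. \<omega> (i + int k)) [0..<n]"

definition subshift :: "('a \<Rightarrow> 'a list) \<Rightarrow> (int \<Rightarrow> 'a) set" where
  "subshift \<sigma> = {\<omega>. \<forall>i k. \<exists>n a. sublist (factor \<omega> i k) (subst_iter \<sigma> n [a])}"

definition word_sum :: "complex^'a \<Rightarrow> 'a::finite list \<Rightarrow> complex" where
  "word_sum \<gamma> w = sum_list (map (\<lambda>a. \<gamma> $ a) w)"

definition seq_sum :: "complex^'a \<Rightarrow> (int \<Rightarrow> 'a::finite) \<Rightarrow> int \<Rightarrow> complex" where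
  "seq_sum \<gamma> \<omega> n =
     (if 0 \<le> n then word_sum \<gamma> (factor \<omega> 0 (nat n)) else - word_sum \<gamma> (factor \<omega> n (nat (- n))))"

definition minimal_sequence :: "complex^'a \<Rightarrow> (int \<Rightarrow> 'a::finite) \<Rightarrow> bool" where
  "minimal_sequence \<gamma> \<omega> \<longleftrightarrow> (\<forall>n. 0 \<le> Re (seq_sum \<gamma> \<omega> n))"

type_synonym 'a label = "'a list \<times> 'a \<times> 'a list"

abbreviation prefix_of :: "'a label \<Rightarrow> 'a list" where "prefix_of x \<equiv> fst x"
abbreviation center_of :: "'a label \<Rightarrow> 'a" where "center_of x \<equiv> fst (snd x)"
abbreviation suffix_of :: "'a label \<Rightarrow> 'a list" where "suffix_of x \<equiv> snd (snd x)"

definition labels_of :: "('a \<Rightarrow> 'a list) \<Rightarrow> 'a \<Rightarrow> 'a label set" where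
  "labels_of \<sigma> a = {(p, c, s). \<sigma> a = p @ c # s}"

definition labels :: "('a \<Rightarrow> 'a list) \<Rightarrow> 'a label set" where
  "labels \<sigma> = (\<Union>a. labels_of \<sigma> a)"

definition left_word :: "('a \<Rightarrow> 'a list) \<Rightarrow> (nat \<Rightarrow> 'a label) \<Rightarrow> nat \<Rightarrow> 'a list" where
  "left_word \<sigma> d m = concat (map (\<lambda>j. subst_iter \<sigma> j (prefix_of (d j))) (rev [0..<Suc m]))"

definition right_word :: "('a \<Rightarrow> 'a list) \<Rightarrow> (nat \<Rightarrow> 'a label) \<Rightarrow> nat \<Rightarrow> 'a list" where
  "right_word \<sigma> d m =
     center_of (d 0) # concat (map (\<lambda>j. subst_iter \<sigma> j (suffix_of (d j))) [0..<Suc m])"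

definition prefix_suffix_decomposition ::
    "('a \<Rightarrow> 'a list) \<Rightarrow> (int \<Rightarrow> 'a) \<Rightarrow> (nat \<Rightarrow> 'a label) \<Rightarrow> bool" where
  "prefix_suffix_decomposition \<sigma> \<omega> d \<longleftrightarrow>
     (\<forall>m. d m \<in> labels_of \<sigma> (center_of (d (Suc m)))) \<and>
     (\<forall>m. factor \<omega> (- int (length (left_word \<sigma> d m))) (length (left_word \<sigma> d m)) = left_word \<sigma> d m \<and>
          factor \<omega> 0 (length (right_word \<sigma> d m)) = right_word \<sigma> d m)"


section \<open>Fractals, unique representation property, good eigenvectors\<close>

text \<open>Paths are indexed from 0: \<open>x m\<close> is the coordinate of index \<open>m + 1\<close>, whence the exponents in
  \<open>path_point\<close>.\<close>

definition paths :: "('a \<Rightarrow> 'a list) \<Rightarrow> 'a \<Rightarrow> (nat \<Rightarrow> 'a label) set" where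
  "paths \<sigma> a = {x. x 0 \<in> labels_of \<sigma> a \<and> (\<forall>m. x (Suc m) \<in> labels_of \<sigma> (center_of (x m)))}"

definition path_point :: "complex \<Rightarrow> complex^'a \<Rightarrow> (nat \<Rightarrow> 'a::finite label) \<Rightarrow> complex" where
  "path_point \<beta> \<Gamma> x = (\<Sum>m. inverse \<beta> ^ (Suc m) * word_sum \<Gamma> (prefix_of (x m)))"

definition fractal ::
    "('a \<Rightarrow> 'a list) \<Rightarrow> complex \<Rightarrow> complex^'a \<Rightarrow> 'a::finite \<Rightarrow> complex set" where
  "fractal \<sigma> \<beta> \<Gamma> a = path_point \<beta> \<Gamma> ` paths \<sigma> a"

definition subfractal ::
    "('a \<Rightarrow> 'a list) \<Rightarrow> complex \<Rightarrow> complex^'a \<Rightarrow> 'a::finite \<Rightarrow> 'a label \<Rightarrow> complex set" where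
  "subfractal \<sigma> \<beta> \<Gamma> a l = path_point \<beta> \<Gamma> ` {x \<in> paths \<sigma> a. x 0 = l}"

text \<open>Applied to nonempty compact sets only, so the infimum is a minimum.\<close>

definition min_Re :: "complex set \<Rightarrow> complex \<Rightarrow> real" where
  "min_Re F \<tau> = (INF z\<in>F. Re (\<tau> * z))"

definition extreme_for :: "complex set \<Rightarrow> complex \<Rightarrow> complex \<Rightarrow> bool" where
  "extreme_for F \<tau> z \<longleftrightarrow> z \<in> F \<and> Re (\<tau> * z) = min_Re F \<tau>"

definition unique_representation ::
    "('a \<Rightarrow> 'a list) \<Rightarrow> complex \<Rightarrow> complex^'a::finite \<Rightarrow> bool" where
  "unique_representation \<sigma> \<beta> \<Gamma> \<longleftrightarrow>
     (\<forall>a. \<forall>\<tau>\<in>sphere 0 1. \<forall>z. extreme_for (fractal \<sigma> \<beta> \<Gamma> a) \<tau> z \<longrightarrow>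
        (\<exists>!x. x \<in> paths \<sigma> a \<and> path_point \<beta> \<Gamma> x = z))"

definition minimizing_label ::
    "('a \<Rightarrow> 'a list) \<Rightarrow> complex \<Rightarrow> complex^'a \<Rightarrow> 'a::finite \<Rightarrow> complex \<Rightarrow> 'a label \<Rightarrow> bool" where
  "minimizing_label \<sigma> \<beta> \<Gamma> a \<tau> l \<longleftrightarrow>
     l \<in> labels_of \<sigma> a \<and> min_Re (fractal \<sigma> \<beta> \<Gamma> a) \<tau> = min_Re (subfractal \<sigma> \<beta> \<Gamma> a l) \<tau>"

definition ambiguous_directions ::
    "('a \<Rightarrow> 'a list) \<Rightarrow> complex \<Rightarrow> complex^'a::finite \<Rightarrow> complex set" where
  "ambiguous_directions \<sigma> \<beta> \<Gamma> =
     (\<Union>a. {\<tau>\<in>sphere 0 1. \<exists>l l'. l \<noteq> l' \<and>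
               minimizing_label \<sigma> \<beta> \<Gamma> a \<tau> l \<and> minimizing_label \<sigma> \<beta> \<Gamma> a \<tau> l'})"

definition arc_dist :: "complex \<Rightarrow> complex \<Rightarrow> real" where
  "arc_dist \<tau> \<tau>' = \<bar>Arg (\<tau> / \<tau>')\<bar>"

definition good_direction ::
    "('a \<Rightarrow> 'a list) \<Rightarrow> complex \<Rightarrow> complex^'a::finite \<Rightarrow> complex \<Rightarrow> bool" where
  "good_direction \<sigma> \<beta> \<Gamma> \<tau> \<longleftrightarrow>
     \<tau> \<in> sphere 0 1 \<and>
     (\<exists>A. 1 < A \<and> A < cmod \<beta> \<and>
        (\<forall>\<xi>\<in>ambiguous_directions \<sigma> \<beta> \<Gamma>.
           liminf (\<lambda>n. ereal (A ^ n * arc_dist \<xi> (sgn \<beta> ^ n * \<tau>))) = \<infinity>))"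

definition good_eigenvector ::
    "('a \<Rightarrow> 'a list) \<Rightarrow> complex \<Rightarrow> complex^'a::finite \<Rightarrow> complex^'a \<Rightarrow> bool" where
  "good_eigenvector \<sigma> \<beta> \<Gamma> \<gamma> \<longleftrightarrow>
     eigenvector (subst_matrix \<sigma>) \<beta> \<gamma> \<and>
     (\<exists>z. z \<noteq> 0 \<and> \<gamma> = z *s \<Gamma> \<and> good_direction \<sigma> \<beta> \<Gamma> (sgn z))"


section \<open>The map \<open>H\<close> and its minimal components\<close>

definition phase_space :: "('a \<Rightarrow> 'a list) \<Rightarrow> (complex \<times> 'a label) set" where
  "phase_space \<sigma> = sphere 0 1 \<times> labels \<sigma>"

text \<open>Right-continuity refers to the counterclockwise orientation of the circle and the discrete
  topology on labels. The circle component of \<open>H\<close> is a rotation, so only the label component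
  matters, and for it right-continuity means being constant on a right neighbourhood.\<close>

definition minimizing_map ::
    "('a \<Rightarrow> 'a list) \<Rightarrow> complex \<Rightarrow> complex^'a::finite \<Rightarrow>
     (complex \<times> 'a label \<Rightarrow> complex \<times> 'a label) \<Rightarrow> bool" where
  "minimizing_map \<sigma> \<beta> \<Gamma> H \<longleftrightarrow>
     (\<forall>(\<tau>, l)\<in>phase_space \<sigma>.
        fst (H (\<tau>, l)) = inverse (sgn \<beta>) * \<tau> \<and>
        minimizing_label \<sigma> \<beta> \<Gamma> (center_of l) \<tau> (snd (H (\<tau>, l))) \<and>
        (\<forall>\<^sub>F \<theta> in at_right 0. snd (H (\<tau> * cis \<theta>, l)) = snd (H (\<tau>, l))))"

text \<open>\<open>e\<close> numbers the labels from left to right along \<open>[0,1)\<close>.\<close>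

definition to_interval ::
    "('a \<Rightarrow> 'a list) \<Rightarrow> ('a label \<Rightarrow> nat) \<Rightarrow> complex \<times> 'a label \<Rightarrow> real" where
  "to_interval \<sigma> e = (\<lambda>(\<tau>, l). (real (e l) + Arg2pi \<tau> / (2 * pi)) / real (card (labels \<sigma>)))"

definition interval_map ::
    "('a \<Rightarrow> 'a list) \<Rightarrow> ('a label \<Rightarrow> nat) \<Rightarrow> (complex \<times> 'a label \<Rightarrow> complex \<times> 'a label) \<Rightarrow> real \<Rightarrow> real" where
  "interval_map \<sigma> e H t = to_interval \<sigma> e (H (inv_into (phase_space \<sigma>) (to_interval \<sigma> e) t))"

definition left_version :: "(real \<Rightarrow> real) \<Rightarrow> real \<Rightarrow> real" where
  "left_version h t = Lim (at_left t) h"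

text \<open>The set \<open>D\<close> of points of \<open>(0,1]\<close> to be doubled. Images and preimages are taken repeatedly and
  in any order: since the left-continuous version need not be injective, the union of the forward
  and of the backward orbits of the discontinuities need not be closed under preimages, and without
  that the extension of \<open>h\<close> to the split interval would not be continuous.\<close>

inductive_set doubled_points :: "(real \<Rightarrow> real) \<Rightarrow> real set" for h where
  discontinuity: "t \<in> {0..<1} \<Longrightarrow> \<not> continuous (at t within {0..<1}) h \<Longrightarrow> t \<in> doubled_points h"
| image: "t \<in> doubled_points h \<Longrightarrow> left_version h t \<in> doubled_points h"
| preimage: "t \<in> {0<..1} \<Longrightarrow> left_version h t \<in> doubled_points h \<Longrightarrow> t \<in> doubled_points h"

text \<open>\<open>Left_of t\<close> is \<open>t\<^sup>-\<close>. The right end point 1 of the split interval is represented by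
  \<open>Left_of 1\<close>; so \<open>1\<^sup>-\<close> and 1 are the same point, also if 1 is in \<open>D\<close>.\<close>

datatype split_point = Point real | Left_of real

fun split_less :: "split_point \<Rightarrow> split_point \<Rightarrow> bool" where
  "split_less (Point s) (Point t) \<longleftrightarrow> s < t"
| "split_less (Left_of s) (Left_of t) \<longleftrightarrow> s < t"
| "split_less (Left_of s) (Point t) \<longleftrightarrow> s \<le> t"
| "split_less (Point s) (Left_of t) \<longleftrightarrow> s < t"

definition split_interval :: "(real \<Rightarrow> real) \<Rightarrow> split_point set" where
  "split_interval h = Point ` {0..<1} \<union> Left_of ` (doubled_points h \<union> {1})"

text \<open>The order topology, generated by the open rays.\<close>

definition split_topology :: "(real \<Rightarrow> real) \<Rightarrow> split_point topology" where
  "split_topology h =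
     topology_generated_by
       ((\<lambda>x. {y\<in>split_interval h. split_less y x}) ` split_interval h \<union>
        (\<lambda>x. {y\<in>split_interval h. split_less x y}) ` split_interval h)"

text \<open>The value at the end point 1 is determined by continuity.\<close>

definition split_extension :: "(real \<Rightarrow> real) \<Rightarrow> (split_point \<Rightarrow> split_point) \<Rightarrow> bool" where
  "split_extension h G \<longleftrightarrow>
     continuous_map (split_topology h) (split_topology h) G \<and>
     (\<forall>t\<in>{0..<1}. G (Point t) = Point (h t)) \<and>
     (\<forall>t\<in>doubled_points h. G (Left_of t) = Left_of (left_version h t))"

definition minimal_subsystem :: "'p topology \<Rightarrow> ('p \<Rightarrow> 'p) \<Rightarrow> 'p set \<Rightarrow> bool" where
  "minimal_subsystem X G K \<longleftrightarrow>
     K \<noteq> {} \<and> closedin X K \<and> G ` K = K \<and>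
     (\<forall>x\<in>K. K \<subseteq> X closure_of (range (\<lambda>n. (G ^^ n) x)))"

definition minimal_component ::
    "('a \<Rightarrow> 'a list) \<Rightarrow> ('a label \<Rightarrow> nat) \<Rightarrow> (complex \<times> 'a label \<Rightarrow> complex \<times> 'a label) \<Rightarrow>
     (complex \<times> 'a label) set \<Rightarrow> bool" where
  "minimal_component \<sigma> e H J \<longleftrightarrow>
     (\<exists>G K. split_extension (interval_map \<sigma> e H) G \<and>
        minimal_subsystem (split_topology (interval_map \<sigma> e H)) G K \<and>
        J = {x\<in>phase_space \<sigma>. Point (to_interval \<sigma> e x) \<in> K})"

end

theory Submission
  imports Defs "HOL-Analysis.Kronecker_Approximation_Theorem" "HOL-Library.Diagonal_Subsequence"
begin

text \<open>Write \<open>\<beta>\<^sub>0 = sgn \<beta>\<close> and \<open>x\<^sub>m = (\<beta>\<^sub>0 ^ m * \<tau>, d m)\<close>. The proof has two halves.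

  The first half shows \<open>H x\<^sub>m\<^sub>+\<^sub>1 = x\<^sub>m\<close> for all large \<open>m\<close>. Let \<open>a\<close> be the centre of
  \<open>d (m + 1)\<close>. The word \<open>\<sigma> ^ (m + 1) a\<close> sits in \<open>\<omega>\<close> around the origin, and its prefixes are coded by the
  paths of length \<open>m + 1\<close> from \<open>a\<close>. Minimality of \<open>\<omega>\<close> says that the path \<open>d m, \<dots>, d 0\<close> is the best one
  in direction \<open>\<beta>\<^sub>0 ^ (m + 1) * \<tau>\<close>; after division by \<open>\<beta> ^ (m + 1)\<close> a path of that length determines
  a point of the fractal up to an error of order \<open>\<bar>\<beta>\<bar> ^ (-m)\<close>, so the piece of the fractal of \<open>a\<close> with label
  \<open>d m\<close> nearly attains the minimum (\<open>minimal_sequence_nearly_minimizes\<close>). On the other hand, when the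
  direction is rotated away from an ambiguous one, the minima of two competing pieces separate linearly
  in the angle: their one-sided derivatives are governed by the end points of the exposed faces, and these
  differ because distinct pieces share no extreme point (\<open>one_sided_unique_minimizer\<close>). A good
  direction stays so far from the ambiguous directions that this linear gap exceeds the error, which
  forces \<open>d m\<close> to be the label chosen by \<open>H\<close> (\<open>nearly_minimizing_label_forced\<close>).

  The second half shows that a full backward orbit \<open>x\<close> of \<open>H\<close> lies in one minimal component. \<open>H\<close> is a
  finite extension of an irrational rotation, and its label component is locally constant on each side of
  every point. For each point \<open>\<tau>\<close> of the circle and each side, consider the set of labels with which \<open>x\<close>
  accumulates at \<open>\<tau>\<close> from that side. These sets form an invariant and upper semicontinuous field of
  finite sets. The number of labels cannot increase along the rotation, and near a point where it is minimal
  it is minimal as well; since every orbit of the rotation is dense, it is constant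
  (\<open>card_field_constant\<close>). Consequently the field is locally constant, \<open>H\<close> is
  injective on it, it has finitely many jumps, and any orbit inside it accumulates on all of it
  (\<open>accumulation_of_orbit_in_field\<close>). Local constancy also puts the points of \<open>x\<close> themselves into the field.

  It remains to transport this to the split interval. The only obstruction to the field being closed and
  invariant there is a point that lies in it from the left, is not doubled, and does not lie in it from
  the right. The backward chain of such a point would pass through infinitely many jumps
  (\<open>left_part_not_doubled\<close>).\<close>

section \<open>One-sided neighbourhoods on the circle\<close>

text \<open>The filter of one-sided punctured neighbourhoods of \<open>\<tau>\<close> in the circle: counterclockwise for \<open>s = 1\<close>,
  clockwise for \<open>s = -1\<close>. Indexing the sides by a sign lets one argument serve both of them.\<close>

definition side :: "real \<Rightarrow> complex \<Rightarrow> complex filter" where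
  "side s \<tau> = filtermap (\<lambda>\<theta>. \<tau> * cis (s * \<theta>)) (at_right 0)"

lemma eventually_side:
  "eventually P (side s \<tau>) \<longleftrightarrow> (\<exists>\<epsilon>>0. \<forall>\<theta>. 0 < \<theta> \<and> \<theta> < \<epsilon> \<longrightarrow> P (\<tau> * cis (s * \<theta>)))"
  unfolding side_def eventually_filtermap eventually_at_right_field by auto

lemma side_not_bot [simp]: "side s \<tau> \<noteq> bot"
  by (simp add: side_def filtermap_bot_iff)

lemma side_mult: "side s (\<rho> * \<tau>) = filtermap ((*) \<rho>) (side s \<tau>)"
  unfolding side_def filtermap_filtermap by (simp add: mult.assoc)

lemma eventually_side_unit:
  assumes "cmod \<tau> = 1"
  shows "\<forall>\<^sub>F t in side s \<tau>. cmod t = 1"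
  using assms by (auto simp: eventually_side norm_mult intro: exI[of _ 1])

text \<open>An arc adjacent to a point is open: it also contains both sides of each of its points.\<close>

lemma eventually_side_side:
  assumes "\<forall>\<^sub>F t in side s \<tau>. P t" and s: "s \<in> {1,-1}"
  shows "\<forall>\<^sub>F t in side s \<tau>. \<forall>r\<in>{1,-1}. \<forall>\<^sub>F t' in side r t. P t'"
proof -
  obtain \<epsilon> where \<epsilon>: "\<epsilon> > 0" "\<And>\<theta>. 0 < \<theta> \<Longrightarrow> \<theta> < \<epsilon> \<Longrightarrow> P (\<tau> * cis (s * \<theta>))"
    using assms(1) unfolding eventually_side by auto
  have "\<exists>\<eta>>0. \<forall>\<theta>'. 0 < \<theta>' \<and> \<theta>' < \<eta> \<longrightarrow> P (\<tau> * cis (s * \<theta>) * cis (r * \<theta>'))"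
    if \<theta>: "0 < \<theta>" "\<theta> < \<epsilon>" and r: "r \<in> {1,-1}" for \<theta> r
  proof (intro exI[of _ "min \<theta> (\<epsilon> - \<theta>)"] conjI allI impI)
    fix \<theta>' assume \<theta>': "0 < \<theta>' \<and> \<theta>' < min \<theta> (\<epsilon> - \<theta>)"
    have "s * \<theta> + r * \<theta>' = s * (\<theta> + s * r * \<theta>')" using s by auto
    then have eq: "cis (s * \<theta>) * cis (r * \<theta>') = cis (s * (\<theta> + s * r * \<theta>'))"
      by (simp add: cis_mult)
    have "0 < \<theta> + s * r * \<theta>'" "\<theta> + s * r * \<theta>' < \<epsilon>" using s r \<theta> \<theta>' by auto
    from \<epsilon>(2)[OF this] show "P (\<tau> * cis (s * \<theta>) * cis (r * \<theta>'))"
      by (simp add: eq mult.assoc)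
  qed (use \<theta> in auto)
  then show ?thesis using \<epsilon>(1) unfolding eventually_side by blast
qed

lemma circle_neighbourhood:
  assumes "cmod \<tau> = 1" and "\<tau> \<in> A" and "\<And>s. s \<in> {1,-1} \<Longrightarrow> \<forall>\<^sub>F t in side s \<tau>. t \<in> A"
  shows "\<exists>U. open U \<and> \<tau> \<in> U \<and> U \<inter> sphere 0 1 \<subseteq> A"
proof -
  obtain \<epsilon>1 where 1: "\<epsilon>1 > 0" "\<And>\<theta>. 0 < \<theta> \<Longrightarrow> \<theta> < \<epsilon>1 \<Longrightarrow> \<tau> * cis \<theta> \<in> A"
    using assms(3)[of 1] by (auto simp: eventually_side)
  obtain \<epsilon>2 where 2: "\<epsilon>2 > 0" "\<And>\<theta>. 0 < \<theta> \<Longrightarrow> \<theta> < \<epsilon>2 \<Longrightarrow> \<tau> * cis (- \<theta>) \<in> A"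
    using assms(3)[of "-1"] by (auto simp: eventually_side)
  have \<tau>0: "\<tau> \<noteq> 0" using assms(1) by auto
  have "isCont (\<lambda>t. Arg (t / \<tau>)) \<tau>"
    using \<tau>0 by (intro continuous_intros isCont_o2[OF _ continuous_at_Arg]) (auto simp: complex_nonpos_Reals_iff)
  moreover have "Arg (\<tau> / \<tau>) = 0" using \<tau>0 by simp
  ultimately have "(\<lambda>t. Arg (t / \<tau>)) \<midarrow>\<tau>\<rightarrow> 0" by (metis isCont_def)
  then obtain \<delta> where \<delta>: "\<delta> > 0" "\<And>t. t \<noteq> \<tau> \<Longrightarrow> dist t \<tau> < \<delta> \<Longrightarrow> \<bar>Arg (t / \<tau>)\<bar> < min \<epsilon>1 \<epsilon>2"
    using 1(1) 2(1) unfolding LIM_def by (metis diff_zero dist_real_def min_less_iff_conj)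
  have "t \<in> A" if t: "dist t \<tau> < \<delta>" "cmod t = 1" for t
  proof (cases "t = \<tau>")
    case False
    have "cmod (t / \<tau>) = 1" using t assms(1) by (simp add: norm_divide)
    then have "t / \<tau> = cis (Arg (t / \<tau>))"
      by (metis cis_conv_exp complex_norm_eq_1_exp_eq)
    then have eq: "t = \<tau> * cis (Arg (t / \<tau>))" using \<tau>0 by (simp add: field_simps)
    have b: "\<bar>Arg (t / \<tau>)\<bar> < min \<epsilon>1 \<epsilon>2" using \<delta>(2) False t by auto
    consider "Arg (t / \<tau>) > 0" | "Arg (t / \<tau>) = 0" | "Arg (t / \<tau>) < 0" by linarith
    then show ?thesis
    proof cases
      case 1 then show ?thesis using \<open>\<And>\<theta>. 0 < \<theta> \<Longrightarrow> \<theta> < \<epsilon>1 \<Longrightarrow> \<tau> * cis \<theta> \<in> A\<close>[of "Arg (t / \<tau>)"] b eq by auto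
    next
      case 2 then show ?thesis using eq False by auto
    next
      case 3 then show ?thesis using 2(2)[of "- Arg (t / \<tau>)"] b eq by auto
    qed
  qed (use assms(2) in auto)
  then show ?thesis using \<delta>(1)
    by (intro exI[of _ "ball \<tau> \<delta>"]) (auto simp: dist_commute)
qed

text \<open>Compactness in the form in which local statements about one-sided neighbourhoods are globalized: a
  property that passes to subsets and finite unions and holds locally holds for the whole circle.\<close>

lemma circle_compactness:
  assumes empty: "Q {}" and un: "\<And>A B. Q A \<Longrightarrow> Q B \<Longrightarrow> Q (A \<union> B)"
    and mono: "\<And>A B. Q B \<Longrightarrow> A \<subseteq> B \<Longrightarrow> Q A"
    and loc: "\<And>\<tau>. cmod \<tau> = 1 \<Longrightarrow>
      \<exists>A. Q A \<and> \<tau> \<in> A \<and> (\<forall>s\<in>{1,-1}. \<forall>\<^sub>F t in side s \<tau>. t \<in> A)"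
  shows "Q (sphere 0 1)"
proof -
  have "\<exists>U. open U \<and> \<tau> \<in> U \<and> Q (U \<inter> sphere 0 1)" if "\<tau> \<in> sphere 0 1" for \<tau>
    using that loc[of \<tau>] circle_neighbourhood[of \<tau>] mono by (metis mem_sphere_0)
  then obtain U where U: "\<And>\<tau>. \<tau> \<in> sphere 0 1 \<Longrightarrow> open (U \<tau>) \<and> \<tau> \<in> U \<tau> \<and> Q (U \<tau> \<inter> sphere 0 1)"
    by metis
  obtain C where C: "C \<subseteq> sphere 0 1" "finite C" "sphere 0 1 \<subseteq> (\<Union>\<tau>\<in>C. U \<tau>)"
    by (rule compactE_image[of "sphere (0::complex) 1" "sphere 0 1" U])
      (use U in \<open>auto simp: compact_sphere\<close>)
  have "finite C \<Longrightarrow> C \<subseteq> sphere 0 1 \<Longrightarrow> Q (\<Union>\<tau>\<in>C. U \<tau> \<inter> sphere 0 1)"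
    by (induction C rule: finite_induct) (use U empty un in auto)
  then have "Q (\<Union>\<tau>\<in>C. U \<tau> \<inter> sphere 0 1)" using C by blast
  then show ?thesis by (rule mono) (use C in blast)
qed

text \<open>Kronecker's theorem. A small arc on one side of \<open>\<tau>\<close> is open, so density of the orbit suffices to hit it
  infinitely often.\<close>

lemma rotation_orbit_dense:
  assumes \<rho>: "cmod \<rho> = 1" and irr: "\<forall>n>0. \<rho> ^ n \<noteq> 1"
    and t: "cmod t = 1" and \<tau>: "cmod \<tau> = 1" and s: "s \<in> {1,-1}"
    and P: "\<forall>\<^sub>F t in side s \<tau>. P t"
  shows "\<exists>\<^sub>F m in sequentially. P (\<rho> ^ m * t)"
  unfolding frequently_sequentially
proof
  fix M
  obtain \<epsilon> where \<epsilon>: "\<epsilon> > 0" "\<And>\<theta>. 0 < \<theta> \<Longrightarrow> \<theta> < \<epsilon> \<Longrightarrow> P (\<tau> * cis (s * \<theta>))"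
    using P unfolding eventually_side by auto
  define \<alpha> where "\<alpha> = Arg \<rho> / (2 * pi)"
  have \<rho>\<alpha>: "\<rho> = cis (2 * pi * \<alpha>)"
    using \<rho> complex_norm_eq_1_exp_eq[of \<rho>] by (simp add: \<alpha>_def cis_conv_exp)
  have \<alpha>: "\<alpha> \<notin> \<rat>"
  proof
    assume "\<alpha> \<in> \<rat>"
    then obtain a b where ab: "b > 0" "\<alpha> = of_int a / of_int b" by (metis Rats_cases')
    have "\<rho> ^ nat b = cis (2 * pi * of_int a)"
      using ab by (simp add: \<rho>\<alpha> Complex.DeMoivre)
    also have "\<dots> = 1" by (simp add: complex_eq_iff sin_int_2pin cos_int_2pin)
    finally show False using irr ab by auto
  qed
  define w where "w = \<tau> / (\<rho> ^ M * t)"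
  have \<rho>0: "\<rho> \<noteq> 0" "t \<noteq> 0" using \<rho> t by auto
  have "cmod w = 1" using \<rho> t \<tau> by (simp add: w_def norm_divide norm_mult norm_power)
  then have w: "w = cis (Arg w)" by (metis cis_conv_exp complex_norm_eq_1_exp_eq)
  define y where "y = (Arg w + s * (\<epsilon> / 2)) / (2 * pi)"
  have "\<epsilon> / (4 * pi) > 0" using \<epsilon> by simp
  then obtain k where k: "k > 0" "\<bar>frac (real k * \<alpha>) - frac y\<bar> < \<epsilon> / (4 * pi)"
    using Kronecker_approx_1_explicit[OF \<alpha>, of "frac y"]
    by (metis frac_ge_0 frac_lt_1 less_imp_le)
  \<comment> \<open>\<open>y\<close> aims at the middle of the arc; the Kronecker error moves the angle by less than \<open>\<epsilon> / 2\<close>\<close>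
  define \<theta> where "\<theta> = \<epsilon> / 2 + s * (2 * pi * (frac (real k * \<alpha>) - frac y))"
  have "\<bar>2 * pi * x\<bar> < \<epsilon> / 2" if "\<bar>x\<bar> < \<epsilon> / (4 * pi)" for x
    using that by (simp add: abs_mult field_simps)
  from this[OF k(2)] have "\<bar>2 * pi * (frac (real k * \<alpha>) - frac y)\<bar> < \<epsilon> / 2" .
  then have \<theta>: "0 < \<theta>" "\<theta> < \<epsilon>" using s by (auto simp: \<theta>_def)
  have ss: "s * s = 1" using s by auto
  have cf: "cis (2 * pi * frac x) = cis (2 * pi * x)" for x
  proof -
    have "cis (2 * pi * frac x) = cis (2 * pi * x) / cis (2 * pi * of_int \<lfloor>x\<rfloor>)"
      by (simp add: cis_divide frac_def algebra_simps)
    also have "cis (2 * pi * of_int \<lfloor>x\<rfloor>) = 1" by (simp add: complex_eq_iff sin_int_2pin cos_int_2pin)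
    finally show ?thesis by simp
  qed
  have "s * \<theta> = s * \<epsilon> / 2 + (s * s) * (2 * pi * (frac (real k * \<alpha>) - frac y))"
    by (simp add: \<theta>_def algebra_simps)
  then have "s * \<theta> = s * \<epsilon> / 2 + (2 * pi * frac (real k * \<alpha>) - 2 * pi * frac y)"
    unfolding ss by (simp add: algebra_simps)
  then have "cis (s * \<theta>) = cis (s * \<epsilon> / 2) * (cis (2 * pi * frac (real k * \<alpha>)) / cis (2 * pi * frac y))"
    by (simp only: cis_mult cis_divide)
  also have "\<dots> = cis (s * \<epsilon> / 2) * (cis (2 * pi * (real k * \<alpha>)) / cis (2 * pi * y))"
    by (simp only: cf)
  also have "cis (2 * pi * y) = cis (Arg w) * cis (s * \<epsilon> / 2)" by (simp add: y_def cis_mult)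
  also have "cis (2 * pi * (real k * \<alpha>)) = \<rho> ^ k" by (simp add: \<rho>\<alpha> Complex.DeMoivre mult_ac)
  finally have "cis (s * \<theta>) = \<rho> ^ k / w" using w by (simp add: field_simps)
  then have "\<tau> * cis (s * \<theta>) = \<rho> ^ (M + k) * t"
    using \<rho>0 \<tau> by (auto simp: w_def field_simps power_add)
  then show "\<exists>m\<ge>M. P (\<rho> ^ m * t)" using \<epsilon>(2)[OF \<theta>] by (metis le_add1)
qed

section \<open>Finite extensions of an irrational rotation\<close>

text \<open>\<open>\<phi> 1\<close> and \<open>\<phi> (-1)\<close> are the right- and the left-continuous version of one and the same action on the
  labels, over the rotation by \<open>\<rho>\<close>: on side \<open>s\<close> of \<open>\<tau>\<close>, both versions equal the limit \<open>\<phi> s \<tau>\<close>.\<close>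

locale rotation_extension =
  fixes L :: "'l set" and \<rho> :: complex and \<phi> :: "real \<Rightarrow> complex \<Rightarrow> 'l \<Rightarrow> 'l"
  assumes finite_L: "finite L"
    and norm_\<rho>: "cmod \<rho> = 1" and irrational: "\<forall>n>0. \<rho> ^ n \<noteq> 1"
    and \<phi>_in: "\<lbrakk>cmod \<tau> = 1; s \<in> {1,-1}; l \<in> L\<rbrakk> \<Longrightarrow> \<phi> s \<tau> l \<in> L"
    and \<phi>_near: "\<lbrakk>cmod \<tau> = 1; s \<in> {1,-1}; l \<in> L\<rbrakk> \<Longrightarrow>
      \<forall>\<^sub>F t in side s \<tau>. \<forall>r\<in>{1,-1}. \<phi> r t l = \<phi> s \<tau> l"
begin

text \<open>\<open>Y s \<tau>\<close> plays the role of the labels \<open>l\<close> for which the point \<open>(\<tau>, l)\<close>, seen from side \<open>s\<close>, belongs to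
  a closed invariant set. Closedness is the last clause, upper semicontinuity.\<close>

definition invariant_field :: "(real \<Rightarrow> complex \<Rightarrow> 'l set) \<Rightarrow> bool" where
  "invariant_field Y \<longleftrightarrow> (\<forall>s\<in>{1,-1}. \<forall>\<tau>. cmod \<tau> = 1 \<longrightarrow>
     Y s \<tau> \<noteq> {} \<and> Y s \<tau> \<subseteq> L \<and> \<phi> s \<tau> ` Y s \<tau> = Y s (\<rho> * \<tau>) \<and>
     (\<forall>\<^sub>F t in side s \<tau>. \<forall>r\<in>{1,-1}. Y r t \<subseteq> Y s \<tau>))"

lemma invariant_fieldD:
  assumes "invariant_field Y" "s \<in> {1,-1}" "cmod \<tau> = 1"
  shows "Y s \<tau> \<noteq> {}" "Y s \<tau> \<subseteq> L" "\<phi> s \<tau> ` Y s \<tau> = Y s (\<rho> * \<tau>)"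
    "\<forall>\<^sub>F t in side s \<tau>. \<forall>r\<in>{1,-1}. Y r t \<subseteq> Y s \<tau>" "finite (Y s \<tau>)"
proof -
  note * = assms(1)[unfolded invariant_field_def, THEN bspec, OF assms(2), THEN spec, THEN mp, OF assms(3)]
  show "Y s \<tau> \<noteq> {}" using * by (elim conjE)
  show sub: "Y s \<tau> \<subseteq> L" using * by (elim conjE)
  show "\<phi> s \<tau> ` Y s \<tau> = Y s (\<rho> * \<tau>)" using * by (elim conjE)
  show "\<forall>\<^sub>F t in side s \<tau>. \<forall>r\<in>{1,-1}. Y r t \<subseteq> Y s \<tau>" using * by (elim conjE)
  show "finite (Y s \<tau>)" by (rule finite_subset[OF sub finite_L])
qed

text \<open>The key to everything that follows: semicontinuity makes the cardinality locally at most its value, and the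
  maps \<open>\<phi> s \<tau>\<close> make it nonincreasing along the minimal rotation.\<close>

lemma card_field_constant:
  assumes Y: "invariant_field Y"
  shows "\<exists>N. \<forall>s\<in>{1,-1}. \<forall>\<tau>. cmod \<tau> = 1 \<longrightarrow> card (Y s \<tau>) = N"
proof -
  define C where "C = {card (Y s \<tau>) |s \<tau>. s \<in> {1,-1} \<and> cmod \<tau> = 1}"
  \<comment> \<open>By semicontinuity the least cardinality persists on an arc; every point is an image, under a power of
    the rotation, of a point of that arc, and cardinalities do not increase along the rotation.\<close>
  define N where "N = (LEAST n. n \<in> C)"
  have "card (Y 1 1) \<in> C" unfolding C_def by (rule CollectI, rule exI[of _ 1], rule exI[of _ 1]) simp
  then have NC: "N \<in> C" unfolding N_def by (rule LeastI)
  have N_le: "N \<le> card (Y s \<tau>)" if "s \<in> {1,-1}" "cmod \<tau> = 1" for s \<tau>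
    unfolding N_def by (rule Least_le) (use that in \<open>auto simp: C_def\<close>)
  obtain s0 \<tau>0 where 0: "s0 \<in> {1,-1}" "cmod \<tau>0 = 1" "card (Y s0 \<tau>0) = N"
    using NC unfolding C_def by blast
  have near0: "\<forall>\<^sub>F t in side s0 \<tau>0. \<forall>r\<in>{1,-1}. card (Y r t) \<le> N"
    using invariant_fieldD(4)[OF Y 0(1,2)]
    by eventually_elim (use card_mono[OF invariant_fieldD(5)[OF Y 0(1,2)]] 0(3) in blast)
  have drop: "card (Y s (\<rho> ^ k * \<tau>)) \<le> card (Y s \<tau>)" if "s \<in> {1,-1}" "cmod \<tau> = 1" for s \<tau> k
  proof (induction k)
    case (Suc k)
    have u: "cmod (\<rho> ^ k * \<tau>) = 1" using that norm_\<rho> by (simp add: norm_mult norm_power)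
    have "card (Y s (\<rho> * (\<rho> ^ k * \<tau>))) \<le> card (Y s (\<rho> ^ k * \<tau>))"
      using card_image_le[OF invariant_fieldD(5)[OF Y that(1) u]] invariant_fieldD(3)[OF Y that(1) u]
      by metis
    then show ?case using Suc by (simp add: mult.assoc)
  qed simp
  have "card (Y s \<tau>) = N" if s: "s \<in> {1,-1}" and \<tau>: "cmod \<tau> = 1" for s \<tau>
  proof -
    have "cmod (inverse \<rho>) = 1" "\<forall>n>0. inverse \<rho> ^ n \<noteq> 1"
      using norm_\<rho> irrational by (auto simp: norm_inverse power_inverse)
    from rotation_orbit_dense[OF this \<tau> 0(2,1) near0]
    obtain k where k: "card (Y s (inverse \<rho> ^ k * \<tau>)) \<le> N"
      using s unfolding frequently_sequentially by blast
    have eq: "\<rho> ^ k * (inverse \<rho> ^ k * \<tau>) = \<tau>"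
      using norm_\<rho> by (auto simp: power_inverse field_simps)
    have "cmod (inverse \<rho> ^ k * \<tau>) = 1" using \<tau> norm_\<rho> by (simp add: norm_mult norm_power norm_inverse)
    from drop[OF s this, of k] k N_le[OF s \<tau>] show ?thesis by (simp add: eq)
  qed
  then show ?thesis by blast
qed

text \<open>Semicontinuity gives an inclusion near \<open>\<tau>\<close>, and a finite set is equal to any of its subsets that has
  the same cardinality.\<close>

lemma field_locally_constant:
  assumes Y: "invariant_field Y" and s: "s \<in> {1,-1}" and \<tau>: "cmod \<tau> = 1"
  shows "\<forall>\<^sub>F t in side s \<tau>. \<forall>r\<in>{1,-1}. Y r t = Y s \<tau>"
proof -
  obtain N where N: "\<And>s \<tau>. s \<in> {1,-1} \<Longrightarrow> cmod \<tau> = 1 \<Longrightarrow> card (Y s \<tau>) = N"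
    using card_field_constant[OF Y] by blast
  show ?thesis using invariant_fieldD(4)[OF Y s \<tau>] eventually_side_unit[OF \<tau>, of s]
    by eventually_elim (metis N card_subset_eq s \<tau> invariant_fieldD(5)[OF Y s \<tau>])
qed

lemma field_inj:
  assumes Y: "invariant_field Y" and s: "s \<in> {1,-1}" and \<tau>: "cmod \<tau> = 1"
  shows "inj_on (\<phi> s \<tau>) (Y s \<tau>)"
proof -
  have "cmod (\<rho> * \<tau>) = 1" using \<tau> norm_\<rho> by (simp add: norm_mult)
  then have "card (\<phi> s \<tau> ` Y s \<tau>) = card (Y s \<tau>)"
    using card_field_constant[OF Y] invariant_fieldD(3)[OF Y s \<tau>] s \<tau> by metis
  then show ?thesis using invariant_fieldD(5)[OF Y s \<tau>] by (metis eq_card_imp_inj_on)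
qed

text \<open>Each point has a punctured neighbourhood on either side of which the field is constant, and hence without
  jumps; now use compactness.\<close>

lemma field_jumps_finite:
  assumes Y: "invariant_field Y"
  shows "finite {\<tau>. cmod \<tau> = 1 \<and> Y 1 \<tau> \<noteq> Y (-1) \<tau>}"
proof -
  define B where "B = {\<tau>. cmod \<tau> = 1 \<and> Y 1 \<tau> \<noteq> Y (-1) \<tau>}"
  have "finite (sphere 0 1 \<inter> B)"
  proof (rule circle_compactness[of "\<lambda>A. finite (A \<inter> B)"])
    fix \<tau> :: complex assume \<tau>: "cmod \<tau> = 1"
    have "\<forall>\<^sub>F t in side s \<tau>. t \<in> insert \<tau> (- B)" if "s \<in> {1,-1}" for s
      using field_locally_constant[OF Y that \<tau>]
      by eventually_elim (auto simp: B_def)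
    moreover have "finite (insert \<tau> (- B) \<inter> B)" by (rule finite_subset[of _ "{\<tau>}"]) auto
    ultimately show "\<exists>A. finite (A \<inter> B) \<and> \<tau> \<in> A \<and> (\<forall>s\<in>{1,-1}. \<forall>\<^sub>F t in side s \<tau>. t \<in> A)"
      by (intro exI[of _ "insert \<tau> (- B)"]) blast
  next
    show "finite ((A \<union> A') \<inter> B)" if "finite (A \<inter> B)" "finite (A' \<inter> B)" for A A'
      using that by (simp add: Int_Un_distrib2)
  next
    show "finite (A \<inter> B)" if "finite (A' \<inter> B)" "A \<subseteq> A'" for A A'
      using that by (meson Int_mono finite_subset subset_refl)
  qed simp
  moreover have "B \<subseteq> sphere 0 1" by (auto simp: B_def)
  ultimately show ?thesis unfolding B_def[symmetric] by (simp add: Int_absorb1)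
qed

definition step :: "complex \<times> 'l \<Rightarrow> complex \<times> 'l \<Rightarrow> bool" where
  "step u v \<longleftrightarrow> fst v = \<rho> * fst u \<and> (\<exists>r\<in>{1,-1}. snd v = \<phi> r (fst u) (snd u))"

text \<open>Forward orbits and backward orbits are treated alike, and each step may use either version of \<open>\<phi>\<close>. This
  covers orbits of the right-continuous map, of its left-continuous version, and backward orbits.\<close>

definition trajectory :: "(nat \<Rightarrow> complex \<times> 'l) \<Rightarrow> bool" where
  "trajectory u \<longleftrightarrow> (\<forall>m. cmod (fst (u m)) = 1 \<and> snd (u m) \<in> L) \<and>
     ((\<forall>m. step (u m) (u (Suc m))) \<or> (\<forall>m. step (u (Suc m)) (u m)))"

definition accumulation :: "(nat \<Rightarrow> complex \<times> 'l) \<Rightarrow> real \<Rightarrow> complex \<Rightarrow> 'l set" where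
  "accumulation u s \<tau> =
     {l. \<forall>P. eventually P (side s \<tau>) \<longrightarrow> (\<exists>\<^sub>F m in sequentially. P (fst (u m)) \<and> snd (u m) = l)}"

lemma trajectory_dense:
  assumes u: "trajectory u" and s: "s \<in> {1,-1}" and \<tau>: "cmod \<tau> = 1"
    and P: "eventually P (side s \<tau>)"
  shows "\<exists>\<^sub>F m in sequentially. P (fst (u m))"
proof -
  have "\<rho> \<noteq> 0" using norm_\<rho> by auto
  obtain \<rho>' where \<rho>': "\<rho>' \<in> {\<rho>, inverse \<rho>}" "\<And>m. fst (u (Suc m)) = \<rho>' * fst (u m)"
  proof (cases "\<forall>m. step (u m) (u (Suc m))")
    case True
    then have "fst (u (Suc m)) = \<rho> * fst (u m)" for m unfolding step_def by blast
    then show ?thesis using that by blast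
  next
    case False
    then have "step (u (Suc m)) (u m)" for m using u unfolding trajectory_def by blast
    then have "fst (u m) = \<rho> * fst (u (Suc m))" for m unfolding step_def by blast
    from arg_cong[OF this, of "(*) (inverse \<rho>)"] have "fst (u (Suc m)) = inverse \<rho> * fst (u m)" for m
      using \<open>\<rho> \<noteq> 0\<close> by (metis mult.assoc left_inverse mult_1)
    then show ?thesis using that by blast
  qed
  have pow: "fst (u m) = \<rho>' ^ m * fst (u 0)" for m
    by (induction m) (simp_all add: \<rho>'(2) mult_ac)
  have "cmod \<rho>' = 1" "\<forall>n>0. \<rho>' ^ n \<noteq> 1"
    using \<rho>'(1) norm_\<rho> irrational by (auto simp: norm_inverse power_inverse)
  moreover have "cmod (fst (u 0)) = 1" using u by (auto simp: trajectory_def)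
  ultimately have "\<exists>\<^sub>F m in sequentially. P (\<rho>' ^ m * fst (u 0))"
    using \<tau> s P by (rule rotation_orbit_dense)
  then show ?thesis by (simp only: pow[symmetric])
qed

lemma not_accumulation:
  "l \<notin> accumulation u s \<tau> \<longleftrightarrow>
     (\<exists>P. eventually P (side s \<tau>) \<and> (\<forall>\<^sub>F m in sequentially. \<not> (P (fst (u m)) \<and> snd (u m) = l)))"
  unfolding accumulation_def not_frequently[symmetric] by auto

text \<open>Pigeonhole principle: if none of the finitely many labels satisfying \<open>Q\<close> accumulated, then the arcs
  excluding them would intersect in an arc that is eventually avoided.\<close>

lemma frequently_label_accumulates:
  assumes u: "trajectory u"
    and fr: "\<And>P. eventually P (side s \<tau>) \<Longrightarrow> \<exists>\<^sub>F m in sequentially. P (fst (u m)) \<and> Q (snd (u m))"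
  shows "\<exists>l\<in>accumulation u s \<tau>. Q l"
proof (rule ccontr)
  assume no: "\<not> ?thesis"
  have "\<forall>l\<in>{l\<in>L. Q l}. \<exists>P. eventually P (side s \<tau>) \<and>
      (\<forall>\<^sub>F m in sequentially. \<not> (P (fst (u m)) \<and> snd (u m) = l))"
    using no not_accumulation by blast
  then obtain P where P: "\<And>l. l \<in> L \<Longrightarrow> Q l \<Longrightarrow> eventually (P l) (side s \<tau>)"
    "\<And>l. l \<in> L \<Longrightarrow> Q l \<Longrightarrow> \<forall>\<^sub>F m in sequentially. \<not> (P l (fst (u m)) \<and> snd (u m) = l)"
    unfolding bchoice_iff by auto
  have "\<forall>\<^sub>F t in side s \<tau>. \<forall>l\<in>{l\<in>L. Q l}. P l t"
    using P(1) finite_L by (intro eventually_ball_finite) auto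
  moreover have "\<forall>\<^sub>F m in sequentially. \<forall>l\<in>{l\<in>L. Q l}. \<not> (P l (fst (u m)) \<and> snd (u m) = l)"
    using P(2) finite_L by (intro eventually_ball_finite) auto
  then have "\<forall>\<^sub>F m in sequentially. \<not> ((\<forall>l\<in>{l\<in>L. Q l}. P l (fst (u m))) \<and> Q (snd (u m)))"
    by eventually_elim (use u in \<open>auto simp: trajectory_def\<close>)
  ultimately show False using fr[of "\<lambda>t. \<forall>l\<in>{l\<in>L. Q l}. P l t"] by (simp add: frequently_def)
qed

lemma accumulation_subset: assumes "trajectory u" shows "accumulation u s \<tau> \<subseteq> L"
proof
  fix l assume "l \<in> accumulation u s \<tau>"
  then have "\<exists>\<^sub>F m in sequentially. snd (u m) = l"
    unfolding accumulation_def by (auto dest!: spec[of _ "\<lambda>_. True"])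
  then show "l \<in> L" using assms by (auto simp: trajectory_def dest: frequently_ex)
qed

lemma trajectory_steps:
  assumes "trajectory u" and "m \<ge> Suc M"
  shows "\<exists>k\<ge>M. step (u m) (u k)" "\<exists>k\<ge>M. step (u k) (u m)"
proof -
  obtain n where n: "m = Suc n" "n \<ge> M" using assms(2) by (cases m) auto
  have "\<exists>k\<ge>n. step (u m) (u k)" "\<exists>k\<ge>n. step (u k) (u m)"
    using assms(1) n(1) unfolding trajectory_def
    by (metis le_Suc_eq le_refl)+
  then show "\<exists>k\<ge>M. step (u m) (u k)" "\<exists>k\<ge>M. step (u k) (u m)" using n(2) le_trans by blast+
qed

text \<open>Neither version of \<open>\<phi>\<close> changes on a small arc next to \<open>\<tau>\<close>, so visits to this arc with label \<open>l\<close> correspond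
  to visits to the rotated arc with label \<open>\<phi> s \<tau> l\<close>, one step later or earlier. A label over \<open>\<rho> * \<tau>\<close> has a
  preimage because the neighbouring visits have finitely many labels.\<close>

lemma accumulation_field:
  assumes u: "trajectory u"
  shows "invariant_field (accumulation u)"
  unfolding invariant_field_def
proof (intro ballI allI impI conjI)
  fix s :: real and \<tau> :: complex assume s: "s \<in> {1,-1}" and \<tau>: "cmod \<tau> = 1"
  have uL: "snd (u m) \<in> L" for m using u by (auto simp: trajectory_def)
  have \<rho>0: "\<rho> \<noteq> 0" using norm_\<rho> by auto
  show "accumulation u s \<tau> \<noteq> {}"
    using frequently_label_accumulates[OF u, of s \<tau> "\<lambda>_. True"] trajectory_dense[OF u s \<tau>] by auto
  show "accumulation u s \<tau> \<subseteq> L" by (rule accumulation_subset[OF u])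
  show "\<forall>\<^sub>F t in side s \<tau>. \<forall>r\<in>{1, - 1}. accumulation u r t \<subseteq> accumulation u s \<tau>"
  proof -
    have "\<forall>\<^sub>F t in side s \<tau>. \<forall>r\<in>{1,-1}. l \<notin> accumulation u r t"
      if "l \<notin> accumulation u s \<tau>" for l
    proof -
      obtain P where P: "eventually P (side s \<tau>)"
        "\<forall>\<^sub>F m in sequentially. \<not> (P (fst (u m)) \<and> snd (u m) = l)"
        using \<open>l \<notin> accumulation u s \<tau>\<close> not_accumulation by blast
      show ?thesis using eventually_side_side[OF P(1) s]
        by eventually_elim (use P(2) not_accumulation in blast)
    qed
    then have "\<forall>\<^sub>F t in side s \<tau>. \<forall>l\<in>L - accumulation u s \<tau>. \<forall>r\<in>{1,-1}. l \<notin> accumulation u r t"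
      using finite_L by (intro eventually_ball_finite) auto
    then show ?thesis by eventually_elim (use accumulation_subset[OF u] in blast)
  qed
  show "\<phi> s \<tau> ` accumulation u s \<tau> = accumulation u s (\<rho> * \<tau>)"
  proof (intro equalityI subsetI)
    fix l' assume "l' \<in> \<phi> s \<tau> ` accumulation u s \<tau>"
    then obtain l where l: "l \<in> accumulation u s \<tau>" "l' = \<phi> s \<tau> l" by blast
    have lL: "l \<in> L" using l accumulation_subset[OF u] by blast
    show "l' \<in> accumulation u s (\<rho> * \<tau>)"
      unfolding accumulation_def
    proof (intro CollectI allI impI)
      fix P assume "eventually P (side s (\<rho> * \<tau>))"
      then have "\<forall>\<^sub>F t in side s \<tau>. P (\<rho> * t)" by (simp add: side_mult eventually_filtermap)
      with \<phi>_near[OF \<tau> s lL]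
      have "\<forall>\<^sub>F t in side s \<tau>. P (\<rho> * t) \<and> (\<forall>r\<in>{1,-1}. \<phi> r t l = l')"
        unfolding l(2) by eventually_elim auto
      then have fr: "\<exists>\<^sub>F m in sequentially. (P (\<rho> * fst (u m)) \<and> (\<forall>r\<in>{1,-1}. \<phi> r (fst (u m)) l = l'))
          \<and> snd (u m) = l"
        using l(1) unfolding accumulation_def by blast
      show "\<exists>\<^sub>F m in sequentially. P (fst (u m)) \<and> snd (u m) = l'"
        unfolding frequently_sequentially
      proof
        fix M
        obtain m where m: "m \<ge> Suc M" "P (\<rho> * fst (u m))" "\<forall>r\<in>{1,-1}. \<phi> r (fst (u m)) l = l'"
          "snd (u m) = l" using fr unfolding frequently_sequentially by blast
        obtain k where "k \<ge> M" "step (u m) (u k)" using trajectory_steps[OF u m(1)] by blast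
        then show "\<exists>m\<ge>M. P (fst (u m)) \<and> snd (u m) = l'"
          using m by (intro exI[of _ k]) (auto simp: step_def)
      qed
    qed
  next
    fix l' assume l': "l' \<in> accumulation u s (\<rho> * \<tau>)"
    have "\<exists>l\<in>accumulation u s \<tau>. \<phi> s \<tau> l = l'"
    proof (rule frequently_label_accumulates[OF u])
      fix P assume P: "eventually P (side s \<tau>)"
      have "\<forall>\<^sub>F t in side s \<tau>. \<forall>l\<in>L. \<forall>r\<in>{1,-1}. \<phi> r t l = \<phi> s \<tau> l"
        using \<phi>_near[OF \<tau> s] finite_L by (intro eventually_ball_finite) auto
      with P have "\<forall>\<^sub>F t in side s \<tau>. P t \<and> (\<forall>l\<in>L. \<forall>r\<in>{1,-1}. \<phi> r t l = \<phi> s \<tau> l)"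
        by eventually_elim auto
      then have "\<forall>\<^sub>F t in side s (\<rho> * \<tau>). P (t / \<rho>) \<and> (\<forall>l\<in>L. \<forall>r\<in>{1,-1}. \<phi> r (t / \<rho>) l = \<phi> s \<tau> l)"
        using \<rho>0 by (simp add: side_mult eventually_filtermap)
      then have fr: "\<exists>\<^sub>F m in sequentially. (P (fst (u m) / \<rho>) \<and>
          (\<forall>l\<in>L. \<forall>r\<in>{1,-1}. \<phi> r (fst (u m) / \<rho>) l = \<phi> s \<tau> l)) \<and> snd (u m) = l'"
        using l' unfolding accumulation_def by blast
      show "\<exists>\<^sub>F m in sequentially. P (fst (u m)) \<and> \<phi> s \<tau> (snd (u m)) = l'"
        unfolding frequently_sequentially
      proof
        fix M
        obtain m where m: "m \<ge> Suc M" "P (fst (u m) / \<rho>)"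
          "\<forall>l\<in>L. \<forall>r\<in>{1,-1}. \<phi> r (fst (u m) / \<rho>) l = \<phi> s \<tau> l" "snd (u m) = l'"
          using fr unfolding frequently_sequentially by blast
        obtain k where k: "k \<ge> M" "step (u k) (u m)" using trajectory_steps[OF u m(1)] by blast
        then have "fst (u m) / \<rho> = fst (u k)" using \<rho>0 by (simp add: step_def)
        then show "\<exists>m\<ge>M. P (fst (u m)) \<and> \<phi> s \<tau> (snd (u m)) = l'"
          using m k uL by (intro exI[of _ k]) (auto simp: step_def)
      qed
    qed
    then show "l' \<in> \<phi> s \<tau> ` accumulation u s \<tau>" by blast
  qed
qed

text \<open>Near \<open>\<tau>\<close> the field is constant, so infinitely many points of \<open>x\<close> lie in it. Invariance then carries
  membership from a point of the backward orbit to all points with smaller index.\<close>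

lemma field_absorbs_backward_orbit:
  assumes x: "trajectory x" and bwd: "\<And>m. fst (x m) = \<rho> * fst (x (Suc m))"
      "\<And>m. snd (x m) = \<phi> 1 (fst (x (Suc m))) (snd (x (Suc m)))"
    and Z: "invariant_field Z" and s: "s \<in> {1,-1}" and \<tau>: "cmod \<tau> = 1"
    and l: "l \<in> Z s \<tau>" "l \<in> accumulation x s \<tau>"
  shows "snd (x m) \<in> Z 1 (fst (x m))"
proof -
  have x1: "cmod (fst (x m)) = 1" for m using x by (auto simp: trajectory_def)
  have "\<exists>\<^sub>F m in sequentially. (\<forall>r\<in>{1,-1}. Z r (fst (x m)) = Z s \<tau>) \<and> snd (x m) = l"
    using l(2) field_locally_constant[OF Z s \<tau>] unfolding accumulation_def by blast
  then obtain n where n: "n \<ge> m" "snd (x n) \<in> Z 1 (fst (x n))"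
    using l(1) unfolding frequently_sequentially by blast
  have down: "snd (x k) \<in> Z 1 (fst (x k))" if "snd (x (Suc k)) \<in> Z 1 (fst (x (Suc k)))" for k
    using invariant_fieldD(3)[OF Z, of 1, OF _ x1[of "Suc k"]] that bwd[of k] by auto
  show ?thesis using n by (induction rule: inc_induct) (auto intro: down)
qed

lemma accumulation_subset_field:
  assumes Z: "invariant_field Z" and s: "s \<in> {1,-1}" and \<tau>: "cmod \<tau> = 1"
    and u: "\<And>m. \<exists>r\<in>{1,-1}. snd (u m) \<in> Z r (fst (u m))"
  shows "accumulation u s \<tau> \<subseteq> Z s \<tau>"
proof
  fix l assume "l \<in> accumulation u s \<tau>"
  then have "\<exists>\<^sub>F m in sequentially. (\<forall>r\<in>{1,-1}. Z r (fst (u m)) = Z s \<tau>) \<and> snd (u m) = l"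
    using field_locally_constant[OF Z s \<tau>] unfolding accumulation_def by blast
  then obtain m where "\<forall>r\<in>{1,-1}. Z r (fst (u m)) = Z s \<tau>" "snd (u m) = l"
    using frequently_ex by blast
  then show "l \<in> Z s \<tau>" using u[of m] by blast
qed

text \<open>The accumulation field of an orbit inside the field of \<open>x\<close> is again invariant. It is contained in the
  field of \<open>x\<close>, so \<open>x\<close> accumulates on it and is absorbed by it; this gives the reverse inclusion. This is
  the minimality of the component that will be built from \<open>x\<close>.\<close>

lemma accumulation_of_orbit_in_field:
  assumes x: "trajectory x" and bwd: "\<And>m. fst (x m) = \<rho> * fst (x (Suc m))"
      "\<And>m. snd (x m) = \<phi> 1 (fst (x (Suc m))) (snd (x (Suc m)))"
    and y: "trajectory y" and yx: "\<And>m. \<exists>r\<in>{1,-1}. snd (y m) \<in> accumulation x r (fst (y m))"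
    and s: "s \<in> {1,-1}" and \<tau>: "cmod \<tau> = 1"
  shows "accumulation y s \<tau> = accumulation x s \<tau>"
proof
  note X = accumulation_field[OF x] and Y = accumulation_field[OF y]
  show sub: "accumulation y s \<tau> \<subseteq> accumulation x s \<tau>"
    by (rule accumulation_subset_field[OF X s \<tau> yx])
  obtain l where l: "l \<in> accumulation y s \<tau>" using invariant_fieldD(1)[OF Y s \<tau>] by blast
  have "snd (x m) \<in> accumulation y 1 (fst (x m))" for m
    by (rule field_absorbs_backward_orbit[OF x bwd Y s \<tau> l]) (use sub l in blast)
  then show "accumulation x s \<tau> \<subseteq> accumulation y s \<tau>"
    by (intro accumulation_subset_field[OF Y s \<tau>]) auto
qed

lemma backward_orbit_in_accumulation:
  assumes x: "trajectory x" and bwd: "\<And>m. fst (x m) = \<rho> * fst (x (Suc m))"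
      "\<And>m. snd (x m) = \<phi> 1 (fst (x (Suc m))) (snd (x (Suc m)))"
  shows "snd (x m) \<in> accumulation x 1 (fst (x m))"
proof -
  note X = accumulation_field[OF x]
  obtain l where "l \<in> accumulation x 1 1" using invariant_fieldD(1)[OF X, of 1 1] by auto
  then show ?thesis using field_absorbs_backward_orbit[OF x bwd X, of 1 1 l m] by auto
qed

end

section \<open>The split interval of a piecewise translation\<close>

fun position :: "split_point \<Rightarrow> real" where
  "position (Point t) = t" | "position (Left_of t) = t"

text \<open>A piecewise translation \<open>h\<close> of the interval together with its left-continuous version \<open>g\<close>, which
  lives on \<open>(0,1]\<close>. Since \<open>g 1 \<noteq> 1\<close>, \<open>Point (g 1)\<close> is available as the
  value of the extension at \<open>Left_of 1\<close> when 1 is not doubled.\<close>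

locale piecewise_translation =
  fixes h g :: "real \<Rightarrow> real"
  assumes h_in: "t \<in> {0..<1} \<Longrightarrow> h t \<in> {0..<1}"
    and g_in: "t \<in> {0<..1} \<Longrightarrow> g t \<in> {0<..1}"
    and g_1: "g 1 \<noteq> 1"
    and right: "t \<in> {0..<1} \<Longrightarrow> \<forall>\<^sub>F x in at_right 0. h (t + x) = h t + x \<and> g (t + x) = h t + x"
    and left: "t \<in> {0<..1} \<Longrightarrow> \<forall>\<^sub>F x in at_right 0. h (t - x) = g t - x \<and> g (t - x) = g t - x"
begin

abbreviation "D \<equiv> doubled_points h"
abbreviation "SI \<equiv> split_interval h"

lemma h_tendsto_left: assumes "t \<in> {0<..1}" shows "(h \<longlongrightarrow> g t) (at_left t)"
proof -
  obtain b where b: "b > 0" "\<And>x. 0 < x \<Longrightarrow> x < b \<Longrightarrow> h (t - x) = g t - x"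
    using left[OF assms] unfolding eventually_at_right_field by auto
  have "h s = g t - (t - s)" if "t - b < s" "s < t" for s using b(2)[of "t - s"] that by simp
  then have "\<forall>\<^sub>F s in at_left t. g t - (t - s) = h s"
    unfolding eventually_at_left_field using b(1) by (intro exI[of _ "t - b"]) auto
  moreover have "((\<lambda>s. g t - (t - s)) \<longlongrightarrow> g t - (t - t)) (at_left t)" by (intro tendsto_intros)
  ultimately show ?thesis by (simp add: tendsto_cong)
qed

lemma left_version_eq: "t \<in> {0<..1} \<Longrightarrow> left_version h t = g t"
  unfolding left_version_def by (rule tendsto_Lim[OF _ h_tendsto_left]) auto

lemma h_tendsto_right: assumes "t \<in> {0..<1}" shows "(h \<longlongrightarrow> h t) (at_right t)"
proof -
  obtain b where b: "b > 0" "\<And>x. 0 < x \<Longrightarrow> x < b \<Longrightarrow> h (t + x) = h t + x"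
    using right[OF assms] unfolding eventually_at_right_field by auto
  have "h s = h t + (s - t)" if "t < s" "s < t + b" for s using b(2)[of "s - t"] that by simp
  then have "\<forall>\<^sub>F s in at_right t. h t + (s - t) = h s"
    unfolding eventually_at_right_field using b(1) by (intro exI[of _ "t + b"]) auto
  moreover have "((\<lambda>s. h t + (s - t)) \<longlongrightarrow> h t + (t - t)) (at_right t)" by (intro tendsto_intros)
  ultimately show ?thesis by (simp add: tendsto_cong)
qed

lemma doubled_range: "t \<in> D \<Longrightarrow> t \<in> {0<..1}"
proof (induction rule: doubled_points.induct)
  case (discontinuity t)
  have "t \<noteq> 0"
  proof
    assume "t = 0"
    have "continuous (at t within {t..}) h"
      using h_tendsto_right[OF discontinuity(1)] by (simp add: continuous_within at_within_Ici_at_right)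
    then have "continuous (at t within {0..<1}) h"
      by (rule continuous_within_subset) (use \<open>t = 0\<close> in auto)
    then show False using discontinuity(2) by simp
  qed
  then show ?case using discontinuity(1) by auto
qed (use g_in left_version_eq in auto)

lemma image_doubled: "t \<in> D \<Longrightarrow> g t \<in> D"
  using doubled_points.image[of t h] left_version_eq doubled_range by simp

lemma preimage_doubled: "t \<in> {0<..1} \<Longrightarrow> g t \<in> D \<Longrightarrow> t \<in> D"
  using doubled_points.preimage[of t h] left_version_eq by simp

lemma not_doubled_eq: assumes "t \<notin> D" "0 < t" "t < 1" shows "h t = g t"
proof -
  have "continuous (at t within {0..<1}) h"
    using doubled_points.discontinuity[of t h] assms by auto
  then have "continuous (at t within {0<..<1}) h" by (rule continuous_within_subset) auto
  then have "(h \<longlongrightarrow> h t) (at t)"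
    using assms by (simp add: continuous_within at_within_open[of t "{0<..<1}"])
  then have "(h \<longlongrightarrow> h t) (at_left t)" by (rule tendsto_mono[rotated]) (simp add: at_le)
  moreover have "(h \<longlongrightarrow> g t) (at_left t)" using assms by (intro h_tendsto_left) auto
  ultimately show ?thesis by (rule tendsto_unique[rotated]) simp
qed

lemma g_1_less: "g 1 < 1" using g_in[of 1] g_1 by auto

text \<open>The signs of the directions from which \<open>y\<close> is a limit of other split points. An undoubled
  \<open>Point t\<close> with \<open>t > 0\<close> is a two-sided limit.\<close>

fun approach :: "split_point \<Rightarrow> real set" where
  "approach (Point t) = (if t \<in> D \<or> t = 0 then {1} else {1,-1})"
| "approach (Left_of t) = {-1}"

definition adjacent :: "split_point set \<Rightarrow> real \<Rightarrow> real \<Rightarrow> bool" where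
  "adjacent U t s \<longleftrightarrow> (\<forall>\<^sub>F x in at_right 0. \<forall>y\<in>SI. position y = t + s * x \<longrightarrow> y \<in> U)"

lemma adjacentE:
  assumes "adjacent U t s"
  obtains b where "b > 0" "\<And>y x. y \<in> SI \<Longrightarrow> 0 < x \<Longrightarrow> x < b \<Longrightarrow> position y = t + s * x \<Longrightarrow> y \<in> U"
  using assms unfolding adjacent_def eventually_at_right_field by auto

lemma adjacentI:
  assumes "b > 0" "\<And>y x. y \<in> SI \<Longrightarrow> 0 < x \<Longrightarrow> x < b \<Longrightarrow> position y = t + s * x \<Longrightarrow> y \<in> U"
  shows "adjacent U t s"
  using assms unfolding adjacent_def eventually_at_right_field by (intro exI[of _ b]) auto

lemma adjacent_Int: "adjacent A t s \<Longrightarrow> adjacent B t s \<Longrightarrow> adjacent (A \<inter> B) t s"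
  unfolding adjacent_def by (erule (1) eventually_elim2) blast

lemma adjacent_mono: "adjacent A t s \<Longrightarrow> A \<subseteq> B \<Longrightarrow> adjacent B t s"
  unfolding adjacent_def by (erule eventually_mono) blast

lemma SI_cases:
  assumes "y \<in> SI"
  obtains (point) t where "y = Point t" "0 \<le> t" "t < 1"
    | (left_of) t where "y = Left_of t" "t \<in> D \<or> t = 1" "0 < t" "t \<le> 1"
  using assms doubled_range unfolding split_interval_def by fastforce

lemma split_less_position: "split_less y z \<Longrightarrow> position y \<le> position z"
  by (cases y; cases z) auto

lemma position_less_split: "position y < position z \<Longrightarrow> split_less y z"
  by (cases y; cases z) auto

text \<open>The delicate case is \<open>x = Left_of t\<close> and \<open>p = Point t\<close>: then \<open>t\<close> is doubled, and the ray above \<open>x\<close> need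
  only contain the right neighbourhoods of \<open>t\<close>.\<close>

lemma rays_adjacent:
  assumes p: "p \<in> SI" "s \<in> approach p" and x: "x \<in> SI"
  shows "split_less p x \<Longrightarrow> adjacent {y\<in>SI. split_less y x} (position p) s"
    and "split_less x p \<Longrightarrow> adjacent {y\<in>SI. split_less x y} (position p) s"
proof -
  assume l: "split_less p x"
  have "position p < position x \<or> s = -1"
    using l p(2) by (cases p; cases x) auto
  then show "adjacent {y\<in>SI. split_less y x} (position p) s"
  proof
    assume a: "position p < position x"
    have s: "s \<le> 1" using p(2) by (cases p) (auto split: if_splits)
    show ?thesis
    proof (rule adjacentI[of "position x - position p"])
      fix y r assume "y \<in> SI" "0 < r" "r < position x - position p" "position y = position p + s * r"
      moreover have "s * r \<le> r" using mult_right_mono[OF s, of r] \<open>0 < r\<close> by simp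
      ultimately have "y \<in> SI" "position y < position x" by linarith+
      then show "y \<in> {y\<in>SI. split_less y x}" using position_less_split[of y x] by simp
    qed (use a in auto)
  next
    assume "s = -1"
    then show ?thesis using split_less_position[OF l]
      by (intro adjacentI[of 1]) (auto intro: position_less_split)
  qed
next
  assume l: "split_less x p"
  have "position x < position p \<or> s = 1"
    using l p x by (cases p; cases x) (auto simp: split_interval_def order.strict_iff_order split: if_splits)
  then show "adjacent {y\<in>SI. split_less x y} (position p) s"
  proof
    assume a: "position x < position p"
    have s: "s \<ge> -1" using p(2) by (cases p) (auto split: if_splits)
    show ?thesis
    proof (rule adjacentI[of "position p - position x"])
      fix y r assume "y \<in> SI" "0 < r" "r < position p - position x" "position y = position p + s * r"
      moreover have "s * r \<ge> - r" using mult_right_mono[OF s, of r] \<open>0 < r\<close> by simp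
      ultimately have "y \<in> SI" "position x < position y" by linarith+
      then show "y \<in> {y\<in>SI. split_less x y}" using position_less_split[of x y] by simp
    qed (use a in auto)
  next
    assume "s = 1"
    then show ?thesis using split_less_position[OF l]
      by (intro adjacentI[of 1]) (auto intro: position_less_split)
  qed
qed

lemma openin_ray:
  assumes "x \<in> SI"
  shows "openin (split_topology h) {y\<in>SI. split_less y x}" "openin (split_topology h) {y\<in>SI. split_less x y}"
  unfolding split_topology_def using assms by (auto intro!: topology_generated_by_Basis)

text \<open>This and \<open>adjacent_imp_openin\<close> describe the order topology by one-sided neighbourhoods, so that
  continuity and closedness can be checked on real intervals.\<close>

lemma openin_imp_adjacent:
  assumes "openin (split_topology h) U"
  shows "U \<subseteq> SI \<and> (\<forall>p\<in>U. \<forall>s\<in>approach p. adjacent U (position p) s)"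
proof -
  have "generate_topology_on ((\<lambda>x. {y\<in>SI. split_less y x}) ` SI \<union> (\<lambda>x. {y\<in>SI. split_less x y}) ` SI) U"
    using assms unfolding split_topology_def openin_topology_generated_by_iff .
  then show ?thesis
  proof (induction rule: generate_topology_on.induct)
    case (Int A B)
    show ?case
    proof (intro conjI ballI)
      fix p s assume "p \<in> A \<inter> B" "s \<in> approach p"
      then show "adjacent (A \<inter> B) (position p) s" using Int.IH by (intro adjacent_Int) blast+
    qed (use Int.IH in blast)
  next
    case (UN K)
    show ?case
    proof (intro conjI ballI)
      fix p s assume "p \<in> \<Union>K" "s \<in> approach p"
      then obtain A where "A \<in> K" "adjacent A (position p) s" using UN by blast
      then show "adjacent (\<Union>K) (position p) s" by (meson Union_upper adjacent_mono)
    qed (use UN in blast)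
  next
    case (Basis A)
    then show ?case using rays_adjacent by auto
  qed simp
qed

lemma adjacent_imp_openin:
  assumes U: "U \<subseteq> SI" and adj: "\<And>p s. p \<in> U \<Longrightarrow> s \<in> approach p \<Longrightarrow> adjacent U (position p) s"
  shows "openin (split_topology h) U"
proof (subst openin_subopen, rule ballI)
  fix p assume p: "p \<in> U"
  have upper: "\<exists>z\<in>SI. split_less p z \<and> (\<forall>y\<in>SI. split_less y z \<and> position p < position y \<longrightarrow> y \<in> U)"
    if "p = Point t" for t
  proof -
    have t: "0 \<le> t" "t < 1" using p U that by (auto simp: split_interval_def)
    have "adjacent U t 1" using adj[OF p, of 1] that by auto
    then obtain b where b: "b > 0" "\<And>y x. y \<in> SI \<Longrightarrow> 0 < x \<Longrightarrow> x < b \<Longrightarrow> position y = t + x \<Longrightarrow> y \<in> U"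
      using adjacentE[of U t 1] by auto
    define u where "u = t + min (b / 2) ((1 - t) / 2)"
    have u: "t < u" "u < t + b" "u < 1" using b(1) t by (auto simp: u_def min_def field_simps)
    show ?thesis
    proof (intro bexI[of _ "Point u"] conjI ballI impI)
      fix y assume y: "y \<in> SI" "split_less y (Point u) \<and> position p < position y"
      then have "position y \<le> u" "t < position y" using split_less_position[of y "Point u"] that by auto
      then show "y \<in> U" using b(2)[of y "position y - t"] y u by auto
    qed (use that u t in \<open>auto simp: split_interval_def\<close>)
  qed
  have lower: "\<exists>z\<in>SI. split_less z p \<and> (\<forall>y\<in>SI. split_less z y \<and> position y < position p \<longrightarrow> y \<in> U)"
    if "-1 \<in> approach p"
  proof -
    define t where "t = position p"
    have t: "0 < t" "t \<le> 1" using p U that subsetD[OF U p]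
      by (auto simp: t_def elim!: SI_cases split: if_splits)
    have "adjacent U t (-1)" using adj[OF p that] by (simp add: t_def)
    then obtain b where b: "b > 0" "\<And>y x. y \<in> SI \<Longrightarrow> 0 < x \<Longrightarrow> x < b \<Longrightarrow> position y = t - x \<Longrightarrow> y \<in> U"
      using adjacentE[of U t "-1"] by auto
    define u where "u = t - min (b / 2) (t / 2)"
    have u: "u < t" "t - b < u" "0 < u" using b(1) t by (auto simp: u_def min_def field_simps)
    show ?thesis
    proof (intro bexI[of _ "Point u"] conjI ballI impI)
      fix y assume y: "y \<in> SI" "split_less (Point u) y \<and> position y < position p"
      then have "u \<le> position y" "position y < t" using split_less_position[of "Point u" y] by (auto simp: t_def)
      then show "y \<in> U" using b(2)[of y "t - position y"] y u by auto
    qed (use u t in \<open>auto simp: split_interval_def t_def intro: position_less_split\<close>)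
  qed
  have same: "y \<in> SI \<Longrightarrow> position y = position p \<Longrightarrow>
      y = p \<or> (\<exists>t. t \<in> D \<union> {1} \<and> {y, p} = {Point t, Left_of t})" for y
    using subsetD[OF U p] by (auto elim!: SI_cases)
  from subsetD[OF U p]
  show "\<exists>T. openin (split_topology h) T \<and> p \<in> T \<and> T \<subseteq> U"
  proof (cases rule: SI_cases)
    case (point t)
    obtain z where z: "z \<in> SI" "split_less p z"
      "\<And>y. y \<in> SI \<Longrightarrow> split_less y z \<Longrightarrow> position p < position y \<Longrightarrow> y \<in> U"
      using upper[OF point(1)] by auto
    consider "t = 0" | "t \<in> D" | "t \<noteq> 0" "t \<notin> D" by blast
    then show ?thesis
    proof cases
      case 1
      have "y \<in> U" if "y \<in> SI" "split_less y z" for y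
      proof (cases "position y = 0")
        case True then have "y = p" using that(1) point 1 by (auto elim!: SI_cases)
        then show ?thesis using p by simp
      next
        case False then have "position y > 0" using that(1) by (auto elim!: SI_cases)
        then show ?thesis using z(3) that 1 point by auto
      qed
      then show ?thesis using openin_ray(1)[OF z(1)] z(2) p U
        by (intro exI[of _ "{y\<in>SI. split_less y z}"]) auto
    next
      case 2
      then have LI: "Left_of t \<in> SI" by (simp add: split_interval_def)
      have "y \<in> U" if "y \<in> SI" "split_less y z" "split_less (Left_of t) y" for y
      proof (cases "position y = t")
        case True then have "y = p" using that(3) point by (cases y) auto
        then show ?thesis using p by simp
      next
        case False then have "position y > t" using split_less_position[OF that(3)] by auto
        then show ?thesis using z(3) that point by auto
      qed
      then show ?thesis using openin_Int[OF openin_ray(1)[OF z(1)] openin_ray(2)[OF LI]] z(2) p U point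
        by (intro exI[of _ "{y\<in>SI. split_less y z} \<inter> {y\<in>SI. split_less (Left_of t) y}"]) auto
    next
      case 3
      then obtain w where w: "w \<in> SI" "split_less w p"
        "\<And>y. y \<in> SI \<Longrightarrow> split_less w y \<Longrightarrow> position y < position p \<Longrightarrow> y \<in> U"
        using lower point by auto
      have "y \<in> U" if "y \<in> SI" "split_less y z" "split_less w y" for y
      proof -
        consider "position y < position p" | "position y = position p" | "position y > position p" by linarith
        then show ?thesis
        proof cases
          case 2
          then have "y = p" using that(1) point 3 by (auto elim!: SI_cases)
          then show ?thesis using p by simp
        qed (use w z that in auto)
      qed
      then show ?thesis using openin_Int[OF openin_ray(1)[OF z(1)] openin_ray(2)[OF w(1)]] z(2) w(2) p U
        by (intro exI[of _ "{y\<in>SI. split_less y z} \<inter> {y\<in>SI. split_less w y}"]) auto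
    qed
  next
    case (left_of t)
    then obtain w where w: "w \<in> SI" "split_less w p"
      "\<And>y. y \<in> SI \<Longrightarrow> split_less w y \<Longrightarrow> position y < position p \<Longrightarrow> y \<in> U"
      using lower by auto
    show ?thesis
    proof (cases "t = 1")
      case True
      have "y \<in> U" if "y \<in> SI" "split_less w y" for y
      proof (cases "position y = 1")
        case True' : True
        then have "y = p" using that(1) left_of True by (auto elim!: SI_cases)
        then show ?thesis using p by simp
      next
        case False then have "position y < 1" using that(1) by (auto elim!: SI_cases)
        then show ?thesis using w(3) that True left_of by auto
      qed
      then show ?thesis using openin_ray(2)[OF w(1)] w(2) p U
        by (intro exI[of _ "{y\<in>SI. split_less w y}"]) auto
    next
      case False
      then have PI: "Point t \<in> SI" using left_of by (auto simp: split_interval_def)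
      have "y \<in> U" if "y \<in> SI" "split_less w y" "split_less y (Point t)" for y
      proof (cases "position y = t")
        case True then have "y = p" using that(3) left_of by (cases y) auto
        then show ?thesis using p by simp
      next
        case False then have "position y < t" using split_less_position[OF that(3)] by auto
        then show ?thesis using w(3) that left_of by auto
      qed
      then show ?thesis using openin_Int[OF openin_ray(2)[OF w(1)] openin_ray(1)[OF PI]] w(2) p U left_of
        by (intro exI[of _ "{y\<in>SI. split_less w y} \<inter> {y\<in>SI. split_less y (Point t)}"]) auto
    qed
  qed
qed

lemma topspace_split [simp]: "topspace (split_topology h) = SI"
proof
  show "topspace (split_topology h) \<subseteq> SI" using openin_imp_adjacent[of "topspace (split_topology h)"] by simp
  have "openin (split_topology h) SI"
    by (rule adjacent_imp_openin) (auto simp: adjacent_def)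
  then show "SI \<subseteq> topspace (split_topology h)" by (rule openin_subset)
qed

text \<open>The second branch only concerns \<open>Left_of 1\<close> when 1 is not doubled. In that case \<open>g 1\<close> is not
  doubled either, and \<open>Point (g 1)\<close> is the limit of the values from the left.\<close>

definition extension :: "split_point \<Rightarrow> split_point" where
  "extension y = (case y of Point t \<Rightarrow> Point (h t)
     | Left_of t \<Rightarrow> if g t \<in> D then Left_of (g t) else Point (g t))"

lemma extension_in: assumes "y \<in> SI" shows "extension y \<in> SI"
  using assms
proof (cases rule: SI_cases)
  case (point t)
  then show ?thesis using h_in[of t] by (simp add: extension_def split_interval_def)
next
  case (left_of t)
  show ?thesis
  proof (cases "g t \<in> D")
    case True
    then show ?thesis using left_of by (simp add: extension_def split_interval_def)
  next
    case False
    then have "t = 1" using left_of image_doubled by blast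
    then have "0 \<le> g t" "g t < 1" using g_1_less g_in[of 1] by auto
    then show ?thesis using left_of False by (simp add: extension_def split_interval_def)
  qed
qed

text \<open>The extension does not lose sides, because a point with doubled left-hand image is itself doubled. This is
  the reason why doubled points have to be closed under preimages.\<close>

lemma approach_extension: assumes "y \<in> SI" shows "approach y \<subseteq> approach (extension y)"
  using assms
proof (cases rule: SI_cases)
  case (point t)
  have "h t \<notin> D \<and> h t \<noteq> 0" if "t \<notin> D" "t \<noteq> 0"
  proof -
    have "t \<in> {0<..1}" "h t = g t" using point that not_doubled_eq by auto
    then show ?thesis using preimage_doubled[of t] g_in[of t] that by auto
  qed
  then show ?thesis using point by (auto simp: extension_def)
next
  case (left_of t)
  then show ?thesis using g_in[of t] by (simp add: extension_def)
qed

lemma position_extension_cases: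
  "position (extension y) = (case y of Point t \<Rightarrow> h t | Left_of t \<Rightarrow> g t)"
  by (cases y) (simp_all add: extension_def)

lemma position_extension:
  assumes p: "p \<in> SI" and s: "s \<in> approach p"
  shows "\<forall>\<^sub>F x in at_right 0. \<forall>y\<in>SI. position y = position p + s * x \<longrightarrow>
    position (extension y) = position (extension p) + s * x"
proof -
  have "s = 1 \<or> s = -1" using s by (cases p) (auto split: if_splits)
  then show ?thesis
  proof
    assume s1: "s = 1"
    then obtain t where t: "p = Point t" using s by (cases p) auto
    then have "t \<in> {0..<1}" using p by (auto simp: split_interval_def)
    from right[OF this] show ?thesis
      by eventually_elim (simp add: position_extension_cases s1 t split: split_point.split)
  next
    assume s1: "s = -1"
    define t where "t = position p"
    have t: "t \<in> {0<..1}" using p s s1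
      by (cases rule: SI_cases) (auto simp: t_def split: if_splits)
    have pe: "position (extension p) = g t" using p
    proof (cases rule: SI_cases)
      case (point u)
      then have "u \<notin> D" "u \<noteq> 0" using s s1 by (auto split: if_splits)
      then show ?thesis using point not_doubled_eq[of u] by (simp add: position_extension_cases t_def)
    qed (simp add: position_extension_cases t_def)
    from left[OF t] show ?thesis
      unfolding pe s1 t_def[symmetric]
      by eventually_elim (simp add: position_extension_cases split: split_point.split)
  qed
qed

lemma extension_Point: "extension (Point t) = Point (h t)"
  by (simp add: extension_def)

lemma extension_Left_of: "t \<in> D \<Longrightarrow> extension (Left_of t) = Left_of (g t)"
  by (simp add: extension_def image_doubled)

lemma split_extension_extension: "split_extension h extension"
  unfolding split_extension_def
proof (intro conjI ballI)
  show "continuous_map (split_topology h) (split_topology h) extension"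
    unfolding continuous_map_def
  proof (intro conjI allI impI)
    show "extension \<in> topspace (split_topology h) \<rightarrow> topspace (split_topology h)"
      using extension_in by auto
    fix U assume U: "openin (split_topology h) U"
    have "openin (split_topology h) {x\<in>SI. extension x \<in> U}"
    proof (rule adjacent_imp_openin)
      fix p s assume p: "p \<in> {x\<in>SI. extension x \<in> U}" and s: "s \<in> approach p"
      have "adjacent U (position (extension p)) s"
        using openin_imp_adjacent[OF U] p s approach_extension[of p] by auto
      moreover have "p \<in> SI" using p by simp
      from position_extension[OF this s]
      show "adjacent {x\<in>SI. extension x \<in> U} (position p) s"
        using calculation unfolding adjacent_def
        by (rule eventually_elim2) (use extension_in in blast)
    qed blast
    then show "openin (split_topology h) {x\<in>topspace (split_topology h). extension x \<in> U}" by simp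
  qed
qed (simp_all only: extension_Point extension_Left_of left_version_eq[OF doubled_range])

text \<open>\<open>Jr\<close> and \<open>Jl\<close> are the points of a set seen from the right and from the left. The hypothesis that
  undoubled points of \<open>Jl\<close> belong to \<open>Jr\<close> is what makes the set below closed; in particular 1 is
  doubled if it belongs to \<open>Jl\<close>.\<close>

lemma minimal_subsystem_closure:
  fixes Jr Jl :: "real set"
  assumes Jr: "Jr \<noteq> {}" "Jr \<subseteq> {0..<1}" and Jl: "Jl \<subseteq> {0<..1}"
    and J_right: "\<And>t. t \<in> {0..<1} \<Longrightarrow>
      \<forall>\<^sub>F x in at_right 0. (t + x \<in> Jr \<longleftrightarrow> t \<in> Jr) \<and> (t + x \<in> Jl \<longleftrightarrow> t \<in> Jr)"
    and J_left: "\<And>t. t \<in> {0<..1} \<Longrightarrow>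
      \<forall>\<^sub>F x in at_right 0. (t - x \<in> Jr \<longleftrightarrow> t \<in> Jl) \<and> (t - x \<in> Jl \<longleftrightarrow> t \<in> Jl)"
    and h_Jr: "h ` Jr = Jr" and g_Jl: "g ` Jl = Jl"
    and not_doubled: "\<And>t. t \<in> Jl \<Longrightarrow> t \<notin> D \<Longrightarrow> t \<in> Jr"
    and dense: "\<And>f t u s P. (f = h \<and> t \<in> Jr) \<or> (f = g \<and> t \<in> Jl) \<Longrightarrow>
      (s = 1 \<and> u \<in> Jr) \<or> (s = -1 \<and> u \<in> Jl) \<Longrightarrow>
      \<forall>\<^sub>F x in at_right 0. P (u + s * x) \<Longrightarrow> \<exists>n. P ((f ^^ n) t)"
  shows "minimal_subsystem (split_topology h) extension (Point ` Jr \<union> Left_of ` (Jl \<inter> D))"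
proof -
  define K where "K = Point ` Jr \<union> Left_of ` (Jl \<inter> D)"
  have K_SI: "K \<subseteq> SI" using Jr by (auto simp: K_def split_interval_def)
  have "openin (split_topology h) (SI - K)"
  proof (rule adjacent_imp_openin)
    fix p s assume p: "p \<in> SI - K" and s: "s \<in> approach p"
    have "s = 1 \<or> s = -1" using s by (cases p) (auto split: if_splits)
    then show "adjacent (SI - K) (position p) s"
    proof
      assume s1: "s = 1"
      then obtain t where t: "p = Point t" using s by (cases p) auto
      then have "t \<in> {0..<1}" "t \<notin> Jr" using p by (auto simp: split_interval_def K_def)
      with J_right[of t] have "\<forall>\<^sub>F x in at_right 0. t + x \<notin> Jr \<and> t + x \<notin> Jl" by simp
      then show ?thesis unfolding adjacent_def
        by eventually_elim (auto simp: K_def s1 t)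
    next
      assume s1: "s = -1"
      define t where "t = position p"
      have pSI: "p \<in> SI" using p by simp
      then have t: "t \<in> {0<..1} \<and> t \<notin> Jl"
      proof (cases rule: SI_cases)
        case (point u)
        then have "u \<notin> D" "u \<noteq> 0" using s s1 by (auto split: if_splits)
        then show ?thesis using point p not_doubled[of u] by (auto simp: t_def K_def)
      next
        case (left_of u)
        have "u \<notin> Jl" if "u \<notin> D" using that not_doubled[of u] left_of Jr by auto
        then show ?thesis using left_of p by (auto simp: t_def K_def)
      qed
      with J_left[of t] have "\<forall>\<^sub>F x in at_right 0. t - x \<notin> Jr \<and> t - x \<notin> Jl" by simp
      then show ?thesis unfolding adjacent_def t_def[symmetric]
        by eventually_elim (auto simp: K_def s1)
    qed
  qed blast
  then have closed: "closedin (split_topology h) K"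
    using K_SI by (simp add: closedin_def)
  have "extension ` K = K"
  proof -
    have 1: "extension ` Point ` Jr = Point ` Jr"
      unfolding image_image extension_Point using h_Jr by (metis image_image)
    have "g ` (Jl \<inter> D) = Jl \<inter> D"
    proof
      show "g ` (Jl \<inter> D) \<subseteq> Jl \<inter> D" using g_Jl image_doubled by blast
      show "Jl \<inter> D \<subseteq> g ` (Jl \<inter> D)"
      proof
        fix t assume t: "t \<in> Jl \<inter> D"
        then obtain u where "u \<in> Jl" "t = g u" using g_Jl by blast
        then show "t \<in> g ` (Jl \<inter> D)" using t Jl preimage_doubled[of u] by blast
      qed
    qed
    moreover have "extension ` Left_of ` (Jl \<inter> D) = Left_of ` g ` (Jl \<inter> D)"
      unfolding image_image by (rule image_cong) (simp_all add: extension_Left_of)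
    ultimately have 2: "extension ` Left_of ` (Jl \<inter> D) = Left_of ` (Jl \<inter> D)" by simp
    show ?thesis unfolding K_def image_Un 1 2 ..
  qed
  moreover have "K \<subseteq> split_topology h closure_of range (\<lambda>n. (extension ^^ n) x)" if x: "x \<in> K" for x
  proof -
    define f where "f = (case x of Point t \<Rightarrow> h | Left_of t \<Rightarrow> g)"
    have orbit: "(extension ^^ n) x \<in> K \<and> position ((extension ^^ n) x) = (f ^^ n) (position x) \<and>
        (case (extension ^^ n) x of Point t \<Rightarrow> f = h | Left_of t \<Rightarrow> f = g)" for n
    proof (induction n)
      case 0 then show ?case using x by (cases x) (auto simp: f_def)
    next
      case (Suc n)
      have "(extension ^^ Suc n) x \<in> K" using Suc \<open>extension ` K = K\<close> by auto
      moreover have "(extension ^^ n) x \<in> K" using Suc by simp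
      ultimately show ?case using Suc
        by (cases "(extension ^^ n) x") (auto simp: extension_Point extension_Left_of K_def)
    qed
    have f: "(f = h \<and> position x \<in> Jr) \<or> (f = g \<and> position x \<in> Jl)"
      using x by (auto simp: f_def K_def)
    show ?thesis
    proof
      fix p assume p: "p \<in> K"
      have "\<exists>y\<in>range (\<lambda>n. (extension ^^ n) x). y \<in> U" if U: "p \<in> U" "openin (split_topology h) U" for U
      proof -
        obtain s where s: "s \<in> approach p" "(s = 1 \<and> position p \<in> Jr) \<or> (s = -1 \<and> position p \<in> Jl)"
        proof (cases p)
          case (Point u)
          then show ?thesis using p that[of 1] by (auto simp: K_def)
        next
          case (Left_of u)
          then show ?thesis using p that[of "-1"] by (auto simp: K_def)
        qed
        have "adjacent U (position p) s" using openin_imp_adjacent[OF U(2)] U(1) s(1) by blast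
        then have "\<forall>\<^sub>F r in at_right 0. \<forall>y\<in>SI. position y = position p + s * r \<longrightarrow> y \<in> U"
          by (simp add: adjacent_def)
        from dense[OF f s(2), of "\<lambda>q. \<forall>y\<in>SI. position y = q \<longrightarrow> y \<in> U", OF this]
        obtain n where "\<forall>y\<in>SI. position y = (f ^^ n) (position x) \<longrightarrow> y \<in> U" by blast
        then have "(extension ^^ n) x \<in> U" using orbit[of n] K_SI by auto
        then show ?thesis by blast
      qed
      moreover have "p \<in> topspace (split_topology h)" using p K_SI by auto
      ultimately show "p \<in> split_topology h closure_of range (\<lambda>n. (extension ^^ n) x)"
        unfolding in_closure_of by blast
    qed
  qed
  ultimately show ?thesis using closed Jr(1) unfolding minimal_subsystem_def K_def[symmetric]
    by (simp add: K_def)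
qed

end

section \<open>From the circle to the interval\<close>

lemma Arg2pi_cis_frac: "Arg2pi (cis (2 * pi * y)) = 2 * pi * frac y"
proof (rule Arg2pi_unique[of 1])
  have "cis (2 * pi * y) = cis (2 * pi * frac y + 2 * pi * of_int \<lfloor>y\<rfloor>)"
    by (simp add: frac_def algebra_simps)
  also have "\<dots> = cis (2 * pi * frac y)"
    by (simp add: cis_mult[symmetric] complex_eq_iff sin_int_2pin cos_int_2pin)
  finally show "complex_of_real 1 * exp (\<i> * complex_of_real (2 * pi * frac y)) = cis (2 * pi * y)"
    by (simp add: cis_conv_exp)
  show "2 * pi * frac y < 2 * pi" using frac_lt_1[of y] by simp
qed (simp_all add: frac_ge_0)

text \<open>The labels are lined up by \<open>e\<close>, and the circle over each of them becomes an interval of length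
  \<open>1 / card (labels \<sigma>)\<close>.\<close>

locale circle_label_system = rotation_extension "labels \<sigma>" \<rho> \<phi>
  for \<sigma> :: "'a::finite \<Rightarrow> 'a list" and \<rho> and \<phi> :: "real \<Rightarrow> complex \<Rightarrow> 'a label \<Rightarrow> 'a label" +
  fixes e :: "'a label \<Rightarrow> nat" and H :: "complex \<times> 'a label \<Rightarrow> complex \<times> 'a label"
  assumes labels_nonempty: "labels \<sigma> \<noteq> {}"
    and e: "bij_betw e (labels \<sigma>) {..<card (labels \<sigma>)}"
    and H: "\<lbrakk>cmod \<tau> = 1; l \<in> labels \<sigma>\<rbrakk> \<Longrightarrow> H (\<tau>, l) = (\<rho> * \<tau>, \<phi> 1 \<tau> l)"
begin

abbreviation "L \<equiv> labels \<sigma>"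
abbreviation "N \<equiv> card L"

text \<open>The circle coordinate of a real number. Since each label occupies one full turn, the same formula serves
  the point \<open>t\<close> and its left-hand copy; only the labels differ, and only at multiples of \<open>1 / N\<close>.\<close>

definition base :: "real \<Rightarrow> complex" where
  "base t = cis (2 * pi * (real N * t))"

definition rlab :: "real \<Rightarrow> 'a label" where
  "rlab t = inv_into L e (nat \<lfloor>real N * t\<rfloor>)"

definition llab :: "real \<Rightarrow> 'a label" where
  "llab t = inv_into L e (nat (\<lceil>real N * t\<rceil> - 1))"

abbreviation "right_point \<equiv> to_interval \<sigma> e"

text \<open>Inverse of \<open>t \<mapsto> (base t, llab t)\<close> on \<open>(0,1]\<close>: seen from the left, the base point 1 over \<open>l\<close> is the right
  end of the interval of \<open>l\<close>.\<close>

definition left_point :: "complex \<times> 'a label \<Rightarrow> real" where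
  "left_point x = (if fst x = 1 then (real (e (snd x)) + 1) / real N else right_point x)"

definition h :: "real \<Rightarrow> real" where
  "h = interval_map \<sigma> e H"

definition g :: "real \<Rightarrow> real" where
  "g t = left_point (\<rho> * base t, \<phi> (-1) (base t) (llab t))"

lemma N_pos: "N > 0"
  using labels_nonempty finite_L by (simp add: card_gt_0_iff)

lemma e_less: "l \<in> L \<Longrightarrow> e l < N"
  using e by (auto simp: bij_betw_def)

lemma inv_e: "k < N \<Longrightarrow> inv_into L e k \<in> L \<and> e (inv_into L e k) = k"
  using e by (metis bij_betw_def f_inv_into_f inv_into_into lessThan_iff)

lemma inv_e_e: "l \<in> L \<Longrightarrow> inv_into L e (e l) = l"
  using e by (simp add: bij_betw_def)

lemma norm_base [simp]: "cmod (base t) = 1"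
  by (simp add: base_def)

lemma base_add: "base (t + s * x) = base t * cis (s * (2 * pi * real N * x))"
  by (simp add: base_def cis_mult algebra_simps)

lemma base_1: "base 1 = 1"
proof -
  have "base 1 = cis (2 * pi * of_int (int N))" by (simp add: base_def)
  then show ?thesis by (simp only: complex_eq_iff cis.simps sin_int_2pin cos_int_2pin) simp
qed

lemma right_point_coordinates:
  assumes "t \<in> {0..<1}"
  shows "rlab t \<in> L" "right_point (base t, rlab t) = t"
proof -
  have y: "0 \<le> real N * t" "real N * t < real N" using assms N_pos by auto
  then have k: "nat \<lfloor>real N * t\<rfloor> < N" by linarith
  then show "rlab t \<in> L" unfolding rlab_def using inv_e by blast
  have "real (e (rlab t)) = of_int \<lfloor>real N * t\<rfloor>" using inv_e[OF k] y by (simp add: rlab_def)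
  then have "right_point (base t, rlab t) = (of_int \<lfloor>real N * t\<rfloor> + frac (real N * t)) / real N"
    by (simp add: to_interval_def base_def Arg2pi_cis_frac)
  also have "\<dots> = t" using N_pos by (simp add: frac_def)
  finally show "right_point (base t, rlab t) = t" .
qed

lemma unit_cis: "cmod \<tau> = 1 \<Longrightarrow> cis (Arg2pi \<tau>) = \<tau>"
  using complex_norm_eq_1_exp[of \<tau>] by (simp add: cis_conv_exp)

lemma coordinates_right_point:
  assumes "cmod \<tau> = 1" and l: "l \<in> L"
  shows "right_point (\<tau>, l) \<in> {0..<1}" "base (right_point (\<tau>, l)) = \<tau>" "rlab (right_point (\<tau>, l)) = l"
proof -
  define \<alpha> where "\<alpha> = Arg2pi \<tau> / (2 * pi)"
  have \<alpha>: "0 \<le> \<alpha>" "\<alpha> < 1" using Arg2pi[of \<tau>] by (auto simp: \<alpha>_def)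
  have t: "right_point (\<tau>, l) = (real (e l) + \<alpha>) / real N" by (simp add: to_interval_def \<alpha>_def)
  then have Nt: "real N * right_point (\<tau>, l) = real (e l) + \<alpha>" using N_pos by simp
  have "real (e l) + \<alpha> < real N" using e_less[OF l] \<alpha> by linarith
  then show "right_point (\<tau>, l) \<in> {0..<1}" unfolding t using \<alpha> N_pos by (auto simp: field_simps)
  have "base (right_point (\<tau>, l)) = cis (2 * pi * of_int (int (e l))) * cis (2 * pi * \<alpha>)"
    unfolding base_def Nt by (simp add: cis_mult algebra_simps)
  also have "cis (2 * pi * of_int (int (e l))) = 1" by (simp only: complex_eq_iff cis.simps sin_int_2pin cos_int_2pin) simp
  finally show "base (right_point (\<tau>, l)) = \<tau>" using unit_cis[OF assms(1)] by (simp add: \<alpha>_def)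
  have "\<lfloor>real (e l) + \<alpha>\<rfloor> = int (e l)" using \<alpha> by linarith
  then show "rlab (right_point (\<tau>, l)) = l" unfolding rlab_def Nt using inv_e_e[OF l] by simp
qed

lemma left_point_coordinates:
  assumes "t \<in> {0<..1}"
  shows "llab t \<in> L" "left_point (base t, llab t) = t"
proof -
  have y: "0 < real N * t" "real N * t \<le> real N" using assms N_pos by auto
  then have k: "nat (\<lceil>real N * t\<rceil> - 1) < N" by linarith
  then show "llab t \<in> L" unfolding llab_def using inv_e by blast
  have el: "real (e (llab t)) = of_int \<lceil>real N * t\<rceil> - 1" using inv_e[OF k] y by (simp add: llab_def)
  show "left_point (base t, llab t) = t"
  proof (cases "base t = 1")
    case True
    then have "2 * pi * frac (real N * t) = 0"
      using Arg2pi_cis_frac[of "real N * t"] Arg2pi_of_real[of 1] by (simp add: base_def)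
    then have "frac (real N * t) = 0" by simp
    then have "of_int \<lceil>real N * t\<rceil> = real N * t" by (metis frac_eq_0_iff ceiling_of_int Ints_cases)
    then have "real (e (llab t)) + 1 = real N * t" using el by linarith
    then show ?thesis using True N_pos by (simp only: left_point_def fst_conv snd_conv if_True) simp
  next
    case False
    have "real N * t \<notin> \<int>"
    proof
      assume "real N * t \<in> \<int>"
      then obtain k where "real N * t = of_int k" by (auto elim: Ints_cases)
      then have "base t = 1" by (simp add: base_def complex_eq_iff sin_int_2pin cos_int_2pin)
      then show False using False by simp
    qed
    then have "real N * t \<noteq> of_int \<lfloor>real N * t\<rfloor>" by (metis Ints_of_int)
    then have "of_int \<lceil>real N * t\<rceil> - 1 = real_of_int \<lfloor>real N * t\<rfloor>"
      unfolding ceiling_altdef by simp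
    then have "left_point (base t, llab t) = (of_int \<lfloor>real N * t\<rfloor> + frac (real N * t)) / real N"
      using False el by (simp add: left_point_def to_interval_def base_def Arg2pi_cis_frac)
    also have "\<dots> = t" using N_pos by (simp add: frac_def)
    finally show ?thesis .
  qed
qed

lemma coordinates_left_point:
  assumes \<tau>: "cmod \<tau> = 1" and l: "l \<in> L"
  shows "left_point (\<tau>, l) \<in> {0<..1}" "base (left_point (\<tau>, l)) = \<tau>" "llab (left_point (\<tau>, l)) = l"
proof -
  \<comment> \<open>the angle in full turns, in \<open>(0,1]\<close> rather than \<open>[0,1)\<close>\<close>
  define \<alpha> where "\<alpha> = (if \<tau> = 1 then 1 else Arg2pi \<tau> / (2 * pi))"
  have "Arg2pi \<tau> \<noteq> 0" if "\<tau> \<noteq> 1" using unit_cis[OF \<tau>] that by auto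
  then have \<alpha>: "0 < \<alpha>" "\<alpha> \<le> 1" using Arg2pi[of \<tau>] by (auto simp: \<alpha>_def order.strict_iff_order)
  have c\<alpha>: "cis (2 * pi * \<alpha>) = \<tau>" using unit_cis[OF \<tau>] by (auto simp: \<alpha>_def)
  have t: "left_point (\<tau>, l) = (real (e l) + \<alpha>) / real N"
    by (simp add: to_interval_def left_point_def \<alpha>_def)
  then have Nt: "real N * left_point (\<tau>, l) = real (e l) + \<alpha>" using N_pos by simp
  have "real (e l) + \<alpha> \<le> real N" using e_less[OF l] \<alpha> by linarith
  then show "left_point (\<tau>, l) \<in> {0<..1}" unfolding t using \<alpha> N_pos by (auto simp: field_simps)
  have "base (left_point (\<tau>, l)) = cis (2 * pi * of_int (int (e l))) * cis (2 * pi * \<alpha>)"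
    unfolding base_def Nt by (simp add: cis_mult algebra_simps)
  also have "cis (2 * pi * of_int (int (e l))) = 1" by (simp only: complex_eq_iff cis.simps sin_int_2pin cos_int_2pin) simp
  finally show "base (left_point (\<tau>, l)) = \<tau>" using c\<alpha> by simp
  have "\<lceil>real (e l) + \<alpha>\<rceil> = int (e l) + 1" using \<alpha> by linarith
  then show "llab (left_point (\<tau>, l)) = l" unfolding llab_def Nt using inv_e_e[OF l] by simp
qed

lemma coordinates_near_right:
  assumes "t \<in> {0..<1}"
  shows "\<forall>\<^sub>F x in at_right 0. t + x \<in> {0<..<1} \<and> rlab (t + x) = rlab t \<and> llab (t + x) = rlab t"
proof -
  \<comment> \<open>the distance from \<open>t\<close> to the next multiple of \<open>1 / N\<close>, where the label changes\<close>
  define b where "b = (of_int \<lfloor>real N * t\<rfloor> + 1 - real N * t) / real N"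
  have "of_int \<lfloor>real N * t\<rfloor> + 1 - real N * t > 0" by linarith
  then have "b > 0" using N_pos by (simp add: b_def)
  moreover have "t + x \<in> {0<..<1} \<and> rlab (t + x) = rlab t \<and> llab (t + x) = rlab t" if x: "0 < x" "x < b" for x
  proof -
    have "real N * x < of_int \<lfloor>real N * t\<rfloor> + 1 - real N * t"
      using x(2) N_pos by (simp add: b_def field_simps)
    then have *: "real N * (t + x) < of_int \<lfloor>real N * t\<rfloor> + 1" by (simp add: algebra_simps)
    have **: "real N * t < real N * (t + x)" using x N_pos by simp
    have f: "\<lfloor>real N * (t + x)\<rfloor> = \<lfloor>real N * t\<rfloor>" "\<lceil>real N * (t + x)\<rceil> - 1 = \<lfloor>real N * t\<rfloor>"
      using * ** by linarith+
    have "real N * t < of_int (int N)" using assms N_pos by simp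
    then have "\<lfloor>real N * t\<rfloor> < int N" by linarith
    then have "real_of_int \<lfloor>real N * t\<rfloor> + 1 \<le> real N" by linarith
    then have "real N * (t + x) < real N" using * by linarith
    then have "t + x < 1" using N_pos by simp
    then show ?thesis using f x assms by (simp add: rlab_def llab_def)
  qed
  ultimately show ?thesis unfolding eventually_at_right_field by auto
qed

lemma coordinates_near_left:
  assumes "t \<in> {0<..1}"
  shows "\<forall>\<^sub>F x in at_right 0. t - x \<in> {0<..<1} \<and> rlab (t - x) = llab t \<and> llab (t - x) = llab t"
proof -
  define b where "b = (real N * t - (of_int \<lceil>real N * t\<rceil> - 1)) / real N"
  have "real N * t - (of_int \<lceil>real N * t\<rceil> - 1) > 0" by linarith
  then have "b > 0" using N_pos by (simp add: b_def)
  moreover have "t - x \<in> {0<..<1} \<and> rlab (t - x) = llab t \<and> llab (t - x) = llab t" if x: "0 < x" "x < b" for x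
  proof -
    have "real N * x < real N * t - (of_int \<lceil>real N * t\<rceil> - 1)"
      using x(2) N_pos by (simp add: b_def field_simps)
    then have *: "real N * (t - x) > of_int \<lceil>real N * t\<rceil> - 1" by (simp add: algebra_simps)
    have **: "real N * (t - x) < real N * t" using x N_pos by simp
    have f: "\<lfloor>real N * (t - x)\<rfloor> = \<lceil>real N * t\<rceil> - 1" "\<lceil>real N * (t - x)\<rceil> - 1 = \<lceil>real N * t\<rceil> - 1"
      using * ** by linarith+
    have "real N * t > 0" using assms N_pos by simp
    then have "\<lceil>real N * t\<rceil> > 0" by linarith
    then have "real_of_int \<lceil>real N * t\<rceil> \<ge> 1" by linarith
    then have "real N * (t - x) > 0" using * by linarith
    then have "t - x > 0" using N_pos by (simp add: zero_less_mult_iff)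
    then show ?thesis using f x assms by (simp add: rlab_def llab_def)
  qed
  ultimately show ?thesis unfolding eventually_at_right_field by auto
qed

lemma eventually_base:
  assumes "eventually P (side s (base t))"
  shows "\<forall>\<^sub>F x in at_right 0. P (base (t + s * x))"
proof -
  obtain \<epsilon> where \<epsilon>: "\<epsilon> > 0" "\<And>\<theta>. 0 < \<theta> \<Longrightarrow> \<theta> < \<epsilon> \<Longrightarrow> P (base t * cis (s * \<theta>))"
    using assms unfolding eventually_side by auto
  have "P (base (t + s * x))" if "0 < x" "x < \<epsilon> / (2 * pi * real N)" for x
    unfolding base_add using that N_pos by (intro \<epsilon>(2)) (auto simp: field_simps)
  moreover have "\<epsilon> / (2 * pi * real N) > 0" using \<epsilon>(1) N_pos by simp
  ultimately show ?thesis unfolding eventually_at_right_field by auto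
qed

lemma eventually_side_base:
  assumes "\<forall>\<^sub>F x in at_right 0. P x"
  shows "\<forall>\<^sub>F t' in side s (base t). \<exists>x. P x \<and> t' = base (t + s * x)"
proof -
  obtain b where b: "b > 0" "\<And>x. 0 < x \<Longrightarrow> x < b \<Longrightarrow> P x"
    using assms unfolding eventually_at_right_field by auto
  have "\<exists>x. P x \<and> base t * cis (s * \<theta>) = base (t + s * x)" if "0 < \<theta>" "\<theta> < 2 * pi * real N * b" for \<theta>
    unfolding base_add using that N_pos b(2)
    by (intro exI[of _ "\<theta> / (2 * pi * real N)"]) (auto simp: field_simps)
  moreover have "2 * pi * real N * b > 0" using b(1) N_pos by simp
  ultimately show ?thesis unfolding eventually_side by blast
qed

lemma inv_right_point: "t \<in> {0..<1} \<Longrightarrow> inv_into (phase_space \<sigma>) right_point t = (base t, rlab t)"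
proof -
  assume t: "t \<in> {0..<1}"
  have "inj_on right_point (phase_space \<sigma>)"
  proof (rule inj_onI)
    fix x y assume "x \<in> phase_space \<sigma>" "y \<in> phase_space \<sigma>" "right_point x = right_point y"
    then show "x = y" unfolding phase_space_def
      using coordinates_right_point(2,3) by (metis mem_Sigma_iff mem_sphere_0 prod.collapse)
  qed
  moreover have "(base t, rlab t) \<in> phase_space \<sigma>"
    using right_point_coordinates(1)[OF t] by (simp add: phase_space_def)
  ultimately show ?thesis using right_point_coordinates(2)[OF t] inv_into_f_f by metis
qed

lemma h_eq: "t \<in> {0..<1} \<Longrightarrow> h t = right_point (\<rho> * base t, \<phi> 1 (base t) (rlab t))"
  by (simp add: h_def interval_map_def inv_right_point H right_point_coordinates(1))

lemma norm_\<rho>_base: "cmod (\<rho> * base t) = 1"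
  by (simp add: norm_mult norm_\<rho>)

lemma h_coordinates:
  assumes "t \<in> {0..<1}"
  shows "h t \<in> {0..<1}" "base (h t) = \<rho> * base t" "rlab (h t) = \<phi> 1 (base t) (rlab t)"
proof -
  have "\<phi> 1 (base t) (rlab t) \<in> L" using \<phi>_in right_point_coordinates(1)[OF assms] by simp
  note * = coordinates_right_point[OF norm_\<rho>_base this]
  show "h t \<in> {0..<1}" "base (h t) = \<rho> * base t" "rlab (h t) = \<phi> 1 (base t) (rlab t)"
    unfolding h_eq[OF assms] by (fact *)+
qed

lemma g_coordinates:
  assumes "t \<in> {0<..1}"
  shows "g t \<in> {0<..1}" "base (g t) = \<rho> * base t" "llab (g t) = \<phi> (-1) (base t) (llab t)"
proof -
  have "\<phi> (-1) (base t) (llab t) \<in> L" using \<phi>_in left_point_coordinates(1)[OF assms] by simp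
  note * = coordinates_left_point[OF norm_\<rho>_base this]
  show "g t \<in> {0<..1}" "base (g t) = \<rho> * base t" "llab (g t) = \<phi> (-1) (base t) (llab t)"
    unfolding g_def by (fact *)+
qed

lemma base_shift: "base u = \<rho> * base t \<Longrightarrow> base (u + s * x) = \<rho> * base (t + s * x)"
  by (simp add: base_add)

sublocale line: piecewise_translation h g
proof
  show "g 1 \<noteq> 1"
  proof
    assume "g 1 = 1"
    then have "\<rho> ^ 1 = 1" using g_coordinates(2)[of 1] base_1 by simp
    then show False using irrational by (metis zero_less_one)
  qed
  fix t :: real assume t: "t \<in> {0..<1}"
  have near: "\<forall>\<^sub>F x in at_right 0. \<forall>r\<in>{1,-1}. \<phi> r (base (t + 1 * x)) (rlab t) = \<phi> 1 (base t) (rlab t)"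
    by (intro eventually_base \<phi>_near right_point_coordinates(1)[OF t]) simp_all
  show "\<forall>\<^sub>F x in at_right 0. h (t + x) = h t + x \<and> g (t + x) = h t + x"
    using coordinates_near_right[OF t] coordinates_near_right[OF h_coordinates(1)[OF t]] near
  proof eventually_elim
    case (elim x)
    have b: "base (h t + x) = \<rho> * base (t + x)"
      using base_shift[OF h_coordinates(2)[OF t], of 1 x] by simp
    have "h (t + x) = right_point (base (h t + x), rlab (h t + x))"
      using elim h_coordinates(3)[OF t] by (subst h_eq) (auto simp: b)
    moreover have "g (t + x) = left_point (base (h t + x), llab (h t + x))"
      using elim h_coordinates(3)[OF t] by (auto simp: g_def[of "t + x"] b)
    ultimately show ?case
      using elim right_point_coordinates(2)[of "h t + x"] left_point_coordinates(2)[of "h t + x"] by auto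
  qed
next
  fix t :: real assume t: "t \<in> {0<..1}"
  have near: "\<forall>\<^sub>F x in at_right 0. \<forall>r\<in>{1,-1}.
      \<phi> r (base (t + (-1) * x)) (llab t) = \<phi> (-1) (base t) (llab t)"
    by (intro eventually_base \<phi>_near left_point_coordinates(1)[OF t]) simp_all
  show "\<forall>\<^sub>F x in at_right 0. h (t - x) = g t - x \<and> g (t - x) = g t - x"
    using coordinates_near_left[OF t] coordinates_near_left[OF g_coordinates(1)[OF t]] near
  proof eventually_elim
    case (elim x)
    have b: "base (g t - x) = \<rho> * base (t - x)"
      using base_shift[OF g_coordinates(2)[OF t], of "-1" x] by simp
    have "h (t - x) = right_point (base (g t - x), rlab (g t - x))"
      using elim g_coordinates(3)[OF t] by (subst h_eq) (auto simp: b)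
    moreover have "g (t - x) = left_point (base (g t - x), llab (g t - x))"
      using elim g_coordinates(3)[OF t] by (auto simp: g_def[of "t - x"] b)
    ultimately show ?case
      using elim right_point_coordinates(2)[of "g t - x"] left_point_coordinates(2)[of "g t - x"] by auto
  qed
qed (use h_coordinates(1) g_coordinates(1) in auto)

definition right_part :: "(real \<Rightarrow> complex \<Rightarrow> 'a label set) \<Rightarrow> real set" where
  "right_part Y = {t\<in>{0..<1}. rlab t \<in> Y 1 (base t)}"

definition left_part :: "(real \<Rightarrow> complex \<Rightarrow> 'a label set) \<Rightarrow> real set" where
  "left_part Y = {t\<in>{0<..1}. llab t \<in> Y (-1) (base t)}"

lemma h_right_part:
  assumes Y: "invariant_field Y"
  shows "h ` right_part Y = right_part Y"
proof
  show "h ` right_part Y \<subseteq> right_part Y"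
    using h_coordinates invariant_fieldD(3)[OF Y, of 1, OF _ norm_base] by (fastforce simp: right_part_def)
  show "right_part Y \<subseteq> h ` right_part Y"
  proof
    fix t assume t: "t \<in> right_part Y"
    define \<tau> where "\<tau> = base t / \<rho>"
    have \<tau>: "cmod \<tau> = 1" "\<rho> * \<tau> = base t" using norm_\<rho> by (auto simp: \<tau>_def norm_divide)
    have "rlab t \<in> \<phi> 1 \<tau> ` Y 1 \<tau>"
      using t invariant_fieldD(3)[OF Y, of 1, OF _ \<tau>(1)] \<tau>(2) by (simp add: right_part_def)
    then obtain l where l: "l \<in> Y 1 \<tau>" "rlab t = \<phi> 1 \<tau> l" by blast
    have "l \<in> L" using l invariant_fieldD(2)[OF Y, of 1, OF _ \<tau>(1)] by auto
    note c = coordinates_right_point[OF \<tau>(1) this]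
    have "h (right_point (\<tau>, l)) = right_point (base t, rlab t)" using c \<tau> l by (simp add: h_eq)
    also have "\<dots> = t" using t right_point_coordinates by (auto simp: right_part_def)
    finally show "t \<in> h ` right_part Y" using c l by (force simp: right_part_def)
  qed
qed

lemma g_left_part:
  assumes Y: "invariant_field Y"
  shows "g ` left_part Y = left_part Y"
proof
  show "g ` left_part Y \<subseteq> left_part Y"
    using g_coordinates invariant_fieldD(3)[OF Y, of "-1", OF _ norm_base] by (fastforce simp: left_part_def)
  show "left_part Y \<subseteq> g ` left_part Y"
  proof
    fix t assume t: "t \<in> left_part Y"
    define \<tau> where "\<tau> = base t / \<rho>"
    have \<tau>: "cmod \<tau> = 1" "\<rho> * \<tau> = base t" using norm_\<rho> by (auto simp: \<tau>_def norm_divide)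
    have "llab t \<in> \<phi> (-1) \<tau> ` Y (-1) \<tau>"
      using t invariant_fieldD(3)[OF Y, of "-1", OF _ \<tau>(1)] \<tau>(2) by (simp add: left_part_def)
    then obtain l where l: "l \<in> Y (-1) \<tau>" "llab t = \<phi> (-1) \<tau> l" by blast
    have "l \<in> L" using l invariant_fieldD(2)[OF Y, of "-1", OF _ \<tau>(1)] by auto
    note c = coordinates_left_point[OF \<tau>(1) this]
    have "g (left_point (\<tau>, l)) = left_point (base t, llab t)" using c \<tau> l by (simp add: g_def)
    also have "\<dots> = t" using t left_point_coordinates by (auto simp: left_part_def)
    finally show "t \<in> g ` left_part Y" using c l by (force simp: left_part_def)
  qed
qed

text \<open>Call \<open>t\<close> bad if it violates the claim. A bad point \<open>t\<close> is the image under \<open>g\<close> of a point of the left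
  part, which is not doubled since \<open>t\<close> is not. If it is 1, it lies outside the right part
  anyway; otherwise \<open>h\<close> and \<open>g\<close> agree there. So this preimage is bad as well.
  Bad points over base points other than 1 are jumps of the field, the base points of a backward chain are
  distinct, and there are only finitely many jumps.\<close>

lemma left_part_not_doubled:
  assumes Y: "invariant_field Y" and t: "t \<in> left_part Y" "t \<notin> line.D"
  shows "t \<in> right_part Y"
proof (rule ccontr)
  assume "t \<notin> right_part Y"
  define B where "B = {u. u \<in> left_part Y \<and> u \<notin> line.D \<and> u \<notin> right_part Y}"
  have pred: "\<exists>u'\<in>B. g u' = u" if "u \<in> B" for u
  proof -
    obtain u' where u': "u' \<in> left_part Y" "g u' = u"
      using g_left_part[OF Y] \<open>u \<in> B\<close> by (force simp: B_def)
    have r: "u' \<in> {0<..1}" using u' by (auto simp: left_part_def)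
    have D: "u' \<notin> line.D" using line.image_doubled[of u'] \<open>u \<in> B\<close> u' by (auto simp: B_def)
    have "u' \<notin> right_part Y"
    proof
      assume a: "u' \<in> right_part Y"
      then have "u' < 1" by (auto simp: right_part_def)
      then have "h u' = u" using line.not_doubled_eq[OF D] r u' by auto
      then have "u \<in> right_part Y" using h_right_part[OF Y] a by blast
      then show False using \<open>u \<in> B\<close> by (simp add: B_def)
    qed
    then show ?thesis using u' D by (auto simp: B_def)
  qed
  have "t \<in> B" using t \<open>t \<notin> right_part Y\<close> by (simp add: B_def)
  then obtain v :: "nat \<Rightarrow> real" where v: "\<And>n. v n \<in> B" and gv: "\<And>n. g (v (Suc n)) = v n"
    using dependent_nat_choice[of "\<lambda>_ u. u \<in> B" "\<lambda>_ u u'. g u' = u"] pred by blast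
  have bv: "base (v n) = inverse \<rho> ^ n * base (v 0)" for n
  proof (induction n)
    case 0 then show ?case by simp
  next
    case (Suc n)
    have "v (Suc n) \<in> {0<..1}" using v[of "Suc n"] by (auto simp: B_def left_part_def)
    then have "base (v n) = \<rho> * base (v (Suc n))" using g_coordinates(2) gv by metis
    moreover have "\<rho> \<noteq> 0" using norm_\<rho> by auto
    ultimately show ?case using Suc by (simp add: field_simps)
  qed
  have inj: "inj (\<lambda>n. base (v n))"
  proof (rule injI, rule ccontr)
    have *: False if "n < m" "base (v n) = base (v m)" for n m
    proof -
      have "base (v 0) \<noteq> 0" "\<rho> \<noteq> 0" using norm_base[of "v 0"] norm_\<rho> by (auto simp del: norm_base)
      moreover have "inverse \<rho> ^ m = inverse \<rho> ^ n * inverse \<rho> ^ (m - n)"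
        using that(1) by (simp add: power_add[symmetric])
      ultimately have "inverse \<rho> ^ (m - n) = 1" using that(2) unfolding bv[of n] bv[of m] by simp
      then have "\<rho> ^ (m - n) = 1" by (simp add: power_inverse)
      then show False using irrational that(1) by (metis zero_less_diff)
    qed
    fix n m assume "base (v n) = base (v m)" "n \<noteq> m"
    then show False using *[of n m] *[of m n] by (metis linorder_neqE_nat)
  qed
  \<comment> \<open>At base point 1 the left and the right label of a real number belong to different copies of the
    circle, so there is no jump to be found; but the chain meets that base point at most once.\<close>
  have "base (v n) \<in> {\<tau>. cmod \<tau> = 1 \<and> Y 1 \<tau> \<noteq> Y (-1) \<tau>} \<union> {1}" for n
  proof (cases "base (v n) = 1")
    case False
    let ?u = "v n"
    have u: "?u \<in> {0<..1}" "llab ?u \<in> Y (-1) (base ?u)" "?u \<notin> right_part Y"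
      using v[of n] by (auto simp: B_def left_part_def)
    have lL: "llab ?u \<in> L" using left_point_coordinates(1)[OF u(1)] .
    have "right_point (base ?u, llab ?u) = ?u"
      using left_point_coordinates(2)[OF u(1)] False by (simp add: left_point_def)
    then have "?u \<in> {0..<1}" "rlab ?u = llab ?u"
      using coordinates_right_point[OF norm_base lL, of ?u] by simp_all
    then have "llab ?u \<notin> Y 1 (base ?u)" using u(3) by (simp add: right_part_def)
    then show ?thesis using u(2) by auto
  qed simp
  then have sub: "range (\<lambda>n. base (v n)) \<subseteq> {\<tau>. cmod \<tau> = 1 \<and> Y 1 \<tau> \<noteq> Y (-1) \<tau>} \<union> {1}"
    by (rule image_subsetI)
  have "finite (range (\<lambda>n. base (v n)))"
    by (rule finite_subset[OF sub]) (simp add: field_jumps_finite[OF Y])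
  then show False using inj by (simp add: finite_image_iff)
qed

text \<open>An accumulation label at \<open>base u\<close> turns into actual visits near \<open>u\<close>, since a real number is determined by
  its base point and its label.\<close>

lemma orbit_hits:
  assumes y: "\<And>m. fst (y m) = base (v m)"
    and lab: "(\<forall>m. v m \<in> {0..<1} \<and> snd (y m) = rlab (v m)) \<or> (\<forall>m. v m \<in> {0<..1} \<and> snd (y m) = llab (v m))"
    and u: "(s = 1 \<and> u \<in> {0..<1} \<and> rlab u \<in> accumulation y s (base u)) \<or>
            (s = -1 \<and> u \<in> {0<..1} \<and> llab u \<in> accumulation y s (base u))"
    and P: "\<forall>\<^sub>F x in at_right 0. P (u + s * x)"
  shows "\<exists>m. P (v m)"
proof -
  define l where "l = (if s = 1 then rlab u else llab u)"
  have l: "l \<in> accumulation y s (base u)"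
    "\<forall>\<^sub>F x in at_right 0. u + s * x \<in> {0<..<1} \<and> rlab (u + s * x) = l \<and> llab (u + s * x) = l"
    using u coordinates_near_right[of u] coordinates_near_left[of u] by (auto simp: l_def)
  have "\<forall>\<^sub>F x in at_right 0. P (u + s * x) \<and>
      u + s * x \<in> {0<..<1} \<and> rlab (u + s * x) = l \<and> llab (u + s * x) = l"
    using P l(2) by eventually_elim simp
  from eventually_side_base[OF this, of u s] l(1)
  have "\<exists>\<^sub>F m in sequentially. (\<exists>x. (P (u + s * x) \<and>
      u + s * x \<in> {0<..<1} \<and> rlab (u + s * x) = l \<and> llab (u + s * x) = l) \<and>
      fst (y m) = base (u + s * x)) \<and> snd (y m) = l"
    unfolding accumulation_def by blast
  then obtain m where "(\<exists>x. (P (u + s * x) \<and>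
      u + s * x \<in> {0<..<1} \<and> rlab (u + s * x) = l \<and> llab (u + s * x) = l) \<and>
      fst (y m) = base (u + s * x)) \<and> snd (y m) = l" by (blast dest: frequently_ex)
  then obtain x where m: "P (u + s * x)" "u + s * x \<in> {0<..<1}" "rlab (u + s * x) = l"
    "llab (u + s * x) = l" "base (v m) = base (u + s * x)" "snd (y m) = l"
    using y[of m] by auto
  have "v m = u + s * x"
    using lab
  proof
    assume "\<forall>m. v m \<in> {0..<1} \<and> snd (y m) = rlab (v m)"
    then show ?thesis using m right_point_coordinates(2)[of "v m"] right_point_coordinates(2)[of "u + s * x"] by simp
  next
    assume "\<forall>m. v m \<in> {0<..1} \<and> snd (y m) = llab (v m)"
    then show ?thesis using m left_point_coordinates(2)[of "v m"] left_point_coordinates(2)[of "u + s * x"] by simp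
  qed
  then show ?thesis using m(1) by metis
qed

text \<open>The component is the right-hand part of the accumulation field of the backward orbit. \<open>H\<close> is bijective on it
  because the field is invariant and has constant cardinality.\<close>

theorem backward_orbit_in_minimal_component:
  assumes x: "\<And>m. x m \<in> phase_space \<sigma>" and Hx: "\<And>m. H (x (Suc m)) = x m"
  shows "\<exists>J. minimal_component \<sigma> e H J \<and> bij_betw H J J \<and> (\<forall>m. x m \<in> J)"
proof -
  have x1: "cmod (fst (x m)) = 1" "snd (x m) \<in> L" for m
    using x[of m] by (auto simp: phase_space_def)
  have x_eq: "x m = (\<rho> * fst (x (Suc m)), \<phi> 1 (fst (x (Suc m))) (snd (x (Suc m))))" for m
    using H[OF x1[of "Suc m"]] unfolding prod.collapse Hx .
  have bwd: "fst (x m) = \<rho> * fst (x (Suc m))"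
      "snd (x m) = \<phi> 1 (fst (x (Suc m))) (snd (x (Suc m)))" for m
    by (subst x_eq[of m], rule fst_conv, subst x_eq[of m], rule snd_conv)
  have "step (x (Suc m)) (x m)" for m
    unfolding step_def using bwd[of m] by blast
  then have traj: "trajectory x" unfolding trajectory_def using x1 by blast
  define Y where "Y = accumulation x"
  have Y: "invariant_field Y" unfolding Y_def by (rule accumulation_field[OF traj])
  define K where "K = Point ` right_part Y \<union> Left_of ` (left_part Y \<inter> line.D)"
  have in_Y: "snd (x m) \<in> Y 1 (fst (x m))" for m
    unfolding Y_def by (rule backward_orbit_in_accumulation[OF traj bwd])
  have "minimal_subsystem (split_topology h) line.extension K"
    unfolding K_def
  proof (rule line.minimal_subsystem_closure)
    have "right_point (x 0) \<in> right_part Y"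
      using coordinates_right_point[OF x1[of 0]] in_Y[of 0] by (simp add: right_part_def)
    then show "right_part Y \<noteq> {}" by blast
    show "\<forall>\<^sub>F x in at_right 0. (t + x \<in> right_part Y \<longleftrightarrow> t \<in> right_part Y) \<and>
        (t + x \<in> left_part Y \<longleftrightarrow> t \<in> right_part Y)" if t: "t \<in> {0..<1}" for t
    proof -
      have "\<forall>\<^sub>F x in at_right 0. \<forall>r\<in>{1,-1}. Y r (base (t + 1 * x)) = Y 1 (base t)"
        by (intro eventually_base field_locally_constant Y) simp_all
      with coordinates_near_right[OF t] show ?thesis
        by eventually_elim (use t in \<open>simp add: right_part_def left_part_def\<close>)
    qed
    show "\<forall>\<^sub>F x in at_right 0. (t - x \<in> right_part Y \<longleftrightarrow> t \<in> left_part Y) \<and>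
        (t - x \<in> left_part Y \<longleftrightarrow> t \<in> left_part Y)" if t: "t \<in> {0<..1}" for t
    proof -
      have "\<forall>\<^sub>F x in at_right 0. \<forall>r\<in>{1,-1}. Y r (base (t + (-1) * x)) = Y (-1) (base t)"
        by (intro eventually_base field_locally_constant Y) simp_all
      with coordinates_near_left[OF t] show ?thesis
        by eventually_elim (use t in \<open>simp add: right_part_def left_part_def\<close>)
    qed
  next
    fix f :: "real \<Rightarrow> real" and t u s :: real and P :: "real \<Rightarrow> bool"
    assume f: "(f = h \<and> t \<in> right_part Y) \<or> (f = g \<and> t \<in> left_part Y)"
      and s: "(s = 1 \<and> u \<in> right_part Y) \<or> (s = -1 \<and> u \<in> left_part Y)"
      and P: "\<forall>\<^sub>F x in at_right 0. P (u + s * x)"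
    define v where "v n = (f ^^ n) t" for n
    have vS: "v (Suc n) = f (v n)" for n by (simp add: v_def)
    obtain y where y: "\<And>m. fst (y m) = base (v m)"
      "(\<forall>m. v m \<in> {0..<1} \<and> snd (y m) = rlab (v m)) \<or> (\<forall>m. v m \<in> {0<..1} \<and> snd (y m) = llab (v m))"
      "trajectory y" "\<And>m. \<exists>r\<in>{1,-1}. snd (y m) \<in> Y r (fst (y m))"
      using f
    proof
      assume f: "f = h \<and> t \<in> right_part Y"
      have v: "v n \<in> right_part Y" for n
        by (induction n) (use f h_right_part[OF Y] in \<open>auto simp: v_def\<close>)
      then have v01: "v n \<in> {0..<1}" for n by (auto simp: right_part_def)
      define y where "y n = (base (v n), rlab (v n))" for n
      show ?thesis
      proof (rule that[of y])
        have "step (y n) (y (Suc n))" for n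
          unfolding step_def y_def vS using f h_coordinates[OF v01[of n]] by simp
        then show "trajectory y" unfolding trajectory_def
          using right_point_coordinates(1)[OF v01] by (simp add: y_def)
        show "\<exists>r\<in>{1,-1}. snd (y m) \<in> Y r (fst (y m))" for m
          using v[of m] by (simp add: y_def right_part_def)
      qed (use v01 in \<open>simp_all add: y_def\<close>)
    next
      assume f: "f = g \<and> t \<in> left_part Y"
      have v: "v n \<in> left_part Y" for n
        by (induction n) (use f g_left_part[OF Y] in \<open>auto simp: v_def\<close>)
      then have v01: "v n \<in> {0<..1}" for n by (auto simp: left_part_def)
      define y where "y n = (base (v n), llab (v n))" for n
      show ?thesis
      proof (rule that[of y])
        have "step (y n) (y (Suc n))" for n
          unfolding step_def y_def vS using f g_coordinates[OF v01[of n]] by simp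
        then show "trajectory y" unfolding trajectory_def
          using left_point_coordinates(1)[OF v01] by (simp add: y_def)
        show "\<exists>r\<in>{1,-1}. snd (y m) \<in> Y r (fst (y m))" for m
          using v[of m] by (simp add: y_def left_part_def)
      qed (use v01 in \<open>simp_all add: y_def\<close>)
    qed
    have acc: "accumulation y r \<tau> = Y r \<tau>" if "r \<in> {1,-1}" "cmod \<tau> = 1" for r \<tau>
      using accumulation_of_orbit_in_field[OF traj bwd y(3) _ that] y(4) by (simp add: Y_def)
    have "\<exists>m. P (v m)"
      by (rule orbit_hits[OF y(1,2) _ P])
        (use s acc in \<open>auto simp: right_part_def left_part_def\<close>)
    then show "\<exists>n. P ((f ^^ n) t)" by (simp add: v_def)
  qed (use h_right_part[OF Y] g_left_part[OF Y] left_part_not_doubled[OF Y] in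
      \<open>auto simp: right_part_def left_part_def\<close>)
  define J where "J = {x\<in>phase_space \<sigma>. Point (right_point x) \<in> K}"
  have J: "J = {(\<tau>, l). cmod \<tau> = 1 \<and> l \<in> Y 1 \<tau>}"
  proof -
    have "(\<tau>, l) \<in> J \<longleftrightarrow> cmod \<tau> = 1 \<and> l \<in> Y 1 \<tau>" for \<tau> l
    proof (cases "cmod \<tau> = 1 \<and> l \<in> L")
      case True
      then show ?thesis using coordinates_right_point[of \<tau> l]
        by (auto simp: J_def K_def right_part_def phase_space_def)
    next
      case False
      then show ?thesis using invariant_fieldD(2)[OF Y, of 1 \<tau>]
        by (auto simp: J_def phase_space_def)
    qed
    then show ?thesis by auto
  qed
  have "minimal_component \<sigma> e H J"
    unfolding minimal_component_def J_def
    using \<open>minimal_subsystem (split_topology h) line.extension K\<close> line.split_extension_extension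
    by (auto simp: h_def)
  moreover have "bij_betw H J J"
    unfolding bij_betw_def
  proof
    have HJ: "H (\<tau>, l) = (\<rho> * \<tau>, \<phi> 1 \<tau> l)" if "(\<tau>, l) \<in> J" for \<tau> l
      using that invariant_fieldD(2)[OF Y, of 1 \<tau>] by (intro H) (auto simp: J)
    have \<rho>0: "\<rho> \<noteq> 0" using norm_\<rho> by auto
    show "inj_on H J"
    proof (rule inj_onI)
      fix a b assume ab: "a \<in> J" "b \<in> J" "H a = H b"
      obtain \<tau> l \<tau>' l' where *: "a = (\<tau>, l)" "b = (\<tau>', l')" by (metis surj_pair)
      then have "\<tau> = \<tau>'" "\<phi> 1 \<tau> l = \<phi> 1 \<tau>' l'" using ab HJ \<rho>0 by auto
      then show "a = b" using * ab field_inj[OF Y, of 1 \<tau>] by (auto simp: J dest: inj_onD)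
    qed
    show "H ` J = J"
    proof (intro equalityI subsetI)
      fix b assume "b \<in> H ` J"
      then obtain \<tau> l where *: "(\<tau>, l) \<in> J" "b = (\<rho> * \<tau>, \<phi> 1 \<tau> l)" using HJ by (metis image_iff surj_pair)
      then show "b \<in> J" using invariant_fieldD(3)[OF Y, of 1 \<tau>] by (auto simp: J norm_mult norm_\<rho>)
    next
      fix b assume b: "b \<in> J"
      obtain \<tau> l where *: "b = (\<tau>, l)" by (cases b)
      have \<tau>: "cmod (\<tau> / \<rho>) = 1" "\<rho> * (\<tau> / \<rho>) = \<tau>"
        using b * \<rho>0 norm_\<rho> by (auto simp: J norm_divide)
      then have "l \<in> \<phi> 1 (\<tau> / \<rho>) ` Y 1 (\<tau> / \<rho>)"
        using invariant_fieldD(3)[OF Y, of 1, OF _ \<tau>(1)] b * by (simp add: J)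
      then obtain l' where l': "l' \<in> Y 1 (\<tau> / \<rho>)" "l = \<phi> 1 (\<tau> / \<rho>) l'" by blast
      then have m: "(\<tau> / \<rho>, l') \<in> J" using \<tau> by (simp add: J)
      have "H (\<tau> / \<rho>, l') = b" using HJ[OF m] l' \<tau> * by simp
      then show "b \<in> H ` J" using m by (metis imageI)
    qed
  qed
  moreover have "x m \<in> J" for m
    using in_Y[of m] x1[of m] by (simp add: J case_prod_beta)
  ultimately show ?thesis by blast
qed

end

section \<open>Substituted words and minimal prefixes\<close>

lemma subst_iter_append: "subst_iter \<sigma> n (u @ v) = subst_iter \<sigma> n u @ subst_iter \<sigma> n v"
  by (induction n) (simp_all add: subst_iter_def)

lemma subst_iter_Suc: "subst_iter \<sigma> (Suc n) w = subst_iter \<sigma> n (concat (map \<sigma> w))"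
  unfolding subst_iter_def funpow_Suc_right by simp

lemma word_sum_append: "word_sum \<gamma> (u @ v) = word_sum \<gamma> u + word_sum \<gamma> v"
  by (simp add: word_sum_def)

lemma word_sum_concat: "word_sum \<gamma> (concat ws) = (\<Sum>w\<leftarrow>ws. word_sum \<gamma> w)"
  by (induction ws) (simp_all add: word_sum_append, simp add: word_sum_def)

lemma word_sum_scale: "word_sum (z *s \<Gamma>) w = z * word_sum \<Gamma> w"
  by (induction w) (simp_all add: word_sum_def algebra_simps)

lemma word_sum_subst:
  assumes "subst_matrix \<sigma> *v \<Gamma> = \<beta> *s \<Gamma>"
  shows "word_sum \<Gamma> (concat (map \<sigma> w)) = \<beta> * word_sum \<Gamma> w"
proof -
  have count: "(\<Sum>b\<in>UNIV. of_nat (count_list u b) * \<Gamma> $ b) = word_sum \<Gamma> u" for u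
  proof (induction u)
    case (Cons c u)
    have "(\<Sum>b\<in>UNIV. of_nat (count_list (c # u) b) * \<Gamma> $ b)
        = (\<Sum>b\<in>UNIV. (if c = b then \<Gamma> $ b else 0) + of_nat (count_list u b) * \<Gamma> $ b)"
      by (intro sum.cong) (auto simp: algebra_simps)
    also have "\<dots> = \<Gamma> $ c + word_sum \<Gamma> u"
      using Cons by (simp add: sum.distrib)
    finally show ?case by (simp add: word_sum_def)
  qed (simp add: word_sum_def)
  have letter: "word_sum \<Gamma> (\<sigma> a) = \<beta> * \<Gamma> $ a" for a
    using arg_cong[OF assms, of "\<lambda>v. v $ a"] count[of "\<sigma> a"]
    by (simp add: matrix_vector_mult_def subst_matrix_def)
  show ?thesis
    by (induction w) (simp_all add: word_sum_append letter, simp_all add: word_sum_def algebra_simps)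
qed

text \<open>Expanding \<open>\<sigma> (center_of (d (Suc m)))\<close> into prefix, centre and suffix and iterating on the centre.\<close>

lemma subst_iter_decomposition:
  assumes "\<And>j. j < m \<Longrightarrow> d j \<in> labels_of \<sigma> (center_of (d (Suc j)))"
  shows "subst_iter \<sigma> m [center_of (d m)] =
    concat (map (\<lambda>j. subst_iter \<sigma> j (prefix_of (d j))) (rev [0..<m])) @
    center_of (d 0) # concat (map (\<lambda>j. subst_iter \<sigma> j (suffix_of (d j))) [0..<m])"
  using assms
proof (induction m)
  case (Suc m)
  have "\<sigma> (center_of (d (Suc m))) = prefix_of (d m) @ [center_of (d m)] @ suffix_of (d m)"
    using Suc.prems[of m] by (auto simp: labels_of_def)
  then have "subst_iter \<sigma> (Suc m) [center_of (d (Suc m))] =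
      subst_iter \<sigma> m (prefix_of (d m)) @ subst_iter \<sigma> m [center_of (d m)] @ subst_iter \<sigma> m (suffix_of (d m))"
    by (simp only: subst_iter_Suc list.map concat.simps append_Nil2 subst_iter_append)
  then show ?case using Suc by simp
qed (simp add: subst_iter_def)

lemma left_right_word:
  assumes "\<And>j. j \<le> m \<Longrightarrow> d j \<in> labels_of \<sigma> (center_of (d (Suc j)))"
  shows "left_word \<sigma> d m @ right_word \<sigma> d m = subst_iter \<sigma> (Suc m) [center_of (d (Suc m))]"
  unfolding left_word_def right_word_def
  by (rule subst_iter_decomposition[symmetric]) (use assms in auto)

lemma factor_append: "factor \<omega> i (n + k) = factor \<omega> i n @ factor \<omega> (i + int n) k"
  by (rule nth_equalityI) (auto simp: factor_def nth_append algebra_simps)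

text \<open>The cut of \<open>l @ r\<close> at the origin is compared with another cut of the same word; the difference of the two
  prefix sums is a partial sum of the sequence.\<close>

lemma minimal_sequence_prefix:
  assumes min: "minimal_sequence \<gamma> \<omega>"
    and l: "factor \<omega> (- int (length l)) (length l) = l" and r: "factor \<omega> 0 (length r) = r"
    and uv: "l @ r = u @ v"
  shows "Re (word_sum \<gamma> l) \<le> Re (word_sum \<gamma> u)"
proof -
  have pos: "0 \<le> Re (seq_sum \<gamma> \<omega> n)" for n using min by (simp add: minimal_sequence_def)
  consider w where "u = l @ w" "r = w @ v" | w where "l = u @ w" "v = w @ r"
    using uv by (auto simp: append_eq_append_conv2)
  then show ?thesis
  proof cases
    case 1
    have "r = factor \<omega> 0 (length w) @ factor \<omega> (int (length w)) (length v)"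
      using r 1 factor_append[of \<omega> 0 "length w" "length v"] by simp
    then have "w = factor \<omega> 0 (length w)" using 1
      by (metis append_eq_append_conv length_map length_upt diff_zero factor_def)
    then show ?thesis using pos[of "int (length w)"] 1 by (simp add: seq_sum_def word_sum_append)
  next
    case 2
    define p where "p = length l"
    have p: "p = length u + length w" "- int p + int (length u) = - int (length w)"
      using 2(1) by (simp_all add: p_def)
    have "l = factor \<omega> (- int p) (length u) @ factor \<omega> (- int (length w)) (length w)"
      using l factor_append[of \<omega> "- int p" "length u" "length w"] p p_def by metis
    then have w: "w = factor \<omega> (- int (length w)) (length w)" using 2
      by (metis append_eq_append_conv length_map length_upt diff_zero factor_def)
    show ?thesis
    proof (cases "w = []")
      case False
      then show ?thesis using pos[of "- int (length w)"] w 2 by (simp add: seq_sum_def word_sum_append)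
    qed (use 2 in simp)
  qed
qed

section \<open>Minima of linear functionals on compact plane sets\<close>

lemma min_Re_le:
  assumes "compact F" "z \<in> F"
  shows "min_Re F \<tau> \<le> Re (\<tau> * z)"
proof -
  have "compact ((\<lambda>z. Re (\<tau> * z)) ` F)" using assms(1) by (intro compact_continuous_image continuous_intros)
  then show ?thesis unfolding min_Re_def
    using assms(2) by (intro cINF_lower) (auto intro: bounded_imp_bdd_below compact_imp_bounded)
qed

lemma min_Re_attained:
  assumes "compact F" "F \<noteq> {}"
  shows "\<exists>z\<in>F. Re (\<tau> * z) = min_Re F \<tau>"
proof -
  have "continuous_on F (\<lambda>z. Re (\<tau> * z))" by (intro continuous_intros)
  then obtain z where z: "z \<in> F" "\<And>y. y \<in> F \<Longrightarrow> Re (\<tau> * z) \<le> Re (\<tau> * y)"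
    using continuous_attains_inf[OF assms] by metis
  then have "Re (\<tau> * z) \<le> min_Re F \<tau>" unfolding min_Re_def
    using assms(2) by (intro cINF_greatest) auto
  then show ?thesis using z(1) min_Re_le[OF assms(1) z(1), of \<tau>] by force
qed

lemma min_Re_lipschitz:
  assumes F: "compact F" "F \<noteq> {}" and B: "\<And>z. z \<in> F \<Longrightarrow> cmod z \<le> B"
  shows "min_Re F \<tau>' \<le> min_Re F \<tau> + B * dist \<tau>' \<tau>"
proof -
  obtain z where z: "z \<in> F" "Re (\<tau> * z) = min_Re F \<tau>" using min_Re_attained[OF F] by blast
  have "min_Re F \<tau>' \<le> Re (\<tau>' * z)" by (rule min_Re_le[OF F(1) z(1)])
  also have "\<dots> = Re (\<tau> * z) + Re ((\<tau>' - \<tau>) * z)" by (simp add: algebra_simps)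
  also have "Re ((\<tau>' - \<tau>) * z) \<le> cmod (\<tau>' - \<tau>) * cmod z" by (metis complex_Re_le_cmod norm_mult)
  also have "\<dots> \<le> dist \<tau>' \<tau> * B" unfolding dist_norm by (intro mult_left_mono B z) auto
  finally show ?thesis using z(2) by (simp add: mult.commute)
qed

lemma eventually_sin_ge_half: "\<forall>\<^sub>F \<theta> in at_right (0::real). \<theta> / 2 \<le> sin \<theta>"
proof -
  have "((\<lambda>h. (sin (0 + h) - sin 0) / h) \<longlongrightarrow> cos (0::real)) (at 0)"
    using DERIV_sin[of "0::real"] by (simp add: DERIV_def)
  then have "((\<lambda>h::real. sin h / h) \<longlongrightarrow> 1) (at_right 0)"
    by (simp add: filterlim_at_split)
  from order_tendstoD(1)[OF this, of "1/2"] have "\<forall>\<^sub>F h in at_right (0::real). 1 / 2 < sin h / h" by simp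
  moreover have "\<forall>\<^sub>F h in at_right (0::real). 0 < h" by (simp add: eventually_at_filter)
  ultimately show ?thesis by eventually_elim (simp add: field_simps)
qed

text \<open>Rotating the direction by \<open>s * \<theta>\<close> changes \<open>Re (\<tau> * z)\<close> into
  \<open>Re (\<tau> * z) * cos \<theta> - s * Im (\<tau> * z) * sin \<theta>\<close>. Thus a point that is lexicographically better than all
  points of \<open>F'\<close> wins by an amount linear in \<open>\<theta>\<close>.\<close>

lemma one_sided_gap:
  assumes F: "compact F" "z \<in> F" and F': "compact F'" "F' \<noteq> {}" and s: "s \<in> {1,-1}"
    and lex: "\<And>z'. z' \<in> F' \<Longrightarrow> Re (\<tau> * z) < Re (\<tau> * z') \<or>
       (Re (\<tau> * z) = Re (\<tau> * z') \<and> s * Im (\<tau> * z') < s * Im (\<tau> * z))"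
  shows "\<exists>c>0. \<forall>\<^sub>F \<theta> in at_right 0.
    min_Re F (\<tau> * cis (s * \<theta>)) + c * \<theta> \<le> min_Re F' (\<tau> * cis (s * \<theta>))"
proof -
  define u w where "u = (\<lambda>z. Re (\<tau> * z))" and "w = (\<lambda>z. s * Im (\<tau> * z))"
  have "continuous_on F' (\<lambda>z'. max (u z' - u z) (w z - w z'))"
    unfolding u_def w_def by (intro continuous_intros)
  \<comment> \<open>By compactness every point of \<open>F'\<close> loses to \<open>z\<close> by a fixed amount in one of the two coordinates.\<close>
  from continuous_attains_inf[OF F' this] obtain y where y: "y \<in> F'"
    "\<And>z'. z' \<in> F' \<Longrightarrow> max (u y - u z) (w z - w y) \<le> max (u z' - u z) (w z - w z')" by blast
  define c where "c = max (u y - u z) (w z - w y)"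
  have c: "c > 0" using lex[OF y(1)] by (auto simp: c_def u_def w_def)
  obtain B where B: "\<And>z'. z' \<in> F' \<Longrightarrow> \<bar>w z - w z'\<bar> \<le> B"
  proof -
    have "compact ((\<lambda>z'. w z - w z') ` F')" unfolding w_def
      by (intro compact_continuous_image continuous_intros F')
    then obtain B where "\<forall>x\<in>(\<lambda>z'. w z - w z') ` F'. norm x \<le> B" using compact_imp_bounded bounded_iff by metis
    then show ?thesis using that by auto
  qed
  have "((\<lambda>\<theta>. c * cos \<theta> - B * sin \<theta> - c / 2 * \<theta>) \<longlongrightarrow> c * cos 0 - B * sin 0 - c / 2 * 0) (at_right 0)"
    by (intro tendsto_intros)
  then have ev1: "\<forall>\<^sub>F \<theta> in at_right 0. 0 < c * cos \<theta> - B * sin \<theta> - c / 2 * \<theta>"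
    using c by (intro order_tendstoD(1)[of _ "c * cos 0 - B * sin 0 - c / 2 * 0"]) auto
  have ev2: "\<forall>\<^sub>F \<theta> in at_right (0::real). 0 < \<theta> \<and> \<theta> < pi / 2"
    unfolding eventually_at_right_field by (rule exI[of _ "pi / 2"]) simp
  have Re: "Re (\<tau> * cis (s * \<theta>) * y) = u y * cos \<theta> - w y * sin \<theta>" for y \<theta>
    using s by (auto simp: u_def w_def algebra_simps)
  have "\<forall>\<^sub>F \<theta> in at_right 0.
    min_Re F (\<tau> * cis (s * \<theta>)) + c / 2 * \<theta> \<le> min_Re F' (\<tau> * cis (s * \<theta>))"
    using ev1 ev2 eventually_sin_ge_half
  proof eventually_elim
    case (elim \<theta>)
    have sc: "0 \<le> sin \<theta>" "0 \<le> cos \<theta>" using elim(2) by (auto intro: sin_ge_zero cos_ge_zero)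
    obtain z' where z': "z' \<in> F'" "Re (\<tau> * cis (s * \<theta>) * z') = min_Re F' (\<tau> * cis (s * \<theta>))"
      using min_Re_attained[OF F'] by blast
    have "u z \<le> u z'" using lex[OF z'(1)] by (auto simp: u_def)
    have "c \<le> max (u z' - u z) (w z - w z')" using y(2)[OF z'(1)] by (simp add: c_def)
    then have "c / 2 * \<theta> \<le> (u z' - u z) * cos \<theta> + (w z - w z') * sin \<theta>"
    proof (cases "c \<le> w z - w z'")
      case True
      have "c / 2 * \<theta> \<le> c * sin \<theta>" using mult_left_mono[OF elim(3), of c] c by simp
      also have "\<dots> \<le> (w z - w z') * sin \<theta>" by (rule mult_right_mono[OF True sc(1)])
      also have "\<dots> \<le> (u z' - u z) * cos \<theta> + (w z - w z') * sin \<theta>"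
        using \<open>u z \<le> u z'\<close> sc(2) by simp
      finally show ?thesis .
    next
      case False
      then have "c \<le> u z' - u z" using \<open>c \<le> max (u z' - u z) (w z - w z')\<close> by auto
      from mult_right_mono[OF this sc(2)] have 1: "c * cos \<theta> \<le> (u z' - u z) * cos \<theta>" .
      have "- B \<le> w z - w z'" using B[OF z'(1)] by linarith
      from mult_right_mono[OF this sc(1)] have 2: "- B * sin \<theta> \<le> (w z - w z') * sin \<theta>" .
      show ?thesis using 1 2 elim(1) by linarith
    qed
    moreover have "min_Re F (\<tau> * cis (s * \<theta>)) \<le> u z * cos \<theta> - w z * sin \<theta>"
      unfolding Re[symmetric] by (rule min_Re_le[OF F])
    ultimately show ?case unfolding z'(2)[symmetric] Re by (simp add: algebra_simps)
  qed
  then show ?thesis using c by (intro exI[of _ "c / 2"]) simp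
qed

text \<open>On side \<open>s\<close> of \<open>\<tau>\<close> the winner is the set containing the lexicographically best point of the union:
  first minimal \<open>Re (\<tau> * z)\<close>, then maximal \<open>s * Im (\<tau> * z)\<close>. A second set cannot contain a point that
  is equally good, since the two coordinates determine the point and the minimal faces of distinct
  sets are disjoint by assumption.\<close>

lemma one_sided_unique_minimizer:
  assumes L: "finite L" "L \<noteq> {}" and F: "\<And>l. l \<in> L \<Longrightarrow> compact (F l) \<and> F l \<noteq> {}" and s: "s \<in> {1,-1}"
    and \<tau>: "\<tau> \<noteq> 0"
    and disjoint: "\<And>l l' z. l \<in> L \<Longrightarrow> l' \<in> L \<Longrightarrow> z \<in> F l \<Longrightarrow> z \<in> F l' \<Longrightarrow>
        (\<forall>k\<in>L. \<forall>y\<in>F k. Re (\<tau> * z) \<le> Re (\<tau> * y)) \<Longrightarrow> l = l'"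
  shows "\<exists>k\<in>L. \<exists>c>0. \<forall>\<^sub>F \<theta> in at_right 0. \<forall>l\<in>L - {k}.
    min_Re (F k) (\<tau> * cis (s * \<theta>)) + c * \<theta> \<le> min_Re (F l) (\<tau> * cis (s * \<theta>))"
proof -
  define u w where "u = (\<lambda>z. Re (\<tau> * z))" and "w = (\<lambda>z. s * Im (\<tau> * z))"
  define A where "A = (\<Union>l\<in>L. F l)"
  have A: "compact A" "A \<noteq> {}" using L F by (auto simp: A_def intro!: compact_UN)
  obtain y where y: "y \<in> A" "\<And>z. z \<in> A \<Longrightarrow> u y \<le> u z"
  proof -
    have "continuous_on A u" unfolding u_def by (intro continuous_intros)
    then show ?thesis using continuous_attains_inf[OF A] that by blast
  qed
  define E where "E = A \<inter> {z. u z = u y}"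
  have "closed {z. u z = u y}" unfolding u_def by (intro closed_Collect_eq continuous_intros)
  then have E: "compact E" "E \<noteq> {}" using A y by (auto simp: E_def intro: compact_Int_closed)
  obtain z where z: "z \<in> E" "\<And>z'. z' \<in> E \<Longrightarrow> w z' \<le> w z"
  proof -
    have "continuous_on E w" unfolding w_def by (intro continuous_intros)
    then show ?thesis using continuous_attains_sup[OF E] that by blast
  qed
  obtain k where k: "k \<in> L" "z \<in> F k" using z(1) by (auto simp: E_def A_def)
  have uz: "u z = u y" using z(1) by (simp add: E_def)
  have "\<exists>c>0. \<forall>\<^sub>F \<theta> in at_right 0.
      min_Re (F k) (\<tau> * cis (s * \<theta>)) + c * \<theta> \<le> min_Re (F l) (\<tau> * cis (s * \<theta>))" if l: "l \<in> L - {k}" for l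
  proof (rule one_sided_gap[OF _ k(2) _ _ s])
    fix z' assume z': "z' \<in> F l"
    then have "z' \<in> A" using l by (auto simp: A_def)
    have "s * Im (\<tau> * z') < s * Im (\<tau> * z)" if "u z' = u z"
    proof -
      have "z' \<in> E" using \<open>z' \<in> A\<close> that uz by (simp add: E_def)
      then have "w z' \<le> w z" by (rule z(2))
      moreover have "w z' \<noteq> w z"
      proof
        assume "w z' = w z"
        then have "\<tau> * z' = \<tau> * z" using that s by (auto simp: u_def w_def complex_eq_iff)
        then have "z' = z" using \<tau> by simp
        moreover have "\<forall>k\<in>L. \<forall>y\<in>F k. Re (\<tau> * z) \<le> Re (\<tau> * y)"
          using y(2) uz by (auto simp: u_def A_def)
        ultimately show False using disjoint[of l k z] l k z' by auto
      qed
      ultimately have "w z' < w z" by linarith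
      then show ?thesis by (simp only: w_def)
    qed
    moreover have "u z \<le> u z'" using y(2)[OF \<open>z' \<in> A\<close>] uz by simp
    ultimately show "Re (\<tau> * z) < Re (\<tau> * z') \<or>
        (Re (\<tau> * z) = Re (\<tau> * z') \<and> s * Im (\<tau> * z') < s * Im (\<tau> * z))"
      by (auto simp: u_def)
  qed (use F l k in auto)
  then obtain c where c: "\<And>l. l \<in> L - {k} \<Longrightarrow> c l > 0 \<and> (\<forall>\<^sub>F \<theta> in at_right 0.
      min_Re (F k) (\<tau> * cis (s * \<theta>)) + c l * \<theta> \<le> min_Re (F l) (\<tau> * cis (s * \<theta>)))" by metis
  define m where "m = Min (insert 1 (c ` (L - {k})))"
  have m: "m > 0" "\<And>l. l \<in> L - {k} \<Longrightarrow> m \<le> c l" using c L(1) by (auto simp: m_def)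
  have "\<forall>\<^sub>F \<theta> in at_right 0. \<forall>l\<in>L - {k}.
      min_Re (F k) (\<tau> * cis (s * \<theta>)) + c l * \<theta> \<le> min_Re (F l) (\<tau> * cis (s * \<theta>))"
    using L(1) c by (intro eventually_ball_finite) auto
  moreover have "\<forall>\<^sub>F \<theta> in at_right (0::real). 0 < \<theta>" by (simp add: eventually_at_filter)
  ultimately have "\<forall>\<^sub>F \<theta> in at_right 0. \<forall>l\<in>L - {k}.
      min_Re (F k) (\<tau> * cis (s * \<theta>)) + m * \<theta> \<le> min_Re (F l) (\<tau> * cis (s * \<theta>))"
  proof eventually_elim
    case (elim \<theta>)
    show ?case
    proof
      fix l assume l: "l \<in> L - {k}"
      have "m * \<theta> \<le> c l * \<theta>" using m(2)[OF l] elim(2) by (intro mult_right_mono) auto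
      then show "min_Re (F k) (\<tau> * cis (s * \<theta>)) + m * \<theta> \<le> min_Re (F l) (\<tau> * cis (s * \<theta>))"
        using bspec[OF elim(1) l] by linarith
    qed
  qed
  then show ?thesis using k(1) m(1) by blast
qed

section \<open>Fractals of an expanding substitution\<close>

locale expanding_substitution =
  fixes \<sigma> :: "'a::finite \<Rightarrow> 'a list" and \<beta> :: complex and \<Gamma> :: "complex^'a"
  assumes nonempty: "\<sigma> a \<noteq> []" and expanding: "cmod \<beta> > 1"
    and eigen: "subst_matrix \<sigma> *v \<Gamma> = \<beta> *s \<Gamma>"
begin

lemma \<beta>_nonzero: "\<beta> \<noteq> 0" using expanding by auto

lemma finite_labels_of: "finite (labels_of \<sigma> a)"
proof (rule finite_subset)
  show "labels_of \<sigma> a \<subseteq> (\<lambda>i. (take i (\<sigma> a), \<sigma> a ! i, drop (Suc i) (\<sigma> a))) ` {..<length (\<sigma> a)}"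
  proof
    fix l assume "l \<in> labels_of \<sigma> a"
    then obtain p c s where l: "l = (p, c, s)" "\<sigma> a = p @ c # s" by (auto simp: labels_of_def)
    then show "l \<in> (\<lambda>i. (take i (\<sigma> a), \<sigma> a ! i, drop (Suc i) (\<sigma> a))) ` {..<length (\<sigma> a)}"
      by (intro image_eqI[of _ _ "length p"]) auto
  qed
qed simp

lemma finite_labels: "finite (labels \<sigma>)"
  unfolding labels_def using finite_labels_of by simp

lemma labels_of_nonempty: "labels_of \<sigma> a \<noteq> {}"
proof -
  obtain c s where "\<sigma> a = c # s" using nonempty[of a] by (cases "\<sigma> a") auto
  then have "([], c, s) \<in> labels_of \<sigma> a" by (simp add: labels_of_def)
  then show ?thesis by blast
qed

lemma labels_ofD: "l \<in> labels_of \<sigma> a \<Longrightarrow> l \<in> labels \<sigma>"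
  by (auto simp: labels_def)

lemma paths_labels: assumes "x \<in> paths \<sigma> a" shows "x m \<in> labels \<sigma>"
  using assms by (cases m) (auto simp: paths_def intro: labels_ofD)

definition digit_bound :: real where
  "digit_bound = (\<Sum>l\<in>labels \<sigma>. cmod (word_sum \<Gamma> (prefix_of l)))"

lemma digit_bound: "l \<in> labels \<sigma> \<Longrightarrow> cmod (word_sum \<Gamma> (prefix_of l)) \<le> digit_bound"
  unfolding digit_bound_def by (rule member_le_sum) (auto simp: finite_labels)

lemma digit_bound_nonneg: "0 \<le> digit_bound"
  unfolding digit_bound_def by (rule sum_nonneg) simp

definition path_term :: "(nat \<Rightarrow> 'a label) \<Rightarrow> nat \<Rightarrow> complex" where
  "path_term x m = inverse \<beta> ^ Suc m * word_sum \<Gamma> (prefix_of (x m))"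

lemma path_point_eq: "path_point \<beta> \<Gamma> x = (\<Sum>m. path_term x m)"
  by (simp add: path_point_def path_term_def)

lemma path_term_bound:
  assumes "x m \<in> labels \<sigma>"
  shows "cmod (path_term x m) \<le> digit_bound * inverse (cmod \<beta>) ^ Suc m"
  using mult_right_mono[OF digit_bound[OF assms], of "inverse (cmod \<beta>) ^ Suc m"]
  by (simp add: path_term_def norm_mult norm_power norm_inverse mult_ac)

lemma summable_bound: "summable (\<lambda>m. digit_bound * inverse (cmod \<beta>) ^ Suc m)"
  using expanding by (intro summable_mult summable_Suc_iff[THEN iffD2] summable_geometric)
    (simp add: inverse_less_1_iff)

text \<open>Bounds the modulus of every point of every fractal.\<close>

definition radius :: real where
  "radius = (\<Sum>m. digit_bound * inverse (cmod \<beta>) ^ Suc m)"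

lemma radius_nonneg: "0 \<le> radius"
  unfolding radius_def using digit_bound_nonneg by (intro suminf_nonneg summable_bound) simp

lemma summable_path_term:
  assumes "\<And>m. x m \<in> labels \<sigma>" shows "summable (path_term x)"
  by (rule summable_comparison_test'[OF summable_bound]) (use path_term_bound assms in auto)

lemma path_point_bound:
  assumes "x \<in> paths \<sigma> a" shows "cmod (path_point \<beta> \<Gamma> x) \<le> radius"
  unfolding path_point_eq radius_def
  by (rule norm_suminf_le) (use path_term_bound paths_labels[OF assms] summable_bound in auto)

lemma paths_shift: assumes "x \<in> paths \<sigma> a" shows "\<exists>b. (\<lambda>m. x (m + k)) \<in> paths \<sigma> b"
proof (cases k)
  case 0 then show ?thesis using assms by auto
next
  case (Suc j)
  then have "(\<lambda>m. x (m + k)) \<in> paths \<sigma> (center_of (x j))" using assms by (simp add: paths_def)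
  then show ?thesis by blast
qed

lemma path_point_truncation:
  assumes "x \<in> paths \<sigma> a"
  shows "cmod (path_point \<beta> \<Gamma> x - (\<Sum>m<k. path_term x m)) \<le> radius / cmod \<beta> ^ k"
proof -
  obtain b where b: "(\<lambda>m. x (m + k)) \<in> paths \<sigma> b" using paths_shift[OF assms] by blast
  have "path_point \<beta> \<Gamma> x - (\<Sum>m<k. path_term x m) = (\<Sum>m. path_term x (m + k))"
    unfolding path_point_eq using suminf_minus_initial_segment[OF summable_path_term, of x k]
      paths_labels[OF assms] by simp
  also have "\<dots> = (\<Sum>m. inverse \<beta> ^ k * path_term (\<lambda>m. x (m + k)) m)"
    by (simp add: path_term_def power_add mult_ac)
  also have "\<dots> = inverse \<beta> ^ k * path_point \<beta> \<Gamma> (\<lambda>m. x (m + k))"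
    unfolding path_point_eq by (rule suminf_mult[OF summable_path_term]) (rule paths_labels[OF b])
  finally have "cmod (path_point \<beta> \<Gamma> x - (\<Sum>m<k. path_term x m))
      = cmod (path_point \<beta> \<Gamma> (\<lambda>m. x (m + k))) / cmod \<beta> ^ k"
    by (simp add: norm_mult norm_power norm_inverse power_inverse divide_inverse mult.commute)
  also have "\<dots> \<le> radius / cmod \<beta> ^ k"
    using path_point_bound[OF b] by (intro divide_right_mono) auto
  finally show ?thesis .
qed

lemma paths_nonempty: "paths \<sigma> a \<noteq> {}"
proof -
  obtain x where "x 0 \<in> labels_of \<sigma> a" "\<And>n. x (Suc n) \<in> labels_of \<sigma> (center_of (x n))"
    using dependent_nat_choice[of "\<lambda>n l. n = 0 \<longrightarrow> l \<in> labels_of \<sigma> a" "\<lambda>_ l l'. l' \<in> labels_of \<sigma> (center_of l)"]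
      labels_of_nonempty by (metis ex_in_conv nat.distinct(1))
  then have "x \<in> paths \<sigma> a" by (simp add: paths_def)
  then show ?thesis by blast
qed

lemma paths_splice:
  assumes d: "\<And>j. j \<le> m \<Longrightarrow> d j \<in> labels_of \<sigma> (center_of (d (Suc j)))"
  shows "\<exists>x\<in>paths \<sigma> (center_of (d (Suc m))). \<forall>k\<le>m. x k = d (m - k)"
proof -
  obtain y where y: "y \<in> paths \<sigma> (center_of (d 0))" using paths_nonempty by blast
  define x where "x k = (if k \<le> m then d (m - k) else y (k - Suc m))" for k
  have "x (Suc k) \<in> labels_of \<sigma> (center_of (x k))" for k
  proof -
    consider "Suc k \<le> m" | "k = m" | "k > m" by linarith
    then show ?thesis
    proof cases
      case 1
      then have "m - k = Suc (m - Suc k)" by simp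
      then show ?thesis using 1 d[of "m - Suc k"] by (simp add: x_def)
    next
      case 2 then show ?thesis using y by (simp add: x_def paths_def)
    next
      case 3
      then have "Suc k - Suc m = Suc (k - Suc m)" by simp
      then show ?thesis using 3 y by (simp add: x_def paths_def)
    qed
  qed
  then have "x \<in> paths \<sigma> (center_of (d (Suc m)))" using d[of m] by (simp add: paths_def x_def)
  then show ?thesis by (intro bexI[of _ x]) (auto simp: x_def)
qed

abbreviation "piece a l \<equiv> subfractal \<sigma> \<beta> \<Gamma> a l"
abbreviation "whole a \<equiv> fractal \<sigma> \<beta> \<Gamma> a"

lemma piece_nonempty: assumes "l \<in> labels_of \<sigma> a" shows "piece a l \<noteq> {}"
proof -
  obtain x where "x\<in>paths \<sigma> a" "x 0 = l"
    using paths_splice[of 0 "\<lambda>j. if j = 0 then l else ([], a, [])"] assms by auto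
  then show ?thesis by (auto simp: subfractal_def)
qed

lemma fractal_Union: "whole a = (\<Union>l\<in>labels_of \<sigma> a. piece a l)"
  by (auto simp: fractal_def subfractal_def paths_def)

lemma piece_bound: "z \<in> piece a l \<Longrightarrow> cmod z \<le> radius"
  using path_point_bound by (auto simp: subfractal_def)

text \<open>The digits come from a finite set and the series converges uniformly: extract a subsequence of paths that
  converges coordinatewise and pass to the limit under the sum by Tannery's theorem.\<close>

lemma compact_piece: "compact (piece a l)"
proof (unfold compact_eq_seq_compact_metric, rule seq_compactI)
  fix f :: "nat \<Rightarrow> complex" assume f: "\<forall>n. f n \<in> piece a l"
  have "\<exists>x. x \<in> paths \<sigma> a \<and> x 0 = l \<and> path_point \<beta> \<Gamma> x = f n" for n
  proof -
    from spec[OF f, of n] obtain x where "f n = path_point \<beta> \<Gamma> x" "x \<in> {x \<in> paths \<sigma> a. x 0 = l}"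
      unfolding subfractal_def by (rule imageE)
    then show ?thesis by (intro exI[of _ x]) simp
  qed
  then obtain x where x: "\<And>n. x n \<in> paths \<sigma> a" "\<And>n. x n 0 = l" "\<And>n. path_point \<beta> \<Gamma> (x n) = f n"
    by metis
  \<comment> \<open>a diagonal subsequence along which every coordinate of the paths is eventually constant\<close>
  interpret subseqs "\<lambda>k r. \<exists>v. \<forall>i. x (r i) k = v"
  proof
    fix k and r :: "nat \<Rightarrow> nat" assume "strict_mono r"
    have "finite (range (\<lambda>i. x (r i) k))"
      by (rule finite_subset[OF _ finite_labels]) (use paths_labels x(1) in blast)
    then obtain i0 where "infinite {i\<in>UNIV. x (r i) k = x (r i0) k}"
      using pigeonhole_infinite[of UNIV "\<lambda>i. x (r i) k"] by auto
    then obtain r' :: "nat \<Rightarrow> nat" where r': "strict_mono r'" "\<And>n. r' n \<in> {i\<in>UNIV. x (r i) k = x (r i0) k}"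
      using infinite_enumerate by blast
    then have "\<forall>i. x ((r \<circ> r') i) k = x (r i0) k" by simp
    then show "\<exists>r'::nat \<Rightarrow> nat. strict_mono r' \<and> (\<exists>v. \<forall>i. x ((r \<circ> r') i) k = v)"
      using r'(1) by (intro exI[of _ r'] conjI exI[of _ "x (r i0) k"])
  qed
  have "\<exists>v. \<forall>i. x (diagseq (Suc k + i)) k = v" for k
  proof -
    have "\<exists>v. \<forall>i. x ((diagseq \<circ> (+) (Suc k)) i) k = v" by (rule diagseq_holds) auto
    then show ?thesis by simp
  qed
  then obtain y where y: "\<And>k i. x (diagseq (Suc k + i)) k = y k" by metis
  have ev: "x (diagseq i) k = y k" if "i \<ge> Suc k" for i k
    using y[of k "i - Suc k"] that by simp
  have "y \<in> paths \<sigma> a"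
    unfolding paths_def
  proof (intro CollectI conjI allI)
    show "y 0 \<in> labels_of \<sigma> a" using ev[of 0 1] x(1)[of "diagseq 1"] by (auto simp: paths_def)
    fix k show "y (Suc k) \<in> labels_of \<sigma> (center_of (y k))"
    proof -
      have "x (diagseq (Suc (Suc k))) k = y k" "x (diagseq (Suc (Suc k))) (Suc k) = y (Suc k)"
        by (rule ev, simp)+
      moreover have "x (diagseq (Suc (Suc k))) (Suc k) \<in> labels_of \<sigma> (center_of (x (diagseq (Suc (Suc k))) k))"
        using x(1) unfolding paths_def by blast
      ultimately show ?thesis by (simp only:)
    qed
  qed
  moreover have "y 0 = l" using ev[of 0 1] x(2) by simp
  ultimately have "path_point \<beta> \<Gamma> y \<in> piece a l" by (auto simp: subfractal_def)
  moreover have "(f \<circ> diagseq) \<longlonglongrightarrow> path_point \<beta> \<Gamma> y"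
  proof -
    have "(\<lambda>n. \<Sum>k. path_term (x (diagseq n)) k) \<longlonglongrightarrow> (\<Sum>k. path_term y k)"
    proof (rule tannerys_theorem[THEN conjunct2, THEN conjunct2])
      show "(\<lambda>n. path_term (x (diagseq n)) k) \<longlonglongrightarrow> path_term y k" for k
      proof (rule tendsto_eventually)
        show "\<forall>\<^sub>F n in sequentially. path_term (x (diagseq n)) k = path_term y k"
          unfolding eventually_sequentially path_term_def
          by (intro exI[of _ "Suc k"] allI impI) (simp only: ev)
      qed
      show "\<forall>\<^sub>F (k, n) in sequentially \<times>\<^sub>F sequentially.
          norm (path_term (x (diagseq n)) k) \<le> digit_bound * inverse (cmod \<beta>) ^ Suc k"
        by (rule always_eventually, clarify) (rule path_term_bound[OF paths_labels[OF x(1)]])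
    qed (use summable_bound in auto)
    then show ?thesis by (simp add: o_def x(3)[symmetric] path_point_eq)
  qed
  ultimately show "\<exists>l'\<in>piece a l. \<exists>r. strict_mono r \<and> (f \<circ> r) \<longlonglongrightarrow> l'"
    using subseq_diagseq by blast
qed

lemma compact_fractal: "compact (whole a)" "whole a \<noteq> {}"
proof -
  show "compact (whole a)" unfolding fractal_Union
    by (intro compact_UN finite_labels_of compact_piece)
  show "whole a \<noteq> {}" using paths_nonempty by (simp add: fractal_def)
qed

lemma min_Re_fractal_le:
  assumes "l \<in> labels_of \<sigma> a" shows "min_Re (whole a) \<tau> \<le> min_Re (piece a l) \<tau>"
proof -
  obtain z where z: "z \<in> piece a l" "Re (\<tau> * z) = min_Re (piece a l) \<tau>"
    using min_Re_attained[OF compact_piece piece_nonempty[OF assms]] by blast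
  then have "z \<in> whole a" using assms by (auto simp: fractal_Union)
  then show ?thesis using min_Re_le[OF compact_fractal(1), of z a \<tau>] z(2) by simp
qed

lemma minimizing_label_exists: "\<exists>l. minimizing_label \<sigma> \<beta> \<Gamma> a \<tau> l"
proof -
  obtain z where z: "z \<in> whole a" "Re (\<tau> * z) = min_Re (whole a) \<tau>"
    using min_Re_attained[OF compact_fractal] by blast
  then obtain l where l: "l \<in> labels_of \<sigma> a" "z \<in> piece a l" by (auto simp: fractal_Union)
  then have "min_Re (piece a l) \<tau> \<le> min_Re (whole a) \<tau>" using min_Re_le[OF compact_piece l(2)] z(2) by metis
  then have "minimizing_label \<sigma> \<beta> \<Gamma> a \<tau> l"
    using l min_Re_fractal_le[OF l(1), of \<tau>] by (simp add: minimizing_label_def)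
  then show ?thesis by blast
qed

lemma minimizing_unique_if_gap:
  assumes gap: "\<And>l. l \<in> labels_of \<sigma> a - {k} \<Longrightarrow> min_Re (piece a k) \<tau> + \<eta> \<le> min_Re (piece a l) \<tau>"
    and k: "k \<in> labels_of \<sigma> a" and l: "l \<in> labels_of \<sigma> a"
    and near: "min_Re (piece a l) \<tau> < min_Re (whole a) \<tau> + \<eta>"
  shows "l = k"
proof (rule ccontr)
  assume "l \<noteq> k"
  then have "min_Re (piece a k) \<tau> + \<eta> \<le> min_Re (piece a l) \<tau>" using gap l by blast
  then show False using near min_Re_fractal_le[OF k, of \<tau>] by linarith
qed

lemma unambiguous_gap:
  assumes "cmod \<tau> = 1" "\<tau> \<notin> ambiguous_directions \<sigma> \<beta> \<Gamma>"
  shows "\<exists>k\<in>labels_of \<sigma> a. \<exists>c>0. \<forall>l\<in>labels_of \<sigma> a - {k}. min_Re (piece a k) \<tau> + c \<le> min_Re (piece a l) \<tau>"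
proof -
  obtain k where k: "minimizing_label \<sigma> \<beta> \<Gamma> a \<tau> k" using minimizing_label_exists by blast
  have uniq: "l = k" if "minimizing_label \<sigma> \<beta> \<Gamma> a \<tau> l" for l
  proof (rule ccontr)
    assume "l \<noteq> k"
    moreover have "\<tau> \<in> sphere 0 1" using assms(1) by simp
    ultimately have "\<tau> \<in> ambiguous_directions \<sigma> \<beta> \<Gamma>"
      unfolding ambiguous_directions_def using k that by blast
    then show False using assms(2) by contradiction
  qed
  define c where "c = Min (insert 1 ((\<lambda>l. min_Re (piece a l) \<tau> - min_Re (piece a k) \<tau>) ` (labels_of \<sigma> a - {k})))"
  have kl: "k \<in> labels_of \<sigma> a" "min_Re (whole a) \<tau> = min_Re (piece a k) \<tau>"
    using k by (simp_all add: minimizing_label_def)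
  have "min_Re (piece a k) \<tau> < min_Re (piece a l) \<tau>" if "l \<in> labels_of \<sigma> a - {k}" for l
  proof -
    have "min_Re (whole a) \<tau> \<noteq> min_Re (piece a l) \<tau>"
      using uniq[of l] that by (auto simp: minimizing_label_def)
    moreover have "min_Re (whole a) \<tau> \<le> min_Re (piece a l) \<tau>" using that min_Re_fractal_le by blast
    ultimately show ?thesis using kl(2) by linarith
  qed
  then have "c > 0" using finite_labels_of by (auto simp: c_def)
  have "c \<le> min_Re (piece a l) \<tau> - min_Re (piece a k) \<tau>" if "l \<in> labels_of \<sigma> a - {k}" for l
    unfolding c_def using that finite_labels_of by (intro Min_le) auto
  then have "min_Re (piece a k) \<tau> + c \<le> min_Re (piece a l) \<tau>" if "l \<in> labels_of \<sigma> a - {k}" for l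
    using that by (simp add: le_diff_eq add.commute)
  then show ?thesis using \<open>c > 0\<close> kl(1) by blast
qed

text \<open>The word \<open>\<sigma> ^ (m + 1) a\<close>, where \<open>a\<close> is the centre of \<open>d (m + 1)\<close>, is cut at the origin by the path
  \<open>d m, \<dots>, d 0\<close>, and at other places by the other paths of the same length. Minimality compares the
  truncated sums of these paths; each truncation costs \<open>radius / cmod \<beta> ^ Suc m\<close>.\<close>

lemma minimal_sequence_nearly_minimizes:
  assumes z: "z \<noteq> 0" and min: "minimal_sequence (z *s \<Gamma>) \<omega>"
    and dec: "prefix_suffix_decomposition \<sigma> \<omega> d"
  shows "min_Re (piece (center_of (d (Suc m))) (d m)) (sgn \<beta> ^ Suc m * sgn z)
    \<le> min_Re (whole (center_of (d (Suc m)))) (sgn \<beta> ^ Suc m * sgn z) + 2 * radius / cmod \<beta> ^ Suc m"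
proof -
  define a t where "a = center_of (d (Suc m))" and "t = sgn \<beta> ^ Suc m * sgn z"
  have d: "d j \<in> labels_of \<sigma> (center_of (d (Suc j)))" for j
    using dec by (simp add: prefix_suffix_decomposition_def)
  have t1: "cmod t = 1" using z \<beta>_nonzero by (simp add: t_def norm_mult norm_power norm_sgn)
  have left: "word_sum \<Gamma> (left_word \<sigma> d' m) = \<beta> ^ Suc m * (\<Sum>k<Suc m. path_term x k)"
    if "\<And>k. k \<le> m \<Longrightarrow> x k = d' (m - k)" for x d'
  proof -
    have pw: "word_sum \<Gamma> (subst_iter \<sigma> j w) = \<beta> ^ j * word_sum \<Gamma> w" for j w
      by (induction j) (simp_all add: subst_iter_def word_sum_subst[OF eigen])
    have "word_sum \<Gamma> (left_word \<sigma> d' m) = (\<Sum>j<Suc m. \<beta> ^ j * word_sum \<Gamma> (prefix_of (d' j)))"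
      unfolding left_word_def word_sum_concat map_map
      by (simp add: o_def pw rev_map[symmetric] interv_sum_list_conv_sum_set_nat atLeast0LessThan del: upt_Suc)
    also have "\<dots> = (\<Sum>k<Suc m. \<beta> ^ (m - k) * word_sum \<Gamma> (prefix_of (d' (m - k))))"
      by (subst sum.nat_diff_reindex[symmetric]) simp
    also have "\<dots> = (\<Sum>k<Suc m. \<beta> ^ Suc m * path_term x k)"
    proof (rule sum.cong[OF refl])
      fix k assume "k \<in> {..<Suc m}"
      then have k: "k \<le> m" by simp
      have "\<beta> ^ Suc m = \<beta> ^ (m - k) * \<beta> ^ Suc k" using k by (simp only: power_add[symmetric]) simp
      then have "\<beta> ^ Suc m * inverse \<beta> ^ Suc k = \<beta> ^ (m - k) * (\<beta> ^ Suc k * inverse \<beta> ^ Suc k)"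
        by (simp only: mult.assoc)
      also have "\<beta> ^ Suc k * inverse \<beta> ^ Suc k = 1"
        by (simp only: power_mult_distrib[symmetric] right_inverse[OF \<beta>_nonzero] power_one)
      finally have "\<beta> ^ Suc m * inverse \<beta> ^ Suc k = \<beta> ^ (m - k)" by simp
      then show "\<beta> ^ (m - k) * word_sum \<Gamma> (prefix_of (d' (m - k))) = \<beta> ^ Suc m * path_term x k"
        using that[OF k] by (metis path_term_def mult.assoc)
    qed
    finally show ?thesis by (simp only: sum_distrib_left)
  qed
  obtain x where x: "x \<in> paths \<sigma> a" "\<And>k. k \<le> m \<Longrightarrow> x k = d (m - k)"
    using paths_splice[of m d] d by (auto simp: a_def)
  have "x 0 = d m" using x(2)[of 0] by simp
  then have x_piece: "path_point \<beta> \<Gamma> x \<in> piece a (d m)" using x(1) by (auto simp: subfractal_def)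
  obtain w where w: "w \<in> whole a" "Re (t * w) = min_Re (whole a) t"
    using min_Re_attained[OF compact_fractal] by blast
  obtain y where y: "y \<in> paths \<sigma> a" "w = path_point \<beta> \<Gamma> y" using w(1) by (auto simp: fractal_def)
  \<comment> \<open>the first \<open>m + 1\<close> labels of \<open>y\<close> in the order of a prefix-suffix decomposition\<close>
  define d' where "d' j = (if j \<le> m then y (m - j) else ([], a, []))" for j
  have d': "d' j \<in> labels_of \<sigma> (center_of (d' (Suc j)))" if "j \<le> m" for j
  proof (cases "j = m")
    case False
    then have "m - j = Suc (m - Suc j)" "Suc j \<le> m" using that by auto
    then show ?thesis using y(1) that by (simp add: d'_def paths_def)
  qed (use y(1) in \<open>simp add: d'_def paths_def\<close>)
  have "left_word \<sigma> d m @ right_word \<sigma> d m = left_word \<sigma> d' m @ right_word \<sigma> d' m"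
    using left_right_word[of m d \<sigma>] left_right_word[of m d' \<sigma>] d d' by (simp add: d'_def a_def)
  then have "Re (word_sum (z *s \<Gamma>) (left_word \<sigma> d m)) \<le> Re (word_sum (z *s \<Gamma>) (left_word \<sigma> d' m))"
    using minimal_sequence_prefix[OF min] dec by (metis prefix_suffix_decomposition_def)
  moreover have "word_sum \<Gamma> (left_word \<sigma> d m) = \<beta> ^ Suc m * (\<Sum>k<Suc m. path_term x k)"
    by (rule left) (rule x(2))
  moreover have "word_sum \<Gamma> (left_word \<sigma> d' m) = \<beta> ^ Suc m * (\<Sum>k<Suc m. path_term y k)"
    by (rule left) (simp add: d'_def)
  ultimately have le: "Re (z * \<beta> ^ Suc m * (\<Sum>k<Suc m. path_term x k)) \<le> Re (z * \<beta> ^ Suc m * (\<Sum>k<Suc m. path_term y k))"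
    unfolding word_sum_scale by (simp only: mult.assoc)
  have zt: "z * \<beta> ^ Suc m = of_real (cmod z * cmod \<beta> ^ Suc m) * t"
  proof -
    have "z = of_real (cmod z) * sgn z" "\<beta> = of_real (cmod \<beta>) * sgn \<beta>"
      using z \<beta>_nonzero by (simp_all add: sgn_eq)
    then have "z * \<beta> ^ Suc m = (of_real (cmod z) * sgn z) * (of_real (cmod \<beta>) * sgn \<beta>) ^ Suc m" by metis
    then show ?thesis unfolding power_mult_distrib t_def by (simp add: mult_ac)
  qed
  have "cmod z * cmod \<beta> ^ Suc m > 0" using z \<beta>_nonzero by simp
  moreover have "Re (of_real r * t * u) = r * Re (t * u)" for r u by (simp add: mult.assoc)
  ultimately have le': "Re (t * (\<Sum>k<Suc m. path_term x k)) \<le> Re (t * (\<Sum>k<Suc m. path_term y k))"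
    using le unfolding zt by (metis mult_le_cancel_left_pos)
  have tr: "\<bar>Re (t * path_point \<beta> \<Gamma> u) - Re (t * (\<Sum>k<Suc m. path_term u k))\<bar> \<le> radius / cmod \<beta> ^ Suc m"
    if "u \<in> paths \<sigma> a" for u
  proof -
    have "\<bar>Re (t * path_point \<beta> \<Gamma> u) - Re (t * (\<Sum>k<Suc m. path_term u k))\<bar>
        = \<bar>Re (t * (path_point \<beta> \<Gamma> u - (\<Sum>k<Suc m. path_term u k)))\<bar>"
      by (simp only: right_diff_distrib minus_complex.simps)
    also have "\<dots> \<le> cmod (t * (path_point \<beta> \<Gamma> u - (\<Sum>k<Suc m. path_term u k)))" by (rule abs_Re_le_cmod)
    also have "\<dots> = cmod (path_point \<beta> \<Gamma> u - (\<Sum>k<Suc m. path_term u k))" by (simp only: norm_mult t1 mult_1)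
    also have "\<dots> \<le> radius / cmod \<beta> ^ Suc m" by (rule path_point_truncation[OF that])
    finally show ?thesis .
  qed
  have "min_Re (piece a (d m)) t \<le> Re (t * path_point \<beta> \<Gamma> x)" by (rule min_Re_le[OF compact_piece x_piece])
  also have "\<dots> \<le> min_Re (whole a) t + 2 * radius / cmod \<beta> ^ Suc m"
    using tr[OF x(1)] tr[OF y(1)] le' w(2) y(2) by (simp add: abs_le_iff)
  finally show ?thesis by (simp only: a_def t_def)
qed

end

section \<open>Labels forced by a good direction\<close>

lemma arc_dist_cis:
  assumes "cmod \<tau> = 1" "s \<in> {1,-1}" "0 < \<theta>" "\<theta> < pi"
  shows "arc_dist \<tau> (\<tau> * cis (s * \<theta>)) = \<theta>"
proof -
  have "\<tau> \<noteq> 0" using assms(1) by auto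
  then have "\<tau> / (\<tau> * cis (s * \<theta>)) = cis (- (s * \<theta>))" by (simp add: field_simps cis_mult)
  moreover have "Arg (cis (- (s * \<theta>))) = - (s * \<theta>)" using assms by (intro Arg_cis) auto
  ultimately show ?thesis using assms by (auto simp: arc_dist_def)
qed

locale uniquely_representing = expanding_substitution +
  assumes urp: "unique_representation \<sigma> \<beta> \<Gamma>"
begin

text \<open>A common minimal point of two pieces would be an extreme point of the fractal with two representations.\<close>

lemma one_sided_minimizing_label:
  assumes \<tau>: "cmod \<tau> = 1" and s: "s \<in> {1,-1}"
  shows "\<exists>k\<in>labels_of \<sigma> a. \<exists>c>0. \<forall>\<^sub>F \<theta> in at_right 0. \<forall>l\<in>labels_of \<sigma> a - {k}.
    min_Re (piece a k) (\<tau> * cis (s * \<theta>)) + c * \<theta> \<le> min_Re (piece a l) (\<tau> * cis (s * \<theta>))"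
proof (rule one_sided_unique_minimizer[OF finite_labels_of labels_of_nonempty _ s])
  show "compact (piece a l) \<and> piece a l \<noteq> {}" if "l \<in> labels_of \<sigma> a" for l
    using that compact_piece piece_nonempty by blast
  show "\<tau> \<noteq> 0" using \<tau> by auto
  fix l l' z
  assume l: "l \<in> labels_of \<sigma> a" "l' \<in> labels_of \<sigma> a" and z: "z \<in> piece a l" "z \<in> piece a l'"
    and min: "\<forall>k\<in>labels_of \<sigma> a. \<forall>y\<in>piece a k. Re (\<tau> * z) \<le> Re (\<tau> * y)"
  obtain x where x: "x \<in> paths \<sigma> a" "x 0 = l" "path_point \<beta> \<Gamma> x = z"
    using z(1) unfolding subfractal_def by blast
  obtain x' where x': "x' \<in> paths \<sigma> a" "x' 0 = l'" "path_point \<beta> \<Gamma> x' = z"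
    using z(2) unfolding subfractal_def by blast
  have zF: "z \<in> whole a" using x by (auto simp: fractal_def)
  obtain w where w: "w \<in> whole a" "Re (\<tau> * w) = min_Re (whole a) \<tau>"
    using min_Re_attained[OF compact_fractal] by blast
  then have "Re (\<tau> * z) \<le> Re (\<tau> * w)" using min unfolding fractal_Union by blast
  then have "Re (\<tau> * z) = min_Re (whole a) \<tau>"
    using min_Re_le[OF compact_fractal(1) zF, of \<tau>] w(2) by linarith
  then have ext: "extreme_for (whole a) \<tau> z" using zF unfolding extreme_for_def by blast
  have "\<tau> \<in> sphere 0 1" using \<tau> by simp
  then have "\<exists>!x. x \<in> paths \<sigma> a \<and> path_point \<beta> \<Gamma> x = z"
    using urp ext unfolding unique_representation_def by blast
  then have "x = x'" using x x' by blast
  then show "l = l'" using x x' by simp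
qed

lemma minimizing_label_one_sided:
  assumes \<tau>: "cmod \<tau> = 1" and s: "s \<in> {1,-1}"
  shows "\<exists>k\<in>labels_of \<sigma> a. \<forall>\<^sub>F t in side s \<tau>. \<forall>l. minimizing_label \<sigma> \<beta> \<Gamma> a t l \<longrightarrow> l = k"
proof -
  obtain k c where k: "k \<in> labels_of \<sigma> a" "c > 0"
    "\<forall>\<^sub>F \<theta> in at_right 0. \<forall>l\<in>labels_of \<sigma> a - {k}.
      min_Re (piece a k) (\<tau> * cis (s * \<theta>)) + c * \<theta> \<le> min_Re (piece a l) (\<tau> * cis (s * \<theta>))"
    using one_sided_minimizing_label[OF assms] by blast
  have "\<forall>\<^sub>F \<theta> in at_right (0::real). 0 < \<theta>" by (simp add: eventually_at_filter)
  with k(3) have "\<forall>\<^sub>F \<theta> in at_right 0. \<forall>l. minimizing_label \<sigma> \<beta> \<Gamma> a (\<tau> * cis (s * \<theta>)) l \<longrightarrow> l = k"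
  proof eventually_elim
    case (elim \<theta>)
    have "0 < c * \<theta>" using k(2) elim by simp
    then show ?case
      using minimizing_unique_if_gap[of a k "\<tau> * cis (s * \<theta>)" "c * \<theta>"] elim(1) k(1)
      unfolding minimizing_label_def by auto
  qed
  then show ?thesis unfolding side_def eventually_filtermap using k(1) by blast
qed

text \<open>Near an unambiguous direction the best label wins by a constant. Near an ambiguous direction \<open>\<xi>\<close>
  it wins by a multiple of the distance to \<open>\<xi>\<close>, which for \<open>t n\<close> is eventually larger than any multiple of
  \<open>A ^ (-n)\<close>, and hence than the allowed error since \<open>A < cmod \<beta>\<close>.\<close>

lemma nearly_minimizing_label_forced:
  assumes A: "1 < A" "A < cmod \<beta>" and C: "0 \<le> C" and t: "\<And>n. cmod (t n) = 1"
    and good: "\<And>\<xi>. \<xi> \<in> ambiguous_directions \<sigma> \<beta> \<Gamma> \<Longrightarrow>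
        liminf (\<lambda>n. ereal (A ^ n * arc_dist \<xi> (t n))) = \<infinity>"
    and k: "\<And>n. k n \<in> labels_of \<sigma> (a n)"
    and near: "\<And>n. min_Re (piece (a n) (k n)) (t n) \<le> min_Re (whole (a n)) (t n) + C / cmod \<beta> ^ n"
  shows "\<forall>\<^sub>F n in sequentially. \<forall>l. minimizing_label \<sigma> \<beta> \<Gamma> (a n) (t n) l \<longrightarrow> l = k n"
proof -
  define forced where "forced n \<longleftrightarrow> (\<forall>l. minimizing_label \<sigma> \<beta> \<Gamma> (a n) (t n) l \<longrightarrow> l = k n)" for n
  have forcedI: "forced n"
    if "j \<in> labels_of \<sigma> (a n)" "\<And>l. l \<in> labels_of \<sigma> (a n) - {j} \<Longrightarrow>
        min_Re (piece (a n) j) (t n) + \<eta> \<le> min_Re (piece (a n) l) (t n)"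
      "C / cmod \<beta> ^ n < \<eta>" for n j \<eta>
  proof -
    have "0 \<le> C / cmod \<beta> ^ n" using C by simp
    then have "0 < \<eta>" using that(3) by linarith
    note * = minimizing_unique_if_gap[of "a n" j "t n" \<eta>, OF that(2,1)]
    have "k n = j" using *[of "k n"] k near[of n] that(3) by force
    moreover have "l = j" if "minimizing_label \<sigma> \<beta> \<Gamma> (a n) (t n) l" for l
      using *[of l] that \<open>0 < \<eta>\<close> unfolding minimizing_label_def by force
    ultimately show ?thesis by (simp add: forced_def)
  qed
  have "\<forall>\<^sub>F n in sequentially. t n \<in> sphere 0 1 \<longrightarrow> forced n"
  proof (rule circle_compactness[of "\<lambda>A. \<forall>\<^sub>F n in sequentially. t n \<in> A \<longrightarrow> forced n"])
    fix \<tau> :: complex assume \<tau>: "cmod \<tau> = 1"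
    show "\<exists>U. (\<forall>\<^sub>F n in sequentially. t n \<in> U \<longrightarrow> forced n) \<and> \<tau> \<in> U \<and>
        (\<forall>s\<in>{1,-1}. \<forall>\<^sub>F t in side s \<tau>. t \<in> U)"
    proof (cases "\<tau> \<in> ambiguous_directions \<sigma> \<beta> \<Gamma>")
      case False
      have "\<exists>j c. j \<in> labels_of \<sigma> b \<and> c > 0 \<and>
          (\<forall>l\<in>labels_of \<sigma> b - {j}. min_Re (piece b j) \<tau> + c \<le> min_Re (piece b l) \<tau>)" for b
        using unambiguous_gap[OF \<tau> False] by blast
      then obtain j c where jc: "\<And>b. j b \<in> labels_of \<sigma> b" "\<And>b. c b > 0"
        "\<And>b l. l \<in> labels_of \<sigma> b - {j b} \<Longrightarrow> min_Re (piece b (j b)) \<tau> + c b \<le> min_Re (piece b l) \<tau>"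
        by metis
      define c0 where "c0 = Min (range c)"
      have c0: "c0 > 0" "\<And>b. c0 \<le> c b" using jc(2) by (auto simp: c0_def)
      \<comment> \<open>Moving the direction by \<open>\<delta>\<close> changes each minimum by at most a quarter of the gap at \<open>\<tau>\<close>.\<close>
      define \<delta> where "\<delta> = c0 / 4 / (radius + 1)"
      have \<delta>: "\<delta> > 0" using c0 radius_nonneg by (simp add: \<delta>_def)
      have "radius * \<delta> \<le> c0 / 4"
      proof -
        have "radius + 1 \<noteq> 0" using radius_nonneg by simp
        then have "(radius + 1) * \<delta> = c0 / 4"
          by (metis \<delta>_def mult.commute nonzero_eq_divide_eq)
        moreover have "radius * \<delta> \<le> (radius + 1) * \<delta>" using \<delta> by (intro mult_right_mono) auto
        ultimately show ?thesis by linarith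
      qed
      have "(\<lambda>n. C * inverse (cmod \<beta>) ^ n) \<longlonglongrightarrow> C * 0"
        using expanding by (intro tendsto_mult tendsto_const LIMSEQ_realpow_zero) (auto simp: inverse_less_1_iff)
      then have "\<forall>\<^sub>F n in sequentially. C * inverse (cmod \<beta>) ^ n < c0 / 2"
        using c0 by (intro order_tendstoD(2)[of _ "C * 0"]) auto
      then have "\<forall>\<^sub>F n in sequentially. t n \<in> ball \<tau> \<delta> \<longrightarrow> forced n"
      proof eventually_elim
        case (elim n)
        show ?case
        proof
          assume "t n \<in> ball \<tau> \<delta>"
          then have d: "dist \<tau> (t n) < \<delta>" by simp
          have lip: "radius * dist \<tau> (t n) \<le> c0 / 4"
            using \<open>radius * \<delta> \<le> c0 / 4\<close> mult_left_mono[OF less_imp_le[OF d] radius_nonneg] by linarith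
          show "forced n"
          proof (rule forcedI[of "j (a n)" n "c0 / 2"])
            show "j (a n) \<in> labels_of \<sigma> (a n)" by (rule jc)
            fix l assume l: "l \<in> labels_of \<sigma> (a n) - {j (a n)}"
            have "min_Re (piece (a n) (j (a n))) (t n) \<le> min_Re (piece (a n) (j (a n))) \<tau> + radius * dist (t n) \<tau>"
              by (rule min_Re_lipschitz[OF compact_piece piece_nonempty[OF jc(1)] piece_bound])
            moreover have "min_Re (piece (a n) l) \<tau> \<le> min_Re (piece (a n) l) (t n) + radius * dist \<tau> (t n)"
              using l by (intro min_Re_lipschitz[OF compact_piece piece_nonempty piece_bound]) auto
            moreover have "min_Re (piece (a n) (j (a n))) \<tau> + c0 \<le> min_Re (piece (a n) l) \<tau>"
              using jc(3)[OF l] c0(2)[of "a n"] by linarith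
            ultimately show "min_Re (piece (a n) (j (a n))) (t n) + c0 / 2 \<le> min_Re (piece (a n) l) (t n)"
              using lip unfolding dist_commute[of "t n" \<tau>] by linarith
          next
            show "C / cmod \<beta> ^ n < c0 / 2"
              using elim by (simp only: divide_inverse power_inverse)
          qed
        qed
      qed
      moreover have "\<forall>\<^sub>F x in side s \<tau>. x \<in> ball \<tau> \<delta>" for s
      proof -
        have "((\<lambda>\<theta>. \<tau> * cis (s * \<theta>)) \<longlongrightarrow> \<tau> * cis (s * 0)) (at_right 0)"
          unfolding cis_conv_exp by (intro tendsto_intros)
        then have "\<forall>\<^sub>F \<theta> in at_right 0. dist (\<tau> * cis (s * \<theta>)) (\<tau> * cis (s * 0)) < \<delta>"
          using \<delta> by (rule tendstoD)
        then show ?thesis unfolding side_def eventually_filtermap by (simp add: dist_commute)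
      qed
      ultimately show ?thesis using \<delta> by (intro exI[of _ "ball \<tau> \<delta>"]) auto
    next
      case True
      define gap where "gap s b j c \<longleftrightarrow> j \<in> labels_of \<sigma> b \<and> c > 0 \<and>
          (\<forall>\<^sub>F \<theta> in at_right 0. \<forall>l\<in>labels_of \<sigma> b - {j}.
          min_Re (piece b j) (\<tau> * cis (s * \<theta>)) + c * \<theta> \<le> min_Re (piece b l) (\<tau> * cis (s * \<theta>)))"
        for s b j c
      have "\<exists>j c. gap s b j c" if "s \<in> {1,-1}" for s b
        using one_sided_minimizing_label[OF \<tau> that, of b] unfolding gap_def by blast
      then obtain j c where "\<And>s b. s \<in> {1,-1} \<Longrightarrow> gap s b (j s b) (c s b)" by metis
      then have jc: "\<And>s b. s \<in> {1,-1} \<Longrightarrow> j s b \<in> labels_of \<sigma> b"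
        "\<And>s b. s \<in> {1,-1} \<Longrightarrow> c s b > 0"
        "\<And>s b. s \<in> {1,-1} \<Longrightarrow> (\<forall>\<^sub>F \<theta> in at_right 0. \<forall>l\<in>labels_of \<sigma> b - {j s b}.
          min_Re (piece b (j s b)) (\<tau> * cis (s * \<theta>)) + c s b * \<theta> \<le> min_Re (piece b l) (\<tau> * cis (s * \<theta>)))"
        unfolding gap_def by blast+
      define c0 where "c0 = Min ((\<lambda>(s, b). c s b) ` ({1,-1} \<times> UNIV))"
      have c0_pos: "c0 > 0" using jc(2) by (auto simp: c0_def)
      have c0_le: "c0 \<le> c s b" if "s \<in> {1,-1}" for s b
        unfolding c0_def by (rule Min_le) (use that in auto)
      have "\<forall>\<^sub>F \<theta> in at_right 0. \<forall>s\<in>{1,-1}. \<forall>b. \<forall>l\<in>labels_of \<sigma> b - {j s b}.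
          min_Re (piece b (j s b)) (\<tau> * cis (s * \<theta>)) + c s b * \<theta> \<le> min_Re (piece b l) (\<tau> * cis (s * \<theta>))"
      proof (rule eventually_ball_finite, simp, rule ballI)
        fix s :: real assume "s \<in> {1,-1}"
        then show "\<forall>\<^sub>F \<theta> in at_right 0. \<forall>b. \<forall>l\<in>labels_of \<sigma> b - {j s b}.
            min_Re (piece b (j s b)) (\<tau> * cis (s * \<theta>)) + c s b * \<theta> \<le> min_Re (piece b l) (\<tau> * cis (s * \<theta>))"
          by (intro eventually_all_finite jc(3))
      qed
      moreover have "\<forall>\<^sub>F \<theta> in at_right (0::real). \<theta> < pi"
        unfolding eventually_at_right_field by (rule exI[of _ pi]) simp
      ultimately have "\<forall>\<^sub>F \<theta> in at_right 0. \<theta> < pi \<and> (\<forall>s\<in>{1,-1}. \<forall>b. \<forall>l\<in>labels_of \<sigma> b - {j s b}.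
          min_Re (piece b (j s b)) (\<tau> * cis (s * \<theta>)) + c s b * \<theta> \<le> min_Re (piece b l) (\<tau> * cis (s * \<theta>)))"
        by eventually_elim blast
      then obtain \<epsilon> where \<epsilon>: "\<epsilon> > 0" "\<And>\<theta>. 0 < \<theta> \<Longrightarrow> \<theta> < \<epsilon> \<Longrightarrow> \<theta> < pi \<and>
          (\<forall>s\<in>{1,-1}. \<forall>b. \<forall>l\<in>labels_of \<sigma> b - {j s b}.
          min_Re (piece b (j s b)) (\<tau> * cis (s * \<theta>)) + c s b * \<theta> \<le> min_Re (piece b l) (\<tau> * cis (s * \<theta>)))"
        unfolding eventually_at_right_field by auto
      define U where "U = insert \<tau> {\<tau> * cis (s * \<theta>) |s \<theta>. s \<in> {1,-1} \<and> 0 < \<theta> \<and> \<theta> < \<epsilon>}"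
      have "\<forall>\<^sub>F n in sequentially. ereal (C / c0) < ereal (A ^ n * arc_dist \<tau> (t n))"
        by (rule less_LiminfD) (simp add: good[OF True])
      then have "\<forall>\<^sub>F n in sequentially. t n \<in> U \<longrightarrow> forced n"
      proof eventually_elim
        case (elim n)
        show ?case
        proof
          assume "t n \<in> U"
          have far: "C / c0 < A ^ n * arc_dist \<tau> (t n)" using elim by simp
          have "t n \<noteq> \<tau>"
          proof
            assume "t n = \<tau>"
            moreover have "\<tau> \<noteq> 0" using \<tau> by auto
            ultimately have "arc_dist \<tau> (t n) = 0" by (simp add: arc_dist_def)
            moreover have "0 \<le> C / c0" using C c0_pos by simp
            ultimately show False using far by simp
          qed
          then obtain s \<theta> where s: "s \<in> {1,-1}" "0 < \<theta>" "\<theta> < \<epsilon>" "t n = \<tau> * cis (s * \<theta>)"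
            using \<open>t n \<in> U\<close> unfolding U_def by blast
          have "arc_dist \<tau> (t n) = \<theta>"
            unfolding s(4) using \<epsilon>(2)[OF s(2,3)] by (intro arc_dist_cis[OF \<tau> s(1,2)]) blast
          then have "C / c0 < A ^ n * \<theta>" using far by simp
          also have "\<dots> \<le> cmod \<beta> ^ n * \<theta>" using A s(2) by (intro mult_right_mono power_mono) auto
          finally have "C < c0 * \<theta> * cmod \<beta> ^ n"
            using c0_pos by (simp add: pos_divide_less_eq mult_ac)
          moreover have "cmod \<beta> ^ n > 0" using \<beta>_nonzero by simp
          ultimately have "C / cmod \<beta> ^ n < c0 * \<theta>" by (simp only: pos_divide_less_eq)
          then have "C / cmod \<beta> ^ n < c s (a n) * \<theta>"
            using mult_right_mono[OF c0_le[OF s(1), of "a n"], of \<theta>] s(2) by linarith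
          then show "forced n"
            using \<epsilon>(2)[OF s(2,3)] s(1) jc(1) unfolding s(4)[symmetric]
            by (intro forcedI[of "j s (a n)" n "c s (a n) * \<theta>"]) (auto simp: s(4))
        qed
      qed
      moreover have "\<forall>\<^sub>F x in side s \<tau>. x \<in> U" if "s \<in> {1,-1}" for s
        unfolding eventually_side U_def using \<epsilon>(1) that by blast
      moreover have "\<tau> \<in> U" by (simp add: U_def)
      ultimately show ?thesis by blast
    qed
  next
    fix A B
    assume "\<forall>\<^sub>F n in sequentially. t n \<in> A \<longrightarrow> forced n" "\<forall>\<^sub>F n in sequentially. t n \<in> B \<longrightarrow> forced n"
    then show "\<forall>\<^sub>F n in sequentially. t n \<in> A \<union> B \<longrightarrow> forced n" by eventually_elim blast
  next
    fix A B :: "complex set"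
    assume "\<forall>\<^sub>F n in sequentially. t n \<in> B \<longrightarrow> forced n" "A \<subseteq> B"
    then show "\<forall>\<^sub>F n in sequentially. t n \<in> A \<longrightarrow> forced n" by (auto elim: eventually_mono)
  qed simp
  then show ?thesis using t by (simp add: forced_def)
qed

text \<open>On the right this recovers \<open>H\<close> by right-continuity; on the left it is the label component of the
  left-continuous version of \<open>H\<close>.\<close>

definition limit_label :: "(complex \<times> 'a label \<Rightarrow> complex \<times> 'a label) \<Rightarrow> real \<Rightarrow> complex \<Rightarrow> 'a label \<Rightarrow> 'a label" where
  "limit_label H s \<tau> l = (THE k. \<forall>\<^sub>F t in side s \<tau>. snd (H (t, l)) = k)"

lemma limit_label_eqI:
  assumes "\<forall>\<^sub>F t in side s \<tau>. snd (H (t, l)) = k"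
  shows "limit_label H s \<tau> l = k"
  unfolding limit_label_def
proof (rule the_equality)
  fix k' assume "\<forall>\<^sub>F t in side s \<tau>. snd (H (t, l)) = k'"
  with assms have "\<forall>\<^sub>F t in side s \<tau>. k' = k" by eventually_elim simp
  then show "k' = k" by simp
qed (rule assms)

lemma minimizing_mapD:
  assumes "minimizing_map \<sigma> \<beta> \<Gamma> H" "cmod \<tau> = 1" "l \<in> labels \<sigma>"
  shows "fst (H (\<tau>, l)) = inverse (sgn \<beta>) * \<tau>"
    "minimizing_label \<sigma> \<beta> \<Gamma> (center_of l) \<tau> (snd (H (\<tau>, l)))"
    "\<forall>\<^sub>F t in side 1 \<tau>. snd (H (t, l)) = snd (H (\<tau>, l))"
proof -
  have "(\<tau>, l) \<in> phase_space \<sigma>" using assms by (simp add: phase_space_def)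
  from bspec[OF assms(1)[unfolded minimizing_map_def] this]
  show "fst (H (\<tau>, l)) = inverse (sgn \<beta>) * \<tau>"
    "minimizing_label \<sigma> \<beta> \<Gamma> (center_of l) \<tau> (snd (H (\<tau>, l)))"
    "\<forall>\<^sub>F t in side 1 \<tau>. snd (H (t, l)) = snd (H (\<tau>, l))"
    by (simp_all add: side_def eventually_filtermap)
qed

lemma limit_label:
  assumes H: "minimizing_map \<sigma> \<beta> \<Gamma> H" and \<tau>: "cmod \<tau> = 1" and l: "l \<in> labels \<sigma>" and s: "s \<in> {1,-1}"
  shows "\<forall>\<^sub>F t in side s \<tau>. snd (H (t, l)) = limit_label H s \<tau> l" "limit_label H s \<tau> l \<in> labels \<sigma>"
proof -
  obtain k where k: "k \<in> labels_of \<sigma> (center_of l)"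
    "\<forall>\<^sub>F t in side s \<tau>. \<forall>l'. minimizing_label \<sigma> \<beta> \<Gamma> (center_of l) t l' \<longrightarrow> l' = k"
    using minimizing_label_one_sided[OF \<tau> s] by blast
  have *: "\<forall>\<^sub>F t in side s \<tau>. snd (H (t, l)) = k"
    using k(2) eventually_side_unit[OF \<tau>]
    by eventually_elim (use minimizing_mapD(2)[OF H _ l] in blast)
  then show "\<forall>\<^sub>F t in side s \<tau>. snd (H (t, l)) = limit_label H s \<tau> l"
    "limit_label H s \<tau> l \<in> labels \<sigma>"
    using limit_label_eqI[OF *] k(1) by (auto intro: labels_ofD)
qed

lemma circle_label_system:
  assumes H: "minimizing_map \<sigma> \<beta> \<Gamma> H" and e: "bij_betw e (labels \<sigma>) {..<card (labels \<sigma>)}"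
    and irr: "\<forall>n>0. sgn \<beta> ^ n \<noteq> 1"
  shows "circle_label_system \<sigma> (inverse (sgn \<beta>)) (limit_label H) e H"
proof
  show "finite (labels \<sigma>)" by (rule finite_labels)
  show "cmod (inverse (sgn \<beta>)) = 1" using \<beta>_nonzero by (simp add: norm_inverse norm_sgn)
  show "\<forall>n>0. inverse (sgn \<beta>) ^ n \<noteq> 1" using irr by (simp add: power_inverse)
  show "labels \<sigma> \<noteq> {}" using labels_of_nonempty by (auto simp: labels_def)
  show "bij_betw e (labels \<sigma>) {..<card (labels \<sigma>)}" by (rule e)
next
  fix \<tau> :: complex and l assume \<tau>: "cmod \<tau> = 1" and l: "l \<in> labels \<sigma>"
  show "H (\<tau>, l) = (inverse (sgn \<beta>) * \<tau>, limit_label H 1 \<tau> l)"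
    using minimizing_mapD(1)[OF H \<tau> l] limit_label_eqI[OF minimizing_mapD(3)[OF H \<tau> l]]
    by (metis prod.collapse)
  fix s :: real assume s: "s \<in> {1,-1}"
  show "limit_label H s \<tau> l \<in> labels \<sigma>" by (rule limit_label[OF H \<tau> l s])
  show "\<forall>\<^sub>F t in side s \<tau>. \<forall>r\<in>{1,-1}. limit_label H r t l = limit_label H s \<tau> l"
    using eventually_side_side[OF limit_label(1)[OF H \<tau> l s] s]
    by eventually_elim (use limit_label_eqI in blast)
qed

end

section \<open>Minimal sequences and minimal components\<close>

lemma primitive_nonempty:
  assumes "primitive_subst \<sigma>" shows "\<sigma> a \<noteq> []"
proof
  assume "\<sigma> a = []"
  obtain n where n: "n > 0" "\<And>a b. b \<in> set (subst_iter \<sigma> n [a])"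
    using assms by (auto simp: primitive_subst_def)
  obtain m where "n = Suc m" using n(1) by (cases n) auto
  moreover have "subst_iter \<sigma> k [] = []" for k by (induction k) (simp_all add: subst_iter_def)
  ultimately show False using n(2)[of a a] \<open>\<sigma> a = []\<close> by (simp add: subst_iter_Suc)
qed

theorem theorem3p3:
  fixes T :: "real \<Rightarrow> real" and P :: "'a::finite \<Rightarrow> real set" and \<delta> :: "'a \<Rightarrow> real" and \<alpha> :: real
    and \<sigma> :: "'a \<Rightarrow> 'a list" and \<beta> z \<tau> :: complex and \<Gamma> \<gamma> :: "complex^'a"
    and e :: "'a label \<Rightarrow> nat" and H :: "complex \<times> 'a label \<Rightarrow> complex \<times> 'a label"
    and \<omega> :: "int \<Rightarrow> 'a" and d :: "nat \<Rightarrow> 'a label"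
  assumes "interval_exchange T P \<delta>" and "minimal_iem T"
    and "self_similar_on T \<alpha>" and "associated_substitution T P \<alpha> \<sigma>" and "primitive_subst \<sigma>"
    and "cmod \<beta> > 1" and "\<forall>n>0. sgn \<beta> ^ n \<noteq> 1"
    and "eigenvector (subst_matrix \<sigma>) \<beta> \<Gamma>" and "unique_representation \<sigma> \<beta> \<Gamma>"
    and "minimizing_map \<sigma> \<beta> \<Gamma> H" and "bij_betw e (labels \<sigma>) {..<card (labels \<sigma>)}"
    and "\<gamma> = z *s \<Gamma>" and "good_eigenvector \<sigma> \<beta> \<Gamma> \<gamma>" and "\<tau> = sgn z"
    and "\<omega> \<in> subshift \<sigma>" and "minimal_sequence \<gamma> \<omega>" and "prefix_suffix_decomposition \<sigma> \<omega> d"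
  shows "\<exists>n J. minimal_component \<sigma> e H J \<and> bij_betw H J J \<and>
           (sgn \<beta> ^ n * \<tau>, d n) \<in> J \<and>
           (\<forall>m\<ge>n. (sgn \<beta> ^ m * \<tau>, d m) = (inv_into J H ^^ (m - n)) (sgn \<beta> ^ n * \<tau>, d n))"
proof -
  interpret uniquely_representing \<sigma> \<beta> \<Gamma>
    using assms(6,8,9) primitive_nonempty[OF assms(5)] by unfold_locales (simp_all add: eigenvector_def)
  interpret circle_label_system \<sigma> "inverse (sgn \<beta>)" "limit_label H" e H
    using assms by (intro circle_label_system)
  have dl: "d m \<in> labels_of \<sigma> (center_of (d (Suc m)))" for m
    using assms by (simp add: prefix_suffix_decomposition_def)
  obtain z' where z': "z' \<noteq> 0" "\<gamma> = z' *s \<Gamma>" "good_direction \<sigma> \<beta> \<Gamma> (sgn z')"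
    using assms(13) by (auto simp: good_eigenvector_def)
  have "z' = z"
  proof -
    have "\<Gamma> \<noteq> 0" using assms(8) by (simp add: eigenvector_def)
    then show ?thesis using z'(2) assms(12) by simp
  qed
  with z' have z: "z \<noteq> 0" "good_direction \<sigma> \<beta> \<Gamma> \<tau>" using assms(14) by simp_all
  obtain A where A: "1 < A" "A < cmod \<beta>"
    "\<And>\<xi>. \<xi> \<in> ambiguous_directions \<sigma> \<beta> \<Gamma> \<Longrightarrow> liminf (\<lambda>n. ereal (A ^ n * arc_dist \<xi> (sgn \<beta> ^ n * \<tau>))) = \<infinity>"
    using z(2) unfolding good_direction_def by blast
  have t1: "cmod (sgn \<beta> ^ n * \<tau>) = 1" for n
    using z(1) \<beta>_nonzero assms(14) by (simp add: norm_mult norm_power norm_sgn)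
  \<comment> \<open>The label to be forced at time \<open>n\<close> is \<open>d (n - 1)\<close>; at \<open>0\<close> any minimizing label will do.\<close>
  define k where "k n = (if n = 0 then SOME l. minimizing_label \<sigma> \<beta> \<Gamma> (center_of (d 0)) \<tau> l else d (n - 1))" for n
  have k0: "minimizing_label \<sigma> \<beta> \<Gamma> (center_of (d 0)) \<tau> (k 0)"
    unfolding k_def using someI_ex[OF minimizing_label_exists] by simp
  have "\<forall>\<^sub>F n in sequentially. \<forall>l. minimizing_label \<sigma> \<beta> \<Gamma> (center_of (d n)) (sgn \<beta> ^ n * \<tau>) l \<longrightarrow> l = k n"
  proof (rule nearly_minimizing_label_forced[OF A(1,2) _ t1 A(3)])
    show "0 \<le> 2 * radius" using radius_nonneg by simp
    fix n
    show "k n \<in> labels_of \<sigma> (center_of (d n))"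
      using k0 dl[of "n - 1"] by (cases n) (simp_all add: minimizing_label_def k_def)
    show "min_Re (piece (center_of (d n)) (k n)) (sgn \<beta> ^ n * \<tau>)
        \<le> min_Re (whole (center_of (d n))) (sgn \<beta> ^ n * \<tau>) + 2 * radius / cmod \<beta> ^ n"
    proof (cases n)
      case 0
      then show ?thesis using k0 radius_nonneg by (simp add: minimizing_label_def)
    next
      case (Suc m)
      have "min_Re (piece (center_of (d (Suc m))) (d m)) (sgn \<beta> ^ Suc m * \<tau>)
        \<le> min_Re (whole (center_of (d (Suc m)))) (sgn \<beta> ^ Suc m * \<tau>) + 2 * radius / cmod \<beta> ^ Suc m"
        unfolding assms(14)
        by (rule minimal_sequence_nearly_minimizes[OF z(1)]) (use assms in auto)
      then show ?thesis unfolding Suc k_def by simp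
    qed
  qed
  then obtain n where n: "\<And>m l. m \<ge> n \<Longrightarrow>
      minimizing_label \<sigma> \<beta> \<Gamma> (center_of (d m)) (sgn \<beta> ^ m * \<tau>) l \<Longrightarrow> l = k m"
    unfolding eventually_sequentially by blast
  define x where "x m = (sgn \<beta> ^ m * \<tau>, d m)" for m
  have xX: "x m \<in> phase_space \<sigma>" for m
    using t1[of m] dl[of m] by (auto simp: x_def phase_space_def intro: labels_ofD)
  have Hx: "H (x (Suc m)) = x m" if "m \<ge> n" for m
  proof -
    have dL: "d (Suc m) \<in> labels \<sigma>" using dl by (rule labels_ofD)
    have "snd (H (x (Suc m))) = d m"
      unfolding x_def using n[OF _ minimizing_mapD(2)[OF assms(10) t1 dL]] that by (simp add: k_def)
    moreover have "fst (H (x (Suc m))) = sgn \<beta> ^ m * \<tau>"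
      unfolding x_def minimizing_mapD(1)[OF assms(10) t1 dL]
      using \<beta>_nonzero by (simp add: sgn_zero_iff)
    ultimately show ?thesis by (metis prod.collapse x_def)
  qed
  obtain J where J: "minimal_component \<sigma> e H J" "bij_betw H J J" "\<And>m. x (n + m) \<in> J"
    using backward_orbit_in_minimal_component[of "\<lambda>m. x (n + m)"] xX Hx by auto
  have x_pow: "x (n + i) = (inv_into J H ^^ i) (x n)" for i
  proof (induction i)
    case (Suc i)
    have "inv_into J H (x (n + i)) = x (n + Suc i)"
      using inv_into_f_f[OF bij_betw_imp_inj_on[OF J(2)] J(3)[of "Suc i"]] Hx[of "n + i"] by simp
    then show ?case using Suc by simp
  qed simp
  have "x m = (inv_into J H ^^ (m - n)) (x n)" if "m \<ge> n" for m
    using x_pow[of "m - n"] that by simp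
  moreover have "x n \<in> J" using J(3)[of 0] by simp
  ultimately have "minimal_component \<sigma> e H J \<and> bij_betw H J J \<and> x n \<in> J \<and>
      (\<forall>m\<ge>n. x m = (inv_into J H ^^ (m - n)) (x n))" using J(1,2) by blast
  then show ?thesis unfolding x_def by blast
qed

end
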